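(* For every $\gamma \in (0,\infty)$ and every $a > 1$, $$s_a^{\mathrm{loc}}(\gamma) = \min\left(\frac{1}{4}\, a \left(1 - \frac{1}{\gamma}\right)^{+},\ \frac{1}{4}\right),$$ where $s_a^{\mathrm{loc}}(\gamma)$ is the infimum of the values of $s > 0$ for which there is a constant $C$, independent of $f$, such that $\Vert P^{*}_{a,\gamma} f \Vert_{L^2([-1,1])} \leq C \Vert f \Vert_{H^s(\mathbb{R})}$ for all $f \in \mathcal{S}(\mathbb{R})$.
   Context: $\mathcal{S}(\mathbb{R})$ is the Schwartz class of (complex-valued) functions on $\mathbb{R}$. The Fourier transform is normalised as $\widehat{f}(\xi) = \int_{\mathbb{R}} f(x) e^{-ix\xi}\, dx$, and $\Vert f \Vert_{H^s(\mathbb{R})} = \left(\int_{\mathbb{R}} (1+\xi^2)^s |\widehat{f}(\xi)|^2 \, d\xi\right)^{1/2}$. For $a > 1$, $\gamma > 0$, $t > 0$ and $x \in \mathbb{R}$, define $$P^t_{a,\gamma} f(x) = \int_{\mathbb{R}} \widehat{f}(\xi)\, e^{it|\xi|^a} e^{-t^{\gamma}|\xi|^a} e^{ix\xi}\, d\xi,$$ and the maximal operator $P^{*}_{a,\gamma} f(x) = \sup_{t \in (0,1)} |P^t_{a,\gamma} f(x)|$. For $y \in \mathbb{R}$, $y^{+} = \max(0,y)$. *)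

theory Defs
  imports "HOL-Analysis.Analysis"
begin

definition iter_deriv :: "nat \<Rightarrow> (real \<Rightarrow> complex) \<Rightarrow> real \<Rightarrow> complex" where
  "iter_deriv n = (\<lambda>g x. vector_derivative g (at x)) ^^ n"

definition schwartz :: "(real \<Rightarrow> complex) set" where
  "schwartz = {f. \<forall>n. (\<forall>x. iter_deriv n f differentiable (at x)) \<and>
                      (\<forall>m. bounded (range (\<lambda>x. x ^ m *\<^sub>R iter_deriv n f x)))}"

definition fourier :: "(real \<Rightarrow> complex) \<Rightarrow> real \<Rightarrow> complex" where
  "fourier f \<xi> = (\<integral>x. f x * exp (- \<i> * of_real (x * \<xi>)) \<partial>lborel)"

(* Norms and suprema take values in [0, \<infinity>], so that a divergent one is \<infinity> and
   not the default value of a real-valued integral or supremum. *)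

definition ennsqrt :: "ennreal \<Rightarrow> ennreal" where
  "ennsqrt u = (if u = \<infinity> then \<infinity> else ennreal (sqrt (enn2real u)))"

definition sobolev_norm :: "real \<Rightarrow> (real \<Rightarrow> complex) \<Rightarrow> ennreal" where
  "sobolev_norm s f =
     ennsqrt (\<integral>\<^sup>+\<xi>. ennreal ((1 + \<xi>\<^sup>2) powr s * (cmod (fourier f \<xi>))\<^sup>2) \<partial>lborel)"

definition L2_norm_on :: "real set \<Rightarrow> (real \<Rightarrow> ennreal) \<Rightarrow> ennreal" where
  "L2_norm_on A g = ennsqrt (\<integral>\<^sup>+x\<in>A. (g x)\<^sup>2 \<partial>lborel)"

definition P :: "real \<Rightarrow> real \<Rightarrow> real \<Rightarrow> (real \<Rightarrow> complex) \<Rightarrow> real \<Rightarrow> complex" where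
  "P a \<gamma> t f x =
     (\<integral>\<xi>. fourier f \<xi> * exp (\<i> * of_real (t * \<bar>\<xi>\<bar> powr a))
            * of_real (exp (- (t powr \<gamma>) * \<bar>\<xi>\<bar> powr a))
            * exp (\<i> * of_real (x * \<xi>)) \<partial>lborel)"

definition P_max :: "real \<Rightarrow> real \<Rightarrow> (real \<Rightarrow> complex) \<Rightarrow> real \<Rightarrow> ennreal" where
  "P_max a \<gamma> f x = (SUP t\<in>{0<..<1}. ennreal (cmod (P a \<gamma> t f x)))"

(* The infimum is taken in the extended reals, where Inf {} = \<infinity>. *)
definition s_loc :: "real \<Rightarrow> real \<Rightarrow> ereal" where
  "s_loc a \<gamma> = Inf (ereal ` {s. s > 0 \<and>
     (\<exists>C::real. \<forall>f\<in>schwartz.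
        L2_norm_on {-1..1} (P_max a \<gamma> f) \<le> ennreal C * sobolev_norm s f)})"

end

theory Submission
  imports Defs "HOL-Probability.Probability"
begin

text \<open>
  Upper bound. Linearise the supremum by a measurable choice of times \<open>t(x)\<close> and compose the
  resulting operator with its adjoint. With \<open>\<tau> = t(x) - t(y)\<close>, \<open>c = t(x)^\<gamma> + t(y)^\<gamma> \<ge> |\<tau>|^\<gamma>\<close> and
  \<open>z = |x - y|\<close>, the kernel of the composition at \<open>(x, y)\<close> is the integral over \<open>\<xi>\<close> of
  \<open>exp (i (\<tau> |\<xi>|^a + (x - y) \<xi>))\<close> against the amplitude \<open>exp (- c |\<xi>|^a) (1 + \<xi>^2)^(- s)\<close>.
  Away from the stationary point \<open>r\<close>, given by \<open>|\<tau>| a r^(a - 1) = z\<close>, the first derivative test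
  bounds it by a multiple of \<open>z^(2 s - 1)\<close>; near \<open>r\<close> the second derivative test gives the amplitude
  at \<open>r / 2\<close> times \<open>(z / r)^(- 1 / 2)\<close>. For \<open>s > 1 / 4\<close> this is again at most a multiple of
  \<open>z^(2 s - 1)\<close>, since it only matters when \<open>r \<ge> 1 / (2 z)\<close>. For smaller \<open>s\<close> the powers of \<open>r\<close>
  are absorbed by the damping, whose exponent is comparable to \<open>|\<tau>|^\<gamma> r^a\<close>, and the power of \<open>z\<close>
  that remains is integrable exactly when \<open>4 s > a (1 - 1 / \<gamma>)\<close>. In either case Schur's test applies.

  Lower bound. Let \<open>\<sigma>\<close> be four times the claimed exponent. A Gaussian wave packet of frequency \<open>N\<close>
  and frequency width \<open>c N^(1 - \<sigma> / 2)\<close> is focused at each \<open>x\<close> in \<open>[- N^(\<sigma> - 1), 0)\<close> at the time \<open>t\<close>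
  with \<open>x + a t N^(a - 1) = 0\<close>, while the damping \<open>t^\<gamma> N^a\<close> is still bounded. Comparing norms as
  \<open>N\<close> tends to infinity forces \<open>4 s \<ge> \<sigma>\<close>.
\<close>

section \<open>Oscillatory integrals in one variable\<close>

text \<open>The exponent comes from |\<tau>| = z r^(1 - a) / a at the stationary point. With c >=
  |\<tau>|^\<gamma> it bounds the damping exponent c r^a from below by a multiple of z^\<gamma> r^e,
  where e = a - \<gamma> (a - 1), so the damping can be exchanged for any negative power of
  z^\<gamma> r^e, in particular the one that cancels r^(1/2 - 2 s). The obstacle is uniformity:
  times may be arbitrarily close to 0, where the damping fades and absolute convergence is lost. The
  quantitative bounds are therefore proved for truncated integrals, with constants depending on a,
  \<gamma> and s only. A positive lower bound on the times serves to make integrals exist, to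
  justify Fubini and to make the norm finite that the duality argument absorbs; it never enters a
  constant. In the lower bound the width N^(1 - \<sigma> / 2) is, up to a constant, the largest for
  which the quadratic part of the phase, of size t N^(a - 2) times the squared width with t about
  N^(\<sigma> - a), stays bounded. The squared norms to compare are then of sizes N^(\<sigma> - 1)
  and N^(2 s - 1 + \<sigma> / 2).\<close>

lemma cis_has_vector_derivative:
  assumes "(\<phi> has_real_derivative d) (at x)"
  shows "((\<lambda>x. cis (\<phi> x)) has_vector_derivative (\<i> * of_real d * cis (\<phi> x))) (at x)"
proof -
  have "((\<lambda>x. of_real (\<phi> x)) has_vector_derivative (of_real d)) (at x)"
    using assms by (intro has_vector_derivative_of_real) (simp add: has_real_derivative_iff_has_vector_derivative)
  moreover have "((\<lambda>z. exp (\<i> * z)) has_field_derivative (\<i> * exp (\<i> * of_real (\<phi> x)))) (at (of_real (\<phi> x)))"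
    by (auto intro!: derivative_eq_intros)
  ultimately have "((\<lambda>z. exp (\<i> * z)) \<circ> (\<lambda>x. of_real (\<phi> x)) has_vector_derivative
      of_real d * (\<i> * exp (\<i> * of_real (\<phi> x)))) (at x)"
    by (rule field_vector_diff_chain_at)
  then show ?thesis by (simp add: o_def cis_conv_exp mult_ac)
qed

text \<open>The sign conditions take the place of bounded variation: for a convex phase and a
  nonincreasing amplitude, the error of an integration by parts has a majorant with an explicit
  antiderivative. \<open>S\<close> will be the open half line, because |\<xi>|^a need not be twice
  differentiable at 0.\<close>

locale oscillatory =
  fixes S :: "real set" and \<phi> \<phi>' \<phi>'' A A' :: "real \<Rightarrow> real"
  assumes d\<phi>: "\<And>\<xi>. \<xi> \<in> S \<Longrightarrow> (\<phi> has_real_derivative \<phi>' \<xi>) (at \<xi>)"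
    and d\<phi>': "\<And>\<xi>. \<xi> \<in> S \<Longrightarrow> (\<phi>' has_real_derivative \<phi>'' \<xi>) (at \<xi>)"
    and dA: "\<And>\<xi>. \<xi> \<in> S \<Longrightarrow> (A has_real_derivative A' \<xi>) (at \<xi>)"
    and convex: "\<And>\<xi>. \<xi> \<in> S \<Longrightarrow> 0 \<le> \<phi>'' \<xi>"
    and A_nonneg: "\<And>\<xi>. \<xi> \<in> S \<Longrightarrow> 0 \<le> A \<xi>"
    and A'_nonpos: "\<And>\<xi>. \<xi> \<in> S \<Longrightarrow> A' \<xi> \<le> 0"
begin

lemma A_antimono:
  assumes "u \<le> v" "{u..v} \<subseteq> S"
  shows "A v \<le> A u"
  using assms by (intro DERIV_nonpos_imp_nonincreasing[of u v A]) (auto intro!: exI[of _ "A' _"] dA A'_nonpos)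

lemma continuous_on_integrand:
  assumes "{u..v} \<subseteq> S"
  shows "continuous_on {u..v} (\<lambda>\<xi>. cis (\<phi> \<xi>) * of_real (A \<xi>))"
proof -
  have "continuous_on {u..v} \<phi>" "continuous_on {u..v} A"
    using assms d\<phi> dA
    by (auto intro!: DERIV_continuous_on[of "{u..v}" \<phi> \<phi>'] DERIV_continuous_on[of "{u..v}" A A']
        intro: has_field_derivative_at_within)
  then show ?thesis by (intro continuous_intros continuous_on_cis)
qed

lemma integrable_integrand:
  assumes "{u..v} \<subseteq> S"
  shows "(\<lambda>\<xi>. cis (\<phi> \<xi>) * of_real (A \<xi>)) integrable_on {u..v}"
  by (intro integrable_continuous_real continuous_on_integrand assms)

lemma norm_integral_le_length:
  assumes "u \<le> v" "{u..v} \<subseteq> S"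
  shows "norm (integral {u..v} (\<lambda>\<xi>. cis (\<phi> \<xi>) * of_real (A \<xi>))) \<le> A u * (v - u)"
proof (intro integral_bound continuous_on_integrand assms)
  fix \<xi> assume "\<xi> \<in> {u..v}"
  moreover from this have "A \<xi> \<le> A u" "0 \<le> A \<xi>"
    using assms by (auto intro!: A_antimono A_nonneg)
  ultimately show "norm (cis (\<phi> \<xi>) * of_real (A \<xi>)) \<le> A u"
    by (simp add: norm_mult)
qed

text \<open>Integration by parts with \<open>h\<close>, the integrand divided by i times the phase
  derivative. The two boundary terms cost \<open>A u / \<mu>\<close> each and the remainder three
  times as much, hence the 5. Only the amplitude at the left end appears, since the amplitude is
  nonincreasing.\<close>

lemma van_der_corput_first:
  assumes "u \<le> v" and sub: "{u..v} \<subseteq> S" and "\<mu> > 0"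
    and \<mu>: "\<And>\<xi>. \<xi> \<in> {u..v} \<Longrightarrow> \<mu> \<le> \<bar>\<phi>' \<xi>\<bar>"
  shows "norm (integral {u..v} (\<lambda>\<xi>. cis (\<phi> \<xi>) * of_real (A \<xi>))) \<le> 5 * A u / \<mu>"
proof -
  have S: "\<xi> \<in> S" if "\<xi> \<in> {u..v}" for \<xi> using that sub by auto
  have nz: "\<phi>' \<xi> \<noteq> 0" if "\<xi> \<in> {u..v}" for \<xi> using \<mu>[OF that] \<open>\<mu> > 0\<close> by auto
  have Au: "A \<xi> \<le> A u" if "\<xi> \<in> {u..v}" for \<xi>
    using that sub by (intro A_antimono) auto
  note A = A_nonneg[OF S] A'_nonpos[OF S]
  note dA = dA[OF S] and d\<phi>' = d\<phi>'[OF S] and d\<phi> = d\<phi>[OF S] and convex = convex[OF S]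
  define h where "h \<xi> = cis (\<phi> \<xi>) * of_real (A \<xi> / \<phi>' \<xi>) / \<i>" for \<xi>
  define e where "e \<xi> = cis (\<phi> \<xi>) * of_real ((A' \<xi> * \<phi>' \<xi> - A \<xi> * \<phi>'' \<xi>) / (\<phi>' \<xi>)\<^sup>2) / \<i>" for \<xi>
  \<comment> \<open>Majorant of the error \<open>e\<close>: |\<phi>'| is replaced by \<mu> in the
    term with \<open>A'\<close>, and \<open>A\<close> by \<open>A u\<close> in the other. The result
    is the derivative of - A / \<mu> - A u / \<phi>', so its integral is a difference of boundary
    values.\<close>
  define g where "g \<xi> = - A' \<xi> / \<mu> + A u * (\<phi>'' \<xi> / (\<phi>' \<xi>)\<^sup>2)" for \<xi>
  have dh: "(h has_vector_derivative (cis (\<phi> \<xi>) * of_real (A \<xi>) + e \<xi>)) (at \<xi>)" if "\<xi> \<in> {u..v}" for \<xi>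
  proof -
    have "((\<lambda>\<xi>. A \<xi> / \<phi>' \<xi>) has_real_derivative ((A' \<xi> * \<phi>' \<xi> - A \<xi> * \<phi>'' \<xi>) / (\<phi>' \<xi>)\<^sup>2)) (at \<xi>)"
      using dA[OF that] d\<phi>'[OF that] nz[OF that] by (auto intro!: derivative_eq_intros simp: power2_eq_square)
    then have q: "((\<lambda>\<xi>. complex_of_real (A \<xi> / \<phi>' \<xi>)) has_vector_derivative
        (of_real ((A' \<xi> * \<phi>' \<xi> - A \<xi> * \<phi>'' \<xi>) / (\<phi>' \<xi>)\<^sup>2))) (at \<xi>)"
      by (intro has_vector_derivative_of_real) (simp add: has_real_derivative_iff_has_vector_derivative)
    have "(h has_vector_derivative
       ((cis (\<phi> \<xi>) * of_real ((A' \<xi> * \<phi>' \<xi> - A \<xi> * \<phi>'' \<xi>) / (\<phi>' \<xi>)\<^sup>2) +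
        (\<i> * of_real (\<phi>' \<xi>) * cis (\<phi> \<xi>)) * of_real (A \<xi> / \<phi>' \<xi>)) * (1/\<i>))) (at \<xi>)"
      unfolding h_def divide_inverse[of _ \<i>] divide_inverse[of 1 \<i>] mult_1
      by (intro has_vector_derivative_mult_left has_vector_derivative_mult cis_has_vector_derivative d\<phi> that q)
    moreover have "(cis (\<phi> \<xi>) * of_real ((A' \<xi> * \<phi>' \<xi> - A \<xi> * \<phi>'' \<xi>) / (\<phi>' \<xi>)\<^sup>2) +
        (\<i> * of_real (\<phi>' \<xi>) * cis (\<phi> \<xi>)) * of_real (A \<xi> / \<phi>' \<xi>)) * (1/\<i>) = cis (\<phi> \<xi>) * of_real (A \<xi>) + e \<xi>"
      using nz[OF that] unfolding e_def by (simp add: algebra_simps)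
    ultimately show ?thesis by simp
  qed
  have Ih: "((\<lambda>\<xi>. cis (\<phi> \<xi>) * of_real (A \<xi>) + e \<xi>) has_integral (h v - h u)) {u..v}"
    using \<open>u \<le> v\<close> dh by (intro fundamental_theorem_of_calculus) (auto intro: has_vector_derivative_at_within)
  have If: "(\<lambda>\<xi>. cis (\<phi> \<xi>) * of_real (A \<xi>)) integrable_on {u..v}"
    using sub by (rule integrable_integrand)
  have Ie: "(e has_integral (h v - h u - integral {u..v} (\<lambda>\<xi>. cis (\<phi> \<xi>) * of_real (A \<xi>)))) {u..v}"
    using has_integral_diff[OF Ih integrable_integral[OF If]] by simp
  have Ig: "(g has_integral ((- A v / \<mu> - A u / \<phi>' v) - (- A u / \<mu> - A u / \<phi>' u))) {u..v}"
  proof (intro fundamental_theorem_of_calculus \<open>u \<le> v\<close>)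
    fix \<xi> assume \<xi>: "\<xi> \<in> {u..v}"
    have "((\<lambda>\<xi>. - A \<xi> / \<mu> - A u / \<phi>' \<xi>) has_real_derivative g \<xi>) (at \<xi>)"
      using dA[OF \<xi>] d\<phi>'[OF \<xi>] nz[OF \<xi>] \<open>\<mu> > 0\<close>
      by (auto intro!: derivative_eq_intros simp: g_def power2_eq_square)
    then show "((\<lambda>\<xi>. - A \<xi> / \<mu> - A u / \<phi>' \<xi>) has_vector_derivative g \<xi>) (at \<xi> within {u..v})"
      by (simp add: has_real_derivative_iff_has_vector_derivative has_vector_derivative_at_within)
  qed
  have eg: "norm (e \<xi>) \<le> g \<xi>" if \<xi>: "\<xi> \<in> {u..v}" for \<xi>
  proof -
    have "norm (e \<xi>) = \<bar>A' \<xi> * \<phi>' \<xi> - A \<xi> * \<phi>'' \<xi>\<bar> / (\<phi>' \<xi>)\<^sup>2"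
      by (simp add: e_def norm_mult norm_divide del: of_real_divide of_real_mult of_real_diff of_real_power)
    also have "\<dots> \<le> (- A' \<xi> * \<bar>\<phi>' \<xi>\<bar> + A \<xi> * \<phi>'' \<xi>) / (\<phi>' \<xi>)\<^sup>2"
    proof (intro divide_right_mono)
      have "\<bar>A' \<xi> * \<phi>' \<xi> - A \<xi> * \<phi>'' \<xi>\<bar> \<le> \<bar>A' \<xi> * \<phi>' \<xi>\<bar> + \<bar>A \<xi> * \<phi>'' \<xi>\<bar>" by simp
      also have "\<dots> = - A' \<xi> * \<bar>\<phi>' \<xi>\<bar> + A \<xi> * \<phi>'' \<xi>"
        using A[OF \<xi>] convex[OF \<xi>] by (simp add: abs_mult)
      finally show "\<bar>A' \<xi> * \<phi>' \<xi> - A \<xi> * \<phi>'' \<xi>\<bar> \<le> - A' \<xi> * \<bar>\<phi>' \<xi>\<bar> + A \<xi> * \<phi>'' \<xi>" .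
    qed simp
    also have "\<dots> = - A' \<xi> / \<bar>\<phi>' \<xi>\<bar> + A \<xi> * (\<phi>'' \<xi> / (\<phi>' \<xi>)\<^sup>2)"
      using nz[OF \<xi>] by (simp add: add_divide_distrib diff_divide_distrib power2_eq_square abs_if)
    also have "\<dots> \<le> g \<xi>"
      unfolding g_def using A[OF \<xi>] convex[OF \<xi>] \<mu>[OF \<xi>] \<open>\<mu> > 0\<close> Au[OF \<xi>]
      by (intro add_mono divide_left_mono mult_right_mono divide_nonneg_nonneg mult_pos_pos) auto
    finally show ?thesis .
  qed
  have inv: "1 / \<bar>\<phi>' \<xi>\<bar> \<le> 1 / \<mu>" if "\<xi> \<in> {u..v}" for \<xi>
    using \<mu>[OF that] \<open>\<mu> > 0\<close> by (simp add: frac_le)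
  have uv: "u \<in> {u..v}" "v \<in> {u..v}" using \<open>u \<le> v\<close> by auto
  have A0: "0 \<le> A u" "0 \<le> A v" using A uv by auto
  have nh: "norm (h \<xi>) \<le> A u / \<mu>" if \<xi>: "\<xi> \<in> {u..v}" for \<xi>
  proof -
    have "norm (h \<xi>) = A \<xi> * (1 / \<bar>\<phi>' \<xi>\<bar>)" using A(1)[OF \<xi>] by (simp add: h_def norm_mult norm_divide del: of_real_divide)
    also have "\<dots> \<le> A u * (1 / \<mu>)" using inv[OF \<xi>] Au[OF \<xi>] A(1)[OF \<xi>] \<open>\<mu> > 0\<close> by (intro mult_mono) auto
    finally show ?thesis by simp
  qed
  have ig: "integral {u..v} g \<le> 3 * A u / \<mu>"
  proof -
    have "\<bar>A u / \<phi>' \<xi>\<bar> \<le> A u / \<mu>" if "\<xi> \<in> {u..v}" for \<xi>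
      using mult_left_mono[OF inv[OF that] A0(1)] A0 by (simp add: abs_divide)
    from this[OF uv(1)] this[OF uv(2)] have "- A u / \<phi>' v + A u / \<phi>' u \<le> 2 * (A u / \<mu>)" by linarith
    moreover have "- A v / \<mu> \<le> 0" using A0 \<open>\<mu> > 0\<close> by simp
    ultimately show ?thesis using Ig by (simp add: integral_unique)
  qed
  have "norm (integral {u..v} e) \<le> integral {u..v} g"
    using Ie Ig eg by (intro integral_norm_bound_integral) (auto simp: has_integral_integrable)
  with ig have ne: "norm (integral {u..v} e) \<le> 3 * A u / \<mu>" by linarith
  have "integral {u..v} (\<lambda>\<xi>. cis (\<phi> \<xi>) * of_real (A \<xi>)) = h v - h u - integral {u..v} e"
    using integral_unique[OF Ie] by simp
  also have "norm \<dots> \<le> norm (h v) + norm (h u) + norm (integral {u..v} e)"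
    by (meson add_mono norm_triangle_ineq4 order_refl order_trans)
  also have "\<dots> \<le> A u / \<mu> + A u / \<mu> + 3 * A u / \<mu>"
    using nh uv ne by (intro add_mono) auto
  finally show ?thesis by simp
qed

lemma phase_deriv_increment:
  assumes "u \<le> v" "{u..v} \<subseteq> S" and \<rho>: "\<And>\<xi>. \<xi> \<in> {u..v} \<Longrightarrow> \<rho> \<le> \<phi>'' \<xi>"
  shows "\<rho> * (v - u) \<le> \<phi>' v - \<phi>' u"
proof -
  have "\<phi>' u - \<rho> * u \<le> \<phi>' v - \<rho> * v"
  proof (intro DERIV_nonneg_imp_nondecreasing[of u v "\<lambda>\<xi>. \<phi>' \<xi> - \<rho> * \<xi>"] \<open>u \<le> v\<close>)
    fix \<xi> assume "u \<le> \<xi>" "\<xi> \<le> v"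
    then have "\<xi> \<in> S" "\<rho> \<le> \<phi>'' \<xi>" using assms by auto
    then show "\<exists>y. ((\<lambda>\<xi>. \<phi>' \<xi> - \<rho> * \<xi>) has_real_derivative y) (at \<xi>) \<and> 0 \<le> y"
      by (intro exI[of _ "\<phi>'' \<xi> - \<rho>"]) (auto intro!: derivative_eq_intros d\<phi>')
  qed
  then show ?thesis by (simp add: algebra_simps)
qed

text \<open>Convexity and \<open>sign\<close> keep \<phi>' of one sign, so |\<phi>'| is at least
  \<rho> times the distance to one end. Removing a piece of length 1 / sqrt \<rho> at that end
  leaves |\<phi>'| >= sqrt \<rho>. The removed piece costs 1 by its length, the rest 5 by the first
  derivative test.\<close>

lemma van_der_corput_second:
  assumes "u \<le> v" and sub: "{u..v} \<subseteq> S" and "\<rho> > 0"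
    and \<rho>: "\<And>\<xi>. \<xi> \<in> {u..v} \<Longrightarrow> \<rho> \<le> \<phi>'' \<xi>"
    and sign: "0 \<le> \<phi>' u \<or> \<phi>' v \<le> 0"
  shows "norm (integral {u..v} (\<lambda>\<xi>. cis (\<phi> \<xi>) * of_real (A \<xi>))) \<le> 6 * A u / sqrt \<rho>"
proof -
  let ?f = "\<lambda>\<xi>. cis (\<phi> \<xi>) * of_real (A \<xi>)"
  define d where "d = 1 / sqrt \<rho>"
  have d: "d > 0" "\<rho> * d = sqrt \<rho>" using \<open>\<rho> > 0\<close> by (auto simp: d_def field_simps)
  have Au: "0 \<le> A u" using sub \<open>u \<le> v\<close> by (auto intro: A_nonneg)
  have split: "norm (integral {u..v} ?f) \<le> norm (integral {u..w} ?f) + norm (integral {w..v} ?f)"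
    if "w \<in> {u..v}" for w
  proof -
    have "integral {u..v} ?f = integral {u..w} ?f + integral {w..v} ?f"
      using that by (intro Henstock_Kurzweil_Integration.integral_combine[symmetric] integrable_integrand[OF sub]) auto
    then show ?thesis by (simp add: norm_triangle_ineq)
  qed
  have mono: "\<phi>' \<eta> + \<rho> * (\<xi> - \<eta>) \<le> \<phi>' \<xi>" if "u \<le> \<eta>" "\<eta> \<le> \<xi>" "\<xi> \<le> v" for \<eta> \<xi>
  proof -
    have "{\<eta>..\<xi>} \<subseteq> {u..v}" using that by auto
    then have "\<rho> * (\<xi> - \<eta>) \<le> \<phi>' \<xi> - \<phi>' \<eta>"
      using that sub \<rho> by (intro phase_deriv_increment) blast+
    then show ?thesis by linarith
  qed
  have short: "norm (integral {p..q} ?f) \<le> A u / sqrt \<rho>" if "u \<le> p" "p \<le> q" "q \<le> v" "q \<le> p + d" for p q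
  proof -
    have "norm (integral {p..q} ?f) \<le> A p * (q - p)"
      using that sub by (intro norm_integral_le_length) auto
    also have "\<dots> \<le> A u * d"
      using that sub Au by (intro mult_mono A_antimono) auto
    finally show ?thesis by (simp add: d_def)
  qed
  have long: "norm (integral {p..q} ?f) \<le> 5 * A u / sqrt \<rho>" if "u \<le> p" "p \<le> q" "q \<le> v"
     and "\<And>\<xi>. \<xi> \<in> {p..q} \<Longrightarrow> sqrt \<rho> \<le> \<bar>\<phi>' \<xi>\<bar>" for p q
  proof -
    have "norm (integral {p..q} ?f) \<le> 5 * A p / sqrt \<rho>"
      using that sub \<open>\<rho> > 0\<close> by (intro van_der_corput_first) auto
    also have "\<dots> \<le> 5 * A u / sqrt \<rho>"
      using that sub \<open>\<rho> > 0\<close> by (intro divide_right_mono mult_left_mono A_antimono) auto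
    finally show ?thesis .
  qed
  have pos: "0 \<le> 5 * A u / sqrt \<rho>" using Au \<open>\<rho> > 0\<close> by simp
  from sign show ?thesis
  proof
    assume s: "0 \<le> \<phi>' u"
    show ?thesis
    proof (cases "u + d \<le> v")
      case True
      have "norm (integral {u + d..v} ?f) \<le> 5 * A u / sqrt \<rho>"
      proof (rule long)
        fix \<xi> assume \<xi>: "\<xi> \<in> {u + d..v}"
        have "sqrt \<rho> \<le> \<rho> * (\<xi> - u)"
          using \<xi> \<open>\<rho> > 0\<close> unfolding d(2)[symmetric] by (intro mult_left_mono) auto
        then show "sqrt \<rho> \<le> \<bar>\<phi>' \<xi>\<bar>" using mono[of u \<xi>] \<xi> d s by auto
      qed (use True d in auto)
      moreover have "norm (integral {u..u + d} ?f) \<le> A u / sqrt \<rho>"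
        using True d(1) by (intro short) linarith+
      moreover have "norm (integral {u..v} ?f) \<le> norm (integral {u..u + d} ?f) + norm (integral {u + d..v} ?f)"
        using True d(1) by (intro split) simp
      ultimately show ?thesis by (simp add: add_divide_distrib)
    next
      case False
      then have "norm (integral {u..v} ?f) \<le> A u / sqrt \<rho>"
        using \<open>u \<le> v\<close> by (intro short) linarith+
      with pos show ?thesis by simp
    qed
  next
    assume s: "\<phi>' v \<le> 0"
    show ?thesis
    proof (cases "u \<le> v - d")
      case True
      have "norm (integral {u..v - d} ?f) \<le> 5 * A u / sqrt \<rho>"
      proof (rule long)
        fix \<xi> assume \<xi>: "\<xi> \<in> {u..v - d}"
        have "sqrt \<rho> \<le> \<rho> * (v - \<xi>)"
          using \<xi> \<open>\<rho> > 0\<close> unfolding d(2)[symmetric] by (intro mult_left_mono) auto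
        then show "sqrt \<rho> \<le> \<bar>\<phi>' \<xi>\<bar>" using mono[of \<xi> v] \<xi> d s by auto
      qed (use True d in auto)
      moreover have "norm (integral {v - d..v} ?f) \<le> A u / sqrt \<rho>"
        using True d(1) by (intro short) linarith+
      moreover have "norm (integral {u..v} ?f) \<le> norm (integral {u..v - d} ?f) + norm (integral {v - d..v} ?f)"
        using True d(1) by (intro split) simp
      ultimately show ?thesis by (simp add: add_divide_distrib)
    next
      case False
      then have "norm (integral {u..v} ?f) \<le> A u / sqrt \<rho>"
        using \<open>u \<le> v\<close> by (intro short) linarith+
      with pos show ?thesis by simp
    qed
  qed
qed

end

section \<open>The kernel of the linearised maximal operator\<close>

definition phase :: "real \<Rightarrow> real \<Rightarrow> real \<Rightarrow> real \<Rightarrow> real" where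
  "phase a \<tau> x \<xi> = \<tau> * \<bar>\<xi>\<bar> powr a + x * \<xi>"

text \<open>Products stay in this family, \<open>s\<close> and \<open>c\<close> being added. The
  composition with the adjoint multiplies two such factors with parameter
  \<open>s / 2\<close>.\<close>

definition amplitude :: "real \<Rightarrow> real \<Rightarrow> real \<Rightarrow> real \<Rightarrow> real" where
  "amplitude a s c \<xi> = exp (- c * \<bar>\<xi>\<bar> powr a) * (1 + \<xi>\<^sup>2) powr (- s)"

lemma amplitude_nonneg [simp]: "0 \<le> amplitude a s c \<xi>"
  by (simp add: amplitude_def)

lemma one_plus_square_pos [simp]: "0 < 1 + (\<xi>::real)\<^sup>2"
  by (simp add: add_pos_nonneg)

lemma amplitude_le_exp:
  assumes "0 \<le> s"
  shows "amplitude a s c \<xi> \<le> exp (- c * \<bar>\<xi>\<bar> powr a)"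
proof -
  have "(1 + \<xi>\<^sup>2) powr (- s) \<le> 1 powr (- s)"
    using assms by (intro powr_mono2') auto
  then show ?thesis by (simp add: amplitude_def mult_left_le)
qed

lemma amplitude_le:
  assumes "0 \<le> s" "0 < \<xi>"
  shows "amplitude a s c \<xi> \<le> exp (- c * \<xi> powr a) * \<xi> powr (- 2 * s)"
proof -
  have "(1 + \<xi>\<^sup>2) powr (- s) \<le> (\<xi>\<^sup>2) powr (- s)"
    using assms by (intro powr_mono2') auto
  also have "\<dots> = \<xi> powr (- 2 * s)"
    using assms by (simp add: powr_powr flip: powr_numeral)
  finally show ?thesis using assms by (auto simp: amplitude_def intro!: mult_left_mono)
qed

lemma amplitude_le_powr:
  assumes "0 \<le> s" "0 \<le> c" "0 < \<xi>"
  shows "amplitude a s c \<xi> \<le> \<xi> powr (- 2 * s)"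
proof -
  have "exp (- c * \<xi> powr a) * \<xi> powr (- 2 * s) \<le> 1 * \<xi> powr (- 2 * s)"
    using assms by (intro mult_right_mono) auto
  with amplitude_le[of s \<xi> a c] assms show ?thesis by linarith
qed

lemma continuous_on_phase_amplitude:
  assumes "0 < a"
  shows "continuous_on S (\<lambda>\<xi>. cis (phase a \<tau> x \<xi>) * of_real (amplitude a s c \<xi>))"
  unfolding phase_def amplitude_def
  by (intro continuous_intros continuous_on_cis continuous_on_powr')
     (use assms in \<open>auto simp: add_nonneg_eq_0_iff\<close>)

text \<open>Nonnegative \<tau> makes the phase convex on positive frequencies. Negative \<tau> is
  reached later by complex conjugation, negative frequencies by reflection.\<close>

lemma oscillatory_phase_amplitude:
  assumes "1 < a" "0 < s" "0 \<le> c" "0 \<le> \<tau>"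
  shows "oscillatory {0<..} (phase a \<tau> x) (\<lambda>\<xi>. \<tau> * a * \<xi> powr (a - 1) + x)
     (\<lambda>\<xi>. \<tau> * a * (a - 1) * \<xi> powr (a - 2)) (amplitude a s c)
     (\<lambda>\<xi>. - amplitude a s c \<xi> * (c * a * \<xi> powr (a - 1) + 2 * s * \<xi> / (1 + \<xi>\<^sup>2)))"
proof
  fix \<xi> :: real assume "\<xi> \<in> {0<..}"
  then have \<xi>: "\<xi> > 0" by simp
  have "\<forall>\<^sub>F \<eta> in nhds \<xi>. \<eta> \<in> {0<..}"
    using \<xi> by (intro eventually_nhds_in_open) auto
  then have ev: "\<forall>\<^sub>F \<eta> in nhds \<xi>. phase a \<tau> x \<eta> = \<tau> * \<eta> powr a + x * \<eta>"
    "\<forall>\<^sub>F \<eta> in nhds \<xi>. amplitude a s c \<eta> = exp (- c * \<eta> powr a) * (1 + \<eta>\<^sup>2) powr (- s)"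
    by (eventually_elim; simp add: phase_def amplitude_def)+
  show "(phase a \<tau> x has_real_derivative \<tau> * a * \<xi> powr (a - 1) + x) (at \<xi>)"
  proof -
    have "((\<lambda>\<xi>. \<tau> * \<xi> powr a + x * \<xi>) has_real_derivative \<tau> * a * \<xi> powr (a - 1) + x) (at \<xi>)"
      using \<xi> by (auto intro!: derivative_eq_intros)
    then show ?thesis
      by (subst DERIV_cong_ev[OF refl ev(1) refl])
  qed
  show "((\<lambda>\<xi>. \<tau> * a * \<xi> powr (a - 1) + x) has_real_derivative \<tau> * a * (a - 1) * \<xi> powr (a - 2)) (at \<xi>)"
    using \<xi> by (auto intro!: derivative_eq_intros)
  show "(amplitude a s c has_real_derivative
     - amplitude a s c \<xi> * (c * a * \<xi> powr (a - 1) + 2 * s * \<xi> / (1 + \<xi>\<^sup>2))) (at \<xi>)"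
  proof -
    have p: "(1 + \<xi>\<^sup>2) powr (- s - 1) = (1 + \<xi>\<^sup>2) powr (- s) / (1 + \<xi>\<^sup>2)"
      by (simp add: powr_diff)
    have "((\<lambda>\<xi>. exp (- c * \<xi> powr a)) has_real_derivative
        exp (- c * \<xi> powr a) * (- c * (a * \<xi> powr (a - 1)))) (at \<xi>)"
      using \<xi> by (auto intro!: derivative_eq_intros)
    moreover have "((\<lambda>\<xi>. (1 + \<xi>\<^sup>2) powr (- s)) has_real_derivative
        - s * (1 + \<xi>\<^sup>2) powr (- s - 1) * (2 * \<xi>)) (at \<xi>)"
    proof -
      have "((\<lambda>\<xi>. 1 + \<xi>\<^sup>2) has_real_derivative 2 * \<xi>) (at \<xi>)"
        by (auto intro!: derivative_eq_intros)
      from DERIV_fun_powr[OF this one_plus_square_pos, of "- s"] show ?thesis by simp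
    qed
    ultimately have "((\<lambda>\<xi>. exp (- c * \<xi> powr a) * (1 + \<xi>\<^sup>2) powr (- s)) has_real_derivative
      exp (- c * \<xi> powr a) * (- c * (a * \<xi> powr (a - 1))) * (1 + \<xi>\<^sup>2) powr (- s)
      + - s * (1 + \<xi>\<^sup>2) powr (- s - 1) * (2 * \<xi>) * exp (- c * \<xi> powr a)) (at \<xi>)"
      by (rule DERIV_mult)
    also have "exp (- c * \<xi> powr a) * (- c * (a * \<xi> powr (a - 1))) * (1 + \<xi>\<^sup>2) powr (- s)
      + - s * (1 + \<xi>\<^sup>2) powr (- s - 1) * (2 * \<xi>) * exp (- c * \<xi> powr a)
      = - (exp (- c * \<xi> powr a) * (1 + \<xi>\<^sup>2) powr (- s)) * (c * a * \<xi> powr (a - 1) + 2 * s * \<xi> / (1 + \<xi>\<^sup>2))"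
      unfolding p by (simp add: algebra_simps)
    finally have "((\<lambda>\<xi>. exp (- c * \<xi> powr a) * (1 + \<xi>\<^sup>2) powr (- s)) has_real_derivative
      - (exp (- c * \<xi> powr a) * (1 + \<xi>\<^sup>2) powr (- s)) * (c * a * \<xi> powr (a - 1) + 2 * s * \<xi> / (1 + \<xi>\<^sup>2))) (at \<xi>)" .
    moreover have "amplitude a s c \<xi> = exp (- c * \<xi> powr a) * (1 + \<xi>\<^sup>2) powr (- s)"
      using \<xi> by (simp add: amplitude_def)
    ultimately show ?thesis
      by (subst DERIV_cong_ev[OF refl ev(2) refl]) simp
  qed
  show "- amplitude a s c \<xi> * (c * a * \<xi> powr (a - 1) + 2 * s * \<xi> / (1 + \<xi>\<^sup>2)) \<le> 0"
    using assms \<xi> by (simp add: mult_nonneg_nonneg add_nonneg_nonneg)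
qed (use assms in auto)

text \<open>No oscillation is used: the amplitude is at most \<xi>^(- 2 s), which is integrable at 0
  because s < 1/2.\<close>

lemma low_frequency_bound:
  assumes "1 < a" "0 < s" "s < 1 / 2" "0 \<le> c" "0 \<le> L"
  shows "norm (integral {0..L} (\<lambda>\<xi>. cis (phase a \<tau> x \<xi>) * of_real (amplitude a s c \<xi>)))
    \<le> L powr (1 - 2 * s) / (1 - 2 * s)"
proof -
  have I: "((\<lambda>\<xi>. \<xi> powr (- 2 * s)) has_integral (L powr (- 2 * s + 1) / (- 2 * s + 1))) {0..L}"
    using assms by (intro has_integral_powr_from_0) auto
  \<comment> \<open>The summand supported at 0 is there because \<open>0 powr _ = 0\<close>, while
    the integrand has modulus 1 at 0. It is then dropped as a change on a null set.\<close>
  have "norm (integral {0..L} (\<lambda>\<xi>. cis (phase a \<tau> x \<xi>) * of_real (amplitude a s c \<xi>)))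
     \<le> integral {0..L} (\<lambda>\<xi>. \<xi> powr (- 2 * s) + (if \<xi> \<in> {0} then 1 else 0))"
  proof (intro integral_norm_bound_integral)
    show "(\<lambda>\<xi>. cis (phase a \<tau> x \<xi>) * of_real (amplitude a s c \<xi>)) integrable_on {0..L}"
      using assms by (intro integrable_continuous_real continuous_on_phase_amplitude) auto
    show "(\<lambda>\<xi>. \<xi> powr (- 2 * s) + (if \<xi> \<in> {0} then 1 else 0)) integrable_on {0..L}"
      by (rule integrable_spike_finite[OF _ _ has_integral_integrable[OF I], of "{0}"]) auto
    show "norm (cis (phase a \<tau> x \<xi>) * complex_of_real (amplitude a s c \<xi>))
         \<le> \<xi> powr (- 2 * s) + (if \<xi> \<in> {0} then 1 else 0)" if "\<xi> \<in> {0..L}" for \<xi>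
    proof (cases "\<xi> = 0")
      case True
      then show ?thesis using amplitude_le_exp[of s a c 0] assms by (simp add: norm_mult)
    next
      case False
      then show ?thesis using amplitude_le_powr[of s c \<xi> a] assms that by (simp add: norm_mult)
    qed
  qed
  also have "\<dots> = integral {0..L} (\<lambda>\<xi>. \<xi> powr (- 2 * s))"
    by (rule integral_spike[of "{0}"]) auto
  also have "\<dots> = L powr (1 - 2 * s) / (1 - 2 * s)"
    using integral_unique[OF I] by (simp add: add.commute)
  finally show ?thesis .
qed

text \<open>The two terms of the phase derivative cannot cancel, so its modulus is at least |x|.
  Frequencies below 1 / |x| contribute |x|^(2 s - 1) by size alone; above, the first derivative test
  gives (1 / |x|)^(- 2 s) / |x|, the same power. The bound does not depend on
  \<open>R\<close>.\<close>

lemma nonstationary_bound: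
  assumes a: "1 < a" and s: "0 < s" "s < 1 / 2" and c: "0 \<le> c" and \<tau>: "0 \<le> \<tau>"
    and x: "x \<noteq> 0" "0 < x \<or> \<tau> = 0" and R: "1 / \<bar>x\<bar> \<le> R"
  shows "norm (integral {0..R} (\<lambda>\<xi>. cis (phase a \<tau> x \<xi>) * of_real (amplitude a s c \<xi>)))
    \<le> (1 / (1 - 2 * s) + 5) * \<bar>x\<bar> powr (2 * s - 1)"
proof -
  let ?f = "\<lambda>\<xi>. cis (phase a \<tau> x \<xi>) * of_real (amplitude a s c \<xi>)"
  define L where "L = 1 / \<bar>x\<bar>"
  have L: "0 < L" "L \<le> R" using x R by (auto simp: L_def)
  have L': "L = \<bar>x\<bar> powr - 1" using x by (simp add: L_def powr_minus_divide)
  interpret oscillatory "{0<..}" "phase a \<tau> x" "\<lambda>\<xi>. \<tau> * a * \<xi> powr (a - 1) + x"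
    "\<lambda>\<xi>. \<tau> * a * (a - 1) * \<xi> powr (a - 2)" "amplitude a s c"
    "\<lambda>\<xi>. - amplitude a s c \<xi> * (c * a * \<xi> powr (a - 1) + 2 * s * \<xi> / (1 + \<xi>\<^sup>2))"
    using assms by (intro oscillatory_phase_amplitude) auto
  have "norm (integral {L..R} ?f) \<le> 5 * amplitude a s c L / \<bar>x\<bar>"
  proof (rule van_der_corput_first)
    fix \<xi>
    have "0 \<le> \<tau> * a * \<xi> powr (a - 1)" using a \<tau> by simp
    then show "\<bar>x\<bar> \<le> \<bar>\<tau> * a * \<xi> powr (a - 1) + x\<bar>" using x by auto
  qed (use L x(1) in auto)
  also have "\<dots> \<le> 5 * L powr (- 2 * s) / \<bar>x\<bar>"
    using s c L by (intro divide_right_mono mult_left_mono amplitude_le_powr) simp_all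
  also have "\<dots> = 5 * \<bar>x\<bar> powr (2 * s - 1)"
    using x unfolding L' powr_powr by (simp add: powr_diff)
  finally have hi: "norm (integral {L..R} ?f) \<le> 5 * \<bar>x\<bar> powr (2 * s - 1)" .
  have "- 1 * (1 - 2 * s) = 2 * s - 1" by simp
  then have "L powr (1 - 2 * s) = \<bar>x\<bar> powr (2 * s - 1)"
    unfolding L' powr_powr by (rule arg_cong)
  moreover have "norm (integral {0..L} ?f) \<le> L powr (1 - 2 * s) / (1 - 2 * s)"
    using a s c L(1) by (intro low_frequency_bound) simp_all
  ultimately have lo: "norm (integral {0..L} ?f) \<le> \<bar>x\<bar> powr (2 * s - 1) / (1 - 2 * s)" by simp
  have "integral {0..R} ?f = integral {0..L} ?f + integral {L..R} ?f"
    using L a by (intro Henstock_Kurzweil_Integration.integral_combine[symmetric] integrable_continuous_real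
        continuous_on_phase_amplitude) simp_all
  then have "norm (integral {0..R} ?f) \<le> norm (integral {0..L} ?f) + norm (integral {L..R} ?f)"
    by (simp add: norm_triangle_ineq)
  also have "\<dots> \<le> \<bar>x\<bar> powr (2 * s - 1) / (1 - 2 * s) + 5 * \<bar>x\<bar> powr (2 * s - 1)"
    using lo hi by (rule add_mono)
  finally show ?thesis by (simp add: distrib_right)
qed

text \<open>The range is cut at 1 / z and at r / 2, r, 2 r. \<open>\<kappa>\<close> bounds |\<phi>'|
  / z from below outside (r / 2, 2 r), and \<open>\<kappa>'\<close> bounds r \<phi>'' / z from below
  inside. The two outer pieces give 10 / \<kappa>, the two inner ones 12. The inner ones occur only
  if 2 r reaches 1 / z, since everything below 1 / z is estimated by size.\<close>

lemma stationary_bound: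
  assumes a: "1 < a" and s: "0 < s" "s < 1 / 2" and c: "0 \<le> c" and \<tau>: "0 < \<tau>"
    and z: "0 < z" and r: "0 < r" "\<tau> * a * r powr (a - 1) = z" and R: "1 / z \<le> R" "2 * r \<le> R"
  defines "\<kappa> \<equiv> 1 - 2 powr (1 - a)" and "\<kappa>' \<equiv> (a - 1) * 2 powr (- \<bar>a - 2\<bar>)"
  shows "norm (integral {0..R} (\<lambda>\<xi>. cis (phase a \<tau> (- z) \<xi>) * of_real (amplitude a s c \<xi>)))
    \<le> (1 / (1 - 2 * s) + 10 / \<kappa>) * z powr (2 * s - 1) +
       (if 1 / z \<le> 2 * r then 12 * amplitude a s c (r / 2) / sqrt (\<kappa>' * z / r) else 0)"
proof -
  let ?f = "\<lambda>\<xi>. cis (phase a \<tau> (- z) \<xi>) * of_real (amplitude a s c \<xi>)"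
  define L where "L = 1 / z"
  have L: "0 < L" "L \<le> R" using z R by (simp_all add: L_def)
  have L': "L = z powr - 1" using z by (simp add: L_def powr_minus_divide)
  define E where "E = (if L \<le> 2 * r then 6 * amplitude a s c (r / 2) / sqrt (\<kappa>' * z / r) else 0)"
  interpret oscillatory "{0<..}" "phase a \<tau> (- z)" "\<lambda>\<xi>. \<tau> * a * \<xi> powr (a - 1) + - z"
    "\<lambda>\<xi>. \<tau> * a * (a - 1) * \<xi> powr (a - 2)" "amplitude a s c"
    "\<lambda>\<xi>. - amplitude a s c \<xi> * (c * a * \<xi> powr (a - 1) + 2 * s * \<xi> / (1 + \<xi>\<^sup>2))"
    using a s c \<tau> by (intro oscillatory_phase_amplitude) simp_all
  have "2 powr (1 - a) < 2 powr 0" using a by (intro powr_less_mono) simp_all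
  then have \<kappa>: "0 < \<kappa>" by (simp add: \<kappa>_def)
  have \<kappa>': "0 < \<kappa>'" using a by (simp add: \<kappa>'_def)
  have E0: "0 \<le> E" using \<kappa>' z r by (simp add: E_def)
  \<comment> \<open>Because z = \<tau> a r^(a - 1), both derivatives are functions of \<xi> / r up
    to the factors z and z / r.\<close>
  have d1: "\<tau> * a * \<xi> powr (a - 1) + - z = z * ((\<xi> / r) powr (a - 1) - 1)" if "0 < \<xi>" for \<xi>
    using r that by (simp add: powr_divide right_diff_distrib flip: r(2))
  have d2: "\<tau> * a * (a - 1) * \<xi> powr (a - 2) = (a - 1) * z / r * (\<xi> / r) powr (a - 2)" if "0 < \<xi>" for \<xi>
  proof -
    have "r powr (a - 1) = r * r powr (a - 2)"
      using r powr_add[of r 1 "a - 2"] by simp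
    then show ?thesis using r that by (simp add: powr_divide flip: r(2))
  qed
  have left: "\<kappa> * z \<le> \<bar>\<tau> * a * \<xi> powr (a - 1) + - z\<bar>" if "0 < \<xi>" "\<xi> \<le> r / 2" for \<xi>
  proof -
    have "(\<xi> / r) powr (a - 1) \<le> (1 / 2) powr (a - 1)"
      using a that r by (intro powr_mono2) (simp_all add: divide_simps)
    also have "\<dots> = 2 powr (1 - a)" by (simp add: powr_divide powr_diff)
    finally have "\<kappa> * z \<le> z * (1 - (\<xi> / r) powr (a - 1))"
      using z by (simp add: \<kappa>_def mult.commute)
    then show ?thesis unfolding d1[OF that(1)] by (simp add: right_diff_distrib)
  qed
  have right: "\<kappa> * z \<le> \<bar>\<tau> * a * \<xi> powr (a - 1) + - z\<bar>" if "2 * r \<le> \<xi>" for \<xi>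
  proof -
    have "0 < \<xi>" using that r(1) by linarith
    have "2 powr (a - 1) \<le> (\<xi> / r) powr (a - 1)"
      using a that r by (intro powr_mono2) (simp_all add: divide_simps)
    moreover have "\<kappa> \<le> 2 powr (a - 1) - 1"
    proof -
      \<comment> \<open>With y = 2^(a - 1) this difference equals (y - 1)^2 / y, so the left side of
        the stationary point dictates the constant.\<close>
      have "0 \<le> (2 powr (a - 1) - 1) - (1 - 2 powr (1 - a))"
      proof -
        have p: "2 powr (1 - a) = 1 / 2 powr (a - 1)" by (simp add: powr_diff)
        have "(2::real) powr 0 \<le> 2 powr (a - 1)" using a by (intro powr_mono) simp_all
        then have "1 \<le> (2::real) powr (a - 1)" by simp
        then have "(1::real) / 2 powr (a - 1) * (2 powr (a - 1) - 1)^2 \<ge> 0" by simp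
        also have "(1::real) / 2 powr (a - 1) * (2 powr (a - 1) - 1)^2 = (2 powr (a - 1) - 1) - (1 - 2 powr (1 - a))"
          unfolding p by (simp add: power2_eq_square field_simps)
        finally show ?thesis .
      qed
      then show ?thesis by (simp add: \<kappa>_def)
    qed
    ultimately have "\<kappa> * z \<le> z * ((\<xi> / r) powr (a - 1) - 1)"
      using z by (simp add: mult.commute)
    then show ?thesis unfolding d1[OF \<open>0 < \<xi>\<close>] by linarith
  qed
  have mid: "\<kappa>' * z / r \<le> \<tau> * a * (a - 1) * \<xi> powr (a - 2)" if "r / 2 \<le> \<xi>" "\<xi> \<le> 2 * r" for \<xi>
  proof -
    have "0 < \<xi>" using that r(1) by linarith
    define w where "w = \<xi> / r"
    have w: "1 / 2 \<le> w" "w \<le> 2" using that r by (simp_all add: w_def divide_simps)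
    have "2 powr (- \<bar>a - 2\<bar>) \<le> w powr (a - 2)"
    proof (cases "a \<ge> 2")
      case True
      have "2 powr (- \<bar>a - 2\<bar>) = (1 / 2) powr (a - 2)" using True by (simp add: powr_divide powr_diff)
      also have "\<dots> \<le> w powr (a - 2)" using True w by (intro powr_mono2) simp_all
      finally show ?thesis .
    next
      case False
      then have "2 powr (- \<bar>a - 2\<bar>) = 2 powr (a - 2)" by simp
      also have "\<dots> \<le> w powr (a - 2)" using False w by (intro powr_mono2') simp_all
      finally show ?thesis .
    qed
    then have "(a - 1) * z / r * 2 powr (- \<bar>a - 2\<bar>) \<le> (a - 1) * z / r * w powr (a - 2)"
      using a z r by (intro mult_left_mono) simp_all
    then show ?thesis unfolding d2[OF \<open>0 < \<xi>\<close>] w_def \<kappa>'_def by (simp add: mult_ac)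
  qed
  have AL: "5 * amplitude a s c p / (\<kappa> * z) \<le> 5 / \<kappa> * z powr (2 * s - 1)" if "L \<le> p" for p
  proof -
    have "amplitude a s c p \<le> amplitude a s c L" using that L by (intro A_antimono) auto
    also have "\<dots> \<le> L powr (- 2 * s)" using s c L by (intro amplitude_le_powr) simp_all
    finally have "5 * amplitude a s c p / (\<kappa> * z) \<le> 5 * L powr (- 2 * s) / (\<kappa> * z)"
      using \<kappa> z by (intro divide_right_mono) simp_all
    also have "\<dots> = 5 / \<kappa> * z powr (2 * s - 1)"
      using z unfolding L' powr_powr by (simp add: powr_diff)
    finally show ?thesis .
  qed
  have crit: "\<tau> * a * r powr (a - 1) + - z = 0" using r by simp
  \<comment> \<open>Taking maxima with \<open>L\<close> shrinks the pieces below 1 / z to points, so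
    that a single splitting serves every position of \<open>r\<close> relative to
    \<open>L\<close>.\<close>
  define p1 p2 p3 where "p1 = max L (r / 2)" and "p2 = max L r" and "p3 = max L (2 * r)"
  have p: "L \<le> p1" "p1 \<le> p2" "p2 \<le> p3" "p3 \<le> R" "0 < p1" "0 < p2" "0 < p3"
    using L r R by (auto simp: p1_def p2_def p3_def)
  have i1: "norm (integral {L..p1} ?f) \<le> 5 / \<kappa> * z powr (2 * s - 1)"
  proof (cases "r / 2 \<le> L")
    case True
    then have "p1 = L" by (simp add: p1_def)
    then show ?thesis using \<kappa> z by simp
  next
    case False
    have "norm (integral {L..p1} ?f) \<le> 5 * amplitude a s c L / (\<kappa> * z)"
      using p L \<kappa> z False by (intro van_der_corput_first left) (auto simp: p1_def)
    with AL[of L] show ?thesis by simp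
  qed
  have i4: "norm (integral {p3..R} ?f) \<le> 5 / \<kappa> * z powr (2 * s - 1)"
  proof -
    have "norm (integral {p3..R} ?f) \<le> 5 * amplitude a s c p3 / (\<kappa> * z)"
      using p \<kappa> z by (intro van_der_corput_first right) (auto simp: p3_def)
    with AL[of p3] p show ?thesis by simp
  qed
  have AE: "6 * amplitude a s c q / sqrt (\<kappa>' * z / r) \<le> E" if "r / 2 \<le> q" "L \<le> 2 * r" for q
  proof -
    have "amplitude a s c q \<le> amplitude a s c (r / 2)" using that r by (intro A_antimono) auto
    then show ?thesis using that \<kappa>' z r unfolding E_def by (auto intro!: divide_right_mono)
  qed
  have i2: "norm (integral {p1..p2} ?f) \<le> E"
  proof (cases "r \<le> L")
    case True
    then have "p1 = p2" using r by (simp add: p1_def p2_def max_def)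
    then show ?thesis using E0 by simp
  next
    case False
    then have p2: "p2 = r" by (simp add: p2_def)
    have "norm (integral {p1..p2} ?f) \<le> 6 * amplitude a s c p1 / sqrt (\<kappa>' * z / r)"
    proof (rule van_der_corput_second)
      show "\<kappa>' * z / r \<le> \<tau> * a * (a - 1) * \<xi> powr (a - 2)" if "\<xi> \<in> {p1..p2}" for \<xi>
        using that p2 r by (intro mid) (auto simp: p1_def)
      show "0 \<le> \<tau> * a * p1 powr (a - 1) + - z \<or> \<tau> * a * p2 powr (a - 1) + - z \<le> 0"
        using crit p2 by simp
      show "{p1..p2} \<subseteq> {0<..}" using p by auto
    qed (use p \<kappa>' z r in simp_all)
    also have "\<dots> \<le> E" using False r by (intro AE) (auto simp: p1_def)
    finally show ?thesis .
  qed
  have i3: "norm (integral {p2..p3} ?f) \<le> E"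
  proof (cases "2 * r \<le> L")
    case True
    then have "p2 = p3" using r by (simp add: p2_def p3_def max_def)
    then show ?thesis using E0 by simp
  next
    case False
    then have p3: "p3 = 2 * r" by (simp add: p3_def)
    have "norm (integral {p2..p3} ?f) \<le> 6 * amplitude a s c p2 / sqrt (\<kappa>' * z / r)"
    proof (rule van_der_corput_second)
      show "\<kappa>' * z / r \<le> \<tau> * a * (a - 1) * \<xi> powr (a - 2)" if "\<xi> \<in> {p2..p3}" for \<xi>
        using that p3 r by (intro mid) (auto simp: p2_def)
      have "r powr (a - 1) \<le> p2 powr (a - 1)" using a r by (intro powr_mono2) (auto simp: p2_def)
      then have "\<tau> * a * r powr (a - 1) \<le> \<tau> * a * p2 powr (a - 1)"
        using \<tau> a by (intro mult_left_mono) simp_all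
      then show "0 \<le> \<tau> * a * p2 powr (a - 1) + - z \<or> \<tau> * a * p3 powr (a - 1) + - z \<le> 0"
        using crit by simp
      show "{p2..p3} \<subseteq> {0<..}" using p by auto
    qed (use p \<kappa>' z r in simp_all)
    also have "\<dots> \<le> E" using False r by (intro AE) (auto simp: p2_def)
    finally show ?thesis .
  qed
  have "- 1 * (1 - 2 * s) = 2 * s - 1" by simp
  then have "L powr (1 - 2 * s) = z powr (2 * s - 1)"
    unfolding L' powr_powr by (rule arg_cong)
  moreover have "norm (integral {0..L} ?f) \<le> L powr (1 - 2 * s) / (1 - 2 * s)"
    using a s c L(1) by (intro low_frequency_bound) simp_all
  ultimately have i0: "norm (integral {0..L} ?f) \<le> z powr (2 * s - 1) / (1 - 2 * s)" by simp
  have comb: "norm (integral {u..w} ?f) \<le> norm (integral {u..v} ?f) + norm (integral {v..w} ?f)"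
    if "u \<le> v" "v \<le> w" for u v w
  proof -
    have "integral {u..w} ?f = integral {u..v} ?f + integral {v..w} ?f"
      using a that by (intro Henstock_Kurzweil_Integration.integral_combine[symmetric] integrable_continuous_real
          continuous_on_phase_amplitude) simp_all
    then show ?thesis by (simp add: norm_triangle_ineq)
  qed
  have "norm (integral {0..R} ?f) \<le> z powr (2 * s - 1) / (1 - 2 * s)
     + (5 / \<kappa> * z powr (2 * s - 1) + (E + (E + 5 / \<kappa> * z powr (2 * s - 1))))"
    using comb[of 0 L R] comb[of L p1 R] comb[of p1 p2 R] comb[of p2 p3 R] L p i0 i1 i2 i3 i4
    by linarith
  also have "\<dots> = (1 / (1 - 2 * s) + 10 / \<kappa>) * z powr (2 * s - 1) + 2 * E"
    by (simp add: distrib_right)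
  finally show ?thesis by (simp add: E_def L_def split: if_splits)
qed

text \<open>Raise u / q <= exp (u / q) to the power \<open>q\<close>. This is how exponential decay
  is exchanged for a power, both in the damping and for Gaussians.\<close>

lemma exp_minus_le_powr:
  fixes q u :: real
  assumes "0 < q" "0 < u"
  shows "exp (- u) \<le> q powr q * u powr (- q)"
proof -
  have "u / q \<le> exp (u / q)" using exp_ge_add_one_self[of "u / q"] by linarith
  then have "(u / q) powr q \<le> exp (u / q) powr q" using assms by (intro powr_mono2) simp_all
  also have "\<dots> = exp u" using assms by (simp add: powr_def)
  finally have "u powr q \<le> exp u * q powr q" using assms by (simp add: powr_divide divide_simps)
  then show ?thesis using assms by (simp add: exp_minus powr_minus divide_simps mult.commute)
qed


text \<open>Without damping the quotient is at most of order r^(1/2 - 2 s) z^(- 1/2). For s > 1/4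
  the power of \<open>r\<close> is negative and r >= 1 / (2 z) suffices, with \<beta> = 1 - 2 s. For
  s < 1/4 it is positive, and large \<open>r\<close> has to be controlled by the damping.\<close>

lemma stationary_decay:
  fixes a \<gamma> s :: real
  assumes a: "1 < a" and \<gamma>: "0 < \<gamma>" and s: "0 < s" "s < 1 / 2"
    and s': "1 / 4 < s \<or> s < 1 / 4 \<and> a * (\<gamma> - 1) < 4 * s * \<gamma>"
  obtains C \<beta> :: real where "0 \<le> C" "0 \<le> \<beta>" "\<beta> < 1"
    "\<And>\<tau> c z r. \<lbrakk>0 < \<tau>; \<tau> powr \<gamma> \<le> c; 0 < z; 0 < r; \<tau> * a * r powr (a - 1) = z; 1 / z \<le> 2 * r\<rbrakk>
       \<Longrightarrow> amplitude a s c (r / 2) / sqrt (z / r) \<le> C * z powr (- \<beta>)"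
  using s'
proof
  assume s': "1 / 4 < s"
  show ?thesis
  proof (rule that)
    show "0 \<le> 2 powr (2 * s) * 2 powr (2 * s - 1 / 2)" "0 \<le> 1 - 2 * s" "1 - 2 * s < 1"
      using s by simp_all
    fix \<tau> c z r :: real
    assume *: "0 < \<tau>" "\<tau> powr \<gamma> \<le> c" "0 < z" "0 < r" "\<tau> * a * r powr (a - 1) = z" "1 / z \<le> 2 * r"
    have c: "0 \<le> c" using *(2) powr_ge_zero order_trans by blast
    have sq: "1 / sqrt (z / r) = z powr (- 1 / 2) * r powr (1 / 2)"
      using * by (simp add: real_sqrt_divide powr_half_sqrt powr_minus divide_simps)
    have h: "(r / 2) powr (- 2 * s) = 2 powr (2 * s) * r powr (- 2 * s)"
      using * by (simp add: powr_divide powr_minus divide_simps)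
    have "amplitude a s c (r / 2) / sqrt (z / r) \<le> (r / 2) powr (- 2 * s) * (1 / sqrt (z / r))"
      using amplitude_le_powr[of s c "r / 2" a] s c * by (simp add: divide_right_mono)
    also have "\<dots> = 2 powr (2 * s) * z powr (- 1 / 2) * (r powr (1 / 2) * r powr (- 2 * s))"
      unfolding sq h by (simp only: mult_ac)
    also have "r powr (1 / 2) * r powr (- 2 * s) = r powr (1 / 2 - 2 * s)"
      by (simp flip: powr_add)
    also have "2 powr (2 * s) * z powr (- 1 / 2) * r powr (1 / 2 - 2 * s)
      \<le> 2 powr (2 * s) * z powr (- 1 / 2) * (1 / (2 * z)) powr (1 / 2 - 2 * s)"
      using * s' by (intro mult_left_mono powr_mono2') (simp_all add: divide_simps mult_ac)
    also have "1 / (2 * z) = (2 * z) powr - 1"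
      using * by (simp add: powr_minus_divide)
    also have "((2 * z) powr - 1) powr (1 / 2 - 2 * s) = 2 powr (2 * s - 1 / 2) * z powr (2 * s - 1 / 2)"
      using * unfolding powr_powr by (simp add: powr_mult)
    also have "2 powr (2 * s) * z powr (- 1 / 2) * (2 powr (2 * s - 1 / 2) * z powr (2 * s - 1 / 2))
       = 2 powr (2 * s) * 2 powr (2 * s - 1 / 2) * (z powr (- 1 / 2) * z powr (2 * s - 1 / 2))"
      by (simp only: mult_ac)
    also have "z powr (- 1 / 2) * z powr (2 * s - 1 / 2) = z powr (- (1 - 2 * s))"
      unfolding powr_add[symmetric] by (rule arg_cong) simp
    finally show "amplitude a s c (r / 2) / sqrt (z / r)
      \<le> 2 powr (2 * s) * 2 powr (2 * s - 1 / 2) * z powr (- (1 - 2 * s))" .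
  qed
next
  assume s': "s < 1 / 4 \<and> a * (\<gamma> - 1) < 4 * s * \<gamma>"
  \<comment> \<open>Inserting \<tau> = z r^(1 - a) / a into \<tau>^\<gamma> (r / 2)^a gives k
    z^\<gamma> r^e with these \<open>e\<close> and \<open>k\<close>. \<open>e\<close> is positive
    because a (\<gamma> - 1) < 4 s \<gamma> < \<gamma>.\<close>
  define e where "e = a - \<gamma> * (a - 1)"
  \<comment> \<open>The decay power that removes \<open>r\<close> altogether: r^(- q e) r^(- 2 s)
    r^(1/2) = 1.\<close>
  define q where "q = (1 / 2 - 2 * s) / e"
  define k where "k = (1 / a) powr \<gamma> * (1 / 2) powr a"
  have "4 * s * \<gamma> < 1 * \<gamma>" using s' \<gamma> by (intro mult_strict_right_mono) simp_all
  with s' have e: "0 < e" by (simp add: e_def algebra_simps)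
  have q: "0 < q" "q * e = 1 / 2 - 2 * s" using s' e by (simp_all add: q_def)
  have k: "0 < k" using a by (simp add: k_def)
  show ?thesis
  proof (rule that)
    show "0 \<le> 2 powr (2 * s) * (q powr q * k powr (- q))" by simp
    show "0 \<le> 1 / 2 + q * \<gamma>" using q \<gamma> by simp
    \<comment> \<open>After clearing the denominator \<open>e\<close> this is the assumption a
      (\<gamma> - 1) < 4 s \<gamma> itself: here the critical exponent enters.\<close>
    show "1 / 2 + q * \<gamma> < 1" using s' e by (simp add: q_def e_def divide_simps algebra_simps)
    fix \<tau> c z r :: real
    assume *: "0 < \<tau>" "\<tau> powr \<gamma> \<le> c" "0 < z" "0 < r" "\<tau> * a * r powr (a - 1) = z" "1 / z \<le> 2 * r"
    have sq: "1 / sqrt (z / r) = z powr (- 1 / 2) * r powr (1 / 2)"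
      using * by (simp add: real_sqrt_divide powr_half_sqrt powr_minus divide_simps)
    have h: "(r / 2) powr (- 2 * s) = 2 powr (2 * s) * r powr (- 2 * s)"
      using * by (simp add: powr_divide powr_minus divide_simps)
    have \<tau>: "\<tau> = 1 / a * z * r powr (1 - a)"
      using * a by (simp add: powr_diff field_simps flip: *(5))
    have "\<tau> powr \<gamma> * (r / 2) powr a = k * (z powr \<gamma> * r powr e)"
    proof -
      have "r powr ((1 - a) * \<gamma>) * r powr a = r powr e"
        unfolding powr_add[symmetric] by (rule arg_cong) (simp add: e_def algebra_simps)
      moreover have "\<tau> powr \<gamma> = (1 / a) powr \<gamma> * z powr \<gamma> * r powr ((1 - a) * \<gamma>)"
        unfolding \<tau> using * a by (simp add: powr_mult powr_powr powr_divide)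
      moreover have "(r / 2) powr a = (1 / 2) powr a * r powr a"
        using * by (simp add: powr_divide)
      ultimately show ?thesis by (simp add: k_def mult_ac)
    qed
    moreover have "\<tau> powr \<gamma> * (r / 2) powr a \<le> c * (r / 2) powr a"
      using * by (intro mult_right_mono) simp_all
    ultimately have "exp (- c * (r / 2) powr a) \<le> exp (- (k * (z powr \<gamma> * r powr e)))" by simp
    also have "\<dots> \<le> q powr q * (k * (z powr \<gamma> * r powr e)) powr (- q)"
      using q k * by (intro exp_minus_le_powr) simp_all
    also have "(k * (z powr \<gamma> * r powr e)) powr (- q) = k powr (- q) * (z powr (- (q * \<gamma>)) * r powr (- (q * e)))"
      using k * by (simp add: powr_mult powr_powr mult_ac)
    finally have ex: "exp (- c * (r / 2) powr a)
      \<le> q powr q * k powr (- q) * (z powr (- (q * \<gamma>)) * r powr (- (q * e)))" by (simp only: mult_ac)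
    have "amplitude a s c (r / 2) / sqrt (z / r)
       \<le> exp (- c * (r / 2) powr a) * ((r / 2) powr (- 2 * s) * (1 / sqrt (z / r)))"
      using amplitude_le[of s "r / 2" a c] s * by (simp add: divide_right_mono)
    also have "\<dots> \<le> q powr q * k powr (- q) * (z powr (- (q * \<gamma>)) * r powr (- (q * e)))
        * ((r / 2) powr (- 2 * s) * (1 / sqrt (z / r)))"
      using * by (intro mult_right_mono ex) simp
    also have "\<dots> = 2 powr (2 * s) * (q powr q * k powr (- q)) * (z powr (- (q * \<gamma>)) * z powr (- 1 / 2))
        * (r powr (- (q * e)) * r powr (- 2 * s) * r powr (1 / 2))"
      unfolding sq h by (simp only: mult_ac)
    also have "r powr (- (q * e)) * r powr (- 2 * s) * r powr (1 / 2) = 1"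
      using *(4) unfolding powr_add[symmetric] q(2) by simp
    also have "z powr (- (q * \<gamma>)) * z powr (- 1 / 2) = z powr (- (1 / 2 + q * \<gamma>))"
      unfolding powr_add[symmetric] by (rule arg_cong) simp
    finally show "amplitude a s c (r / 2) / sqrt (z / r)
       \<le> 2 powr (2 * s) * (q powr q * k powr (- q)) * z powr (- (1 / 2 + q * \<gamma>))" by simp
  qed
qed


text \<open>The cut-off \<open>R\<close> has to pass 1 / |x| and twice the stationary point, which
  depends on \<tau>. Hence the \<open>eventually\<close>, with a bound that is nevertheless uniform
  in \<tau> and \<open>c\<close>. The exponent is the worse of 1 - 2 s and the one from the
  stationary part.\<close>

lemma half_line_kernel_bound:
  fixes a \<gamma> s :: real
  assumes a: "1 < a" and \<gamma>: "0 < \<gamma>" and s: "0 < s" "s < 1 / 2"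
    and s': "1 / 4 < s \<or> s < 1 / 4 \<and> a * (\<gamma> - 1) < 4 * s * \<gamma>"
  obtains C \<beta> :: real where "0 \<le> C" "0 \<le> \<beta>" "\<beta> < 1"
    "\<And>\<tau> c x. \<lbrakk>\<bar>\<tau>\<bar> powr \<gamma> \<le> c; x \<noteq> 0; \<bar>x\<bar> \<le> 2\<rbrakk> \<Longrightarrow> \<forall>\<^sub>F R in at_top.
       norm (integral {0..R} (\<lambda>\<xi>. cis (phase a \<tau> x \<xi>) * of_real (amplitude a s c \<xi>))) \<le> C * \<bar>x\<bar> powr (- \<beta>)"
proof -
  obtain D b where D: "0 \<le> D" "0 \<le> b" "b < 1"
    "\<And>\<tau> c z r. \<lbrakk>0 < \<tau>; \<tau> powr \<gamma> \<le> c; 0 < z; 0 < r; \<tau> * a * r powr (a - 1) = z; 1 / z \<le> 2 * r\<rbrakk>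
       \<Longrightarrow> amplitude a s c (r / 2) / sqrt (z / r) \<le> D * z powr (- b)"
    using stationary_decay[OF a \<gamma> s s'] by blast
  define \<kappa> where "\<kappa> = 1 - 2 powr (1 - a)"
  define \<kappa>' where "\<kappa>' = (a - 1) * 2 powr (- \<bar>a - 2\<bar>)"
  have "2 powr (1 - a) < 2 powr 0" using a by (intro powr_less_mono) simp_all
  then have \<kappa>: "0 < \<kappa>" by (simp add: \<kappa>_def)
  have \<kappa>': "0 < \<kappa>'" using a by (simp add: \<kappa>'_def)
  define B where "B = 1 / (1 - 2 * s) + 5 + 10 / \<kappa>"
  define B' where "B' = 12 / sqrt \<kappa>' * D"
  define \<beta> where "\<beta> = max (1 - 2 * s) b"
  have B: "0 \<le> B" "0 \<le> B'" using s \<kappa> \<kappa>' D by (simp_all add: B_def B'_def)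
  have \<beta>: "0 \<le> \<beta>" "\<beta> < 1" using s D by (simp_all add: \<beta>_def)
  \<comment> \<open>For z <= 2 an exponent may be increased to \<beta> at the price of the factor
    2^(\<beta> - e) <= 2.\<close>
  have weaken: "z powr (- e) \<le> 2 * z powr (- \<beta>)" if "0 < z" "z \<le> 2" "0 \<le> e" "e \<le> \<beta>" for z e :: real
  proof -
    have "z powr (\<beta> - e) \<le> 2 powr (\<beta> - e)" using that by (intro powr_mono2) simp_all
    also have "2 powr (\<beta> - e) \<le> 2 powr 1" using that \<beta> by (intro powr_mono) simp_all
    finally have "z powr (\<beta> - e) * z powr (- \<beta>) \<le> 2 * z powr (- \<beta>)"
      by (intro mult_right_mono) simp_all
    then show ?thesis by (simp flip: powr_add)
  qed
  have pos: "\<forall>\<^sub>F R in at_top. norm (integral {0..R} (\<lambda>\<xi>. cis (phase a \<tau> x \<xi>) * of_real (amplitude a s c \<xi>)))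
      \<le> 2 * (B + B') * \<bar>x\<bar> powr (- \<beta>)"
    if \<tau>: "0 \<le> \<tau>" "\<tau> powr \<gamma> \<le> c" and x: "x \<noteq> 0" "\<bar>x\<bar> \<le> 2" for \<tau> c x
  proof -
    let ?I = "\<lambda>R. integral {0..R} (\<lambda>\<xi>. cis (phase a \<tau> x \<xi>) * of_real (amplitude a s c \<xi>))"
    have c: "0 \<le> c" using \<tau>(2) powr_ge_zero order_trans by blast
    have w1: "\<bar>x\<bar> powr (2 * s - 1) \<le> 2 * \<bar>x\<bar> powr (- \<beta>)"
      using weaken[of "\<bar>x\<bar>" "1 - 2 * s"] x s by (simp add: \<beta>_def)
    have w2: "\<bar>x\<bar> powr (- b) \<le> 2 * \<bar>x\<bar> powr (- \<beta>)"
      using weaken[of "\<bar>x\<bar>" b] x D by (simp add: \<beta>_def)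
    have fin: "B * \<bar>x\<bar> powr (2 * s - 1) + B' * \<bar>x\<bar> powr (- b) \<le> 2 * (B + B') * \<bar>x\<bar> powr (- \<beta>)"
      using mult_left_mono[OF w1 B(1)] mult_left_mono[OF w2 B(2)] by (simp add: distrib_left distrib_right)
    show ?thesis
    proof (cases "0 < x \<or> \<tau> = 0")
      case True
      show ?thesis
      proof (rule eventually_mono[OF eventually_ge_at_top[of "1 / \<bar>x\<bar>"]])
        fix R assume "1 / \<bar>x\<bar> \<le> R"
        then have "norm (?I R) \<le> (1 / (1 - 2 * s) + 5) * \<bar>x\<bar> powr (2 * s - 1)"
          using a s c \<tau> x True by (intro nonstationary_bound) simp_all
        also have "\<dots> \<le> B * \<bar>x\<bar> powr (2 * s - 1)"
          using \<kappa> by (intro mult_right_mono) (simp_all add: B_def)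
        also have "\<dots> \<le> B * \<bar>x\<bar> powr (2 * s - 1) + B' * \<bar>x\<bar> powr (- b)" using B by simp
        finally show "norm (?I R) \<le> 2 * (B + B') * \<bar>x\<bar> powr (- \<beta>)" using fin by linarith
      qed
    next
      case False
      define z where "z = - x"
      have z: "0 < z" "x = - z" "\<bar>x\<bar> = z" and \<tau>': "0 < \<tau>" using False x \<tau> by (auto simp: z_def)
      define r where "r = (z / (\<tau> * a)) powr (1 / (a - 1))"
      have r: "0 < r" "\<tau> * a * r powr (a - 1) = z"
        using z \<tau>' a by (simp_all add: r_def powr_powr)
      show ?thesis
      proof (rule eventually_mono[OF eventually_ge_at_top[of "max (1 / z) (2 * r)"]])
        fix R assume R: "max (1 / z) (2 * r) \<le> R"
        let ?E = "if 1 / z \<le> 2 * r then 12 * amplitude a s c (r / 2) / sqrt (\<kappa>' * z / r) else 0"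
        have "norm (?I R) \<le> (1 / (1 - 2 * s) + 10 / \<kappa>) * z powr (2 * s - 1) + ?E"
          unfolding z(2) \<kappa>_def \<kappa>'_def using a s c \<tau>' z r R by (intro stationary_bound) simp_all
        moreover have "(1 / (1 - 2 * s) + 10 / \<kappa>) * z powr (2 * s - 1) \<le> B * z powr (2 * s - 1)"
          by (intro mult_right_mono) (simp_all add: B_def)
        moreover have "?E \<le> B' * z powr (- b)"
        proof (cases "1 / z \<le> 2 * r")
          case True
          have "sqrt (\<kappa>' * z / r) = sqrt \<kappa>' * sqrt (z / r)" by (simp flip: real_sqrt_mult)
          then have "?E = 12 / sqrt \<kappa>' * (amplitude a s c (r / 2) / sqrt (z / r))" using True by simp
          also have "\<dots> \<le> 12 / sqrt \<kappa>' * (D * z powr (- b))"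
            using \<kappa>' \<tau> \<tau>' z r True by (intro mult_left_mono D(4)) simp_all
          finally show ?thesis by (simp add: B'_def)
        qed (use B in simp)
        ultimately show "norm (?I R) \<le> 2 * (B + B') * \<bar>x\<bar> powr (- \<beta>)" using fin z(3) by simp
      qed
    qed
  qed
  show ?thesis
  proof (rule that)
    show "0 \<le> 2 * (B + B')" using B by simp
    show "0 \<le> \<beta>" "\<beta> < 1" by fact+
    fix \<tau> c x :: real
    assume *: "\<bar>\<tau>\<bar> powr \<gamma> \<le> c" "x \<noteq> 0" "\<bar>x\<bar> \<le> 2"
    show "\<forall>\<^sub>F R in at_top. norm (integral {0..R} (\<lambda>\<xi>. cis (phase a \<tau> x \<xi>) * of_real (amplitude a s c \<xi>)))
       \<le> 2 * (B + B') * \<bar>x\<bar> powr (- \<beta>)"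
    proof (cases "0 \<le> \<tau>")
      case True
      with pos[of \<tau> c x] * show ?thesis by simp
    next
      case False
      \<comment> \<open>Conjugation reverses the signs of \<tau> and x together; the modulus of the
        integral and the condition on |\<tau>| and \<open>c\<close> are unaffected.\<close>
      have "(\<lambda>\<xi>. cis (phase a \<tau> x \<xi>) * of_real (amplitude a s c \<xi>)) =
          (\<lambda>\<xi>. cnj (cis (phase a (- \<tau>) (- x) \<xi>) * of_real (amplitude a s c \<xi>)))"
        by (simp add: phase_def cis_cnj add.commute)
      then have "norm (integral {0..R} (\<lambda>\<xi>. cis (phase a \<tau> x \<xi>) * of_real (amplitude a s c \<xi>))) =
          norm (integral {0..R} (\<lambda>\<xi>. cis (phase a (- \<tau>) (- x) \<xi>) * of_real (amplitude a s c \<xi>)))" for R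
        by (simp only: Henstock_Kurzweil_Integration.integral_cnj[symmetric] complex_mod_cnj)
      with pos[of "- \<tau>" c "- x"] * False show ?thesis by simp
    qed
  qed
qed

section \<open>Damped integrals over the whole line\<close>

lemma integrable_exp_abs_powr:
  fixes a c :: real
  assumes "0 < a" "0 < c"
  shows "integrable lborel (\<lambda>\<xi>. exp (- c * \<bar>\<xi>\<bar> powr a))"
proof -
  \<comment> \<open>With a q = 2 the exponential is bounded by a multiple of |\<xi>|^(- 2), hence,
    being at most 1, by a multiple of 1 / (1 + \<xi>^2).\<close>
  define q where "q = 2 / a"
  have q: "0 < q" "a * q = 2" using assms by (simp_all add: q_def)
  define K where "K = q powr q * c powr (- q)"
  show ?thesis
  proof (rule Bochner_Integration.integrable_bound)
    show "integrable lborel (\<lambda>\<xi>. (1 + K) * inverse (1 + \<xi>\<^sup>2))"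
      using integrable_inverse_1_plus_square by (simp add: set_integrable_def)
    show "AE \<xi> in lborel. norm (exp (- c * \<bar>\<xi>\<bar> powr a)) \<le> norm ((1 + K) * inverse (1 + \<xi>\<^sup>2))"
    proof (rule AE_I2)
      fix \<xi> :: real
      have "exp (- c * \<bar>\<xi>\<bar> powr a) * \<xi>\<^sup>2 \<le> K"
      proof (cases "\<xi> = 0")
        case False
        then have "exp (- (c * \<bar>\<xi>\<bar> powr a)) \<le> q powr q * (c * \<bar>\<xi>\<bar> powr a) powr (- q)"
          using q assms by (intro exp_minus_le_powr) simp_all
        also have "\<dots> = K * \<bar>\<xi>\<bar> powr (- 2)"
          using assms q by (simp add: powr_mult powr_powr K_def)
        also have "\<bar>\<xi>\<bar> powr (- 2) = 1 / \<xi>\<^sup>2"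
          using False by (simp add: powr_minus_divide)
        finally show ?thesis using False by (simp add: divide_simps)
      qed (simp add: K_def)
      moreover have "exp (- c * \<bar>\<xi>\<bar> powr a) \<le> 1" using assms by simp
      ultimately have "exp (- c * \<bar>\<xi>\<bar> powr a) * (1 + \<xi>\<^sup>2) \<le> 1 + K"
        unfolding distrib_left mult_1_right by (rule add_mono[rotated])
      then have "exp (- c * \<bar>\<xi>\<bar> powr a) \<le> (1 + K) * inverse (1 + \<xi>\<^sup>2)"
        by (simp add: pos_le_divide_eq flip: divide_inverse)
      moreover have "0 \<le> (1 + K) * inverse (1 + \<xi>\<^sup>2)" by (simp add: K_def)
      ultimately show "norm (exp (- c * \<bar>\<xi>\<bar> powr a)) \<le> norm ((1 + K) * inverse (1 + \<xi>\<^sup>2))"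
        by simp
    qed
  qed simp
qed

lemma borel_measurable_phase [measurable]:
  assumes [measurable]: "\<tau> \<in> borel_measurable M" "x \<in> borel_measurable M" "\<xi> \<in> borel_measurable M"
  shows "(\<lambda>w. phase a (\<tau> w) (x w) (\<xi> w)) \<in> borel_measurable M"
  unfolding phase_def by measurable

lemma borel_measurable_amplitude [measurable]:
  assumes [measurable]: "c \<in> borel_measurable M" "\<xi> \<in> borel_measurable M"
  shows "(\<lambda>w. amplitude a s (c w) (\<xi> w)) \<in> borel_measurable M"
  unfolding amplitude_def by measurable

lemma borel_measurable_cis [measurable]: "cis \<in> borel_measurable borel"
  by (intro borel_measurable_continuous_onI continuous_intros continuous_on_cis)

text \<open>c > 0 makes the integral converge absolutely, so it is the limit of its symmetric
  truncations, while the bound is inherited from the half lines and does not see the size of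
  \<open>c\<close>. Reflecting the negative half replaces \<open>x\<close> by \<open>- x\<close>,
  since the rest of the integrand is even.\<close>

lemma kernel_bound:
  fixes a \<gamma> s :: real
  assumes a: "1 < a" and \<gamma>: "0 < \<gamma>" and s: "0 < s" "s < 1 / 2"
    and s': "1 / 4 < s \<or> s < 1 / 4 \<and> a * (\<gamma> - 1) < 4 * s * \<gamma>"
  obtains C \<beta> :: real where "0 \<le> C" "0 \<le> \<beta>" "\<beta> < 1"
    "\<And>\<tau> c x. \<lbrakk>\<bar>\<tau>\<bar> powr \<gamma> \<le> c; 0 < c; x \<noteq> 0; \<bar>x\<bar> \<le> 2\<rbrakk> \<Longrightarrow>
       norm (\<integral>\<xi>. cis (phase a \<tau> x \<xi>) * of_real (amplitude a s c \<xi>) \<partial>lborel) \<le> C * \<bar>x\<bar> powr (- \<beta>)"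
proof -
  obtain C \<beta> where C: "0 \<le> C" "0 \<le> \<beta>" "\<beta> < 1"
    "\<And>\<tau> c x. \<lbrakk>\<bar>\<tau>\<bar> powr \<gamma> \<le> c; x \<noteq> 0; \<bar>x\<bar> \<le> 2\<rbrakk> \<Longrightarrow> \<forall>\<^sub>F R in at_top.
       norm (integral {0..R} (\<lambda>\<xi>. cis (phase a \<tau> x \<xi>) * of_real (amplitude a s c \<xi>))) \<le> C * \<bar>x\<bar> powr (- \<beta>)"
    using half_line_kernel_bound[OF a \<gamma> s s'] by blast
  show ?thesis
  proof (rule that)
    show "0 \<le> 2 * C" "0 \<le> \<beta>" "\<beta> < 1" using C by simp_all
    fix \<tau> c x :: real
    assume *: "\<bar>\<tau>\<bar> powr \<gamma> \<le> c" "0 < c" "x \<noteq> 0" "\<bar>x\<bar> \<le> 2"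
    let ?f = "\<lambda>x \<xi>. cis (phase a \<tau> x \<xi>) * of_real (amplitude a s c \<xi>)"
    have bnd: "norm (?f x \<xi>) \<le> exp (- c * \<bar>\<xi>\<bar> powr a)" for \<xi>
      using amplitude_le_exp[of s a c \<xi>] s by (simp add: norm_mult)
    have E: "integrable lborel (\<lambda>\<xi>. exp (- c * \<bar>\<xi>\<bar> powr a))"
      using a * by (intro integrable_exp_abs_powr) simp_all
    have int: "integrable lborel (?f x)"
      by (rule Bochner_Integration.integrable_bound[OF E]) (use bnd in simp_all)
    have lim: "((\<lambda>R. \<integral>\<xi>. indicator {-R..R} \<xi> *\<^sub>R ?f x \<xi> \<partial>lborel) \<longlongrightarrow> (\<integral>\<xi>. ?f x \<xi> \<partial>lborel)) at_top"
    proof (rule integral_dominated_convergence_at_top[OF _ _ E])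
      show "AE \<xi> in lborel. ((\<lambda>R. indicator {-R..R} \<xi> *\<^sub>R ?f x \<xi>) \<longlongrightarrow> ?f x \<xi>) at_top"
      proof (rule AE_I2)
        fix \<xi>
        have "\<forall>\<^sub>F R in at_top. indicator {-R..R} \<xi> *\<^sub>R ?f x \<xi> = ?f x \<xi>"
          by (rule eventually_mono[OF eventually_ge_at_top[of "\<bar>\<xi>\<bar>"]]) (auto simp: indicator_def)
        then show "((\<lambda>R. indicator {-R..R} \<xi> *\<^sub>R ?f x \<xi>) \<longlongrightarrow> ?f x \<xi>) at_top"
          by (rule tendsto_eventually)
      qed
      show "\<forall>\<^sub>F R in at_top. AE \<xi> in lborel. norm (indicator {-R..R} \<xi> *\<^sub>R ?f x \<xi>) \<le> exp (- c * \<bar>\<xi>\<bar> powr a)"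
        by (intro always_eventually allI AE_I2) (use bnd in \<open>auto simp: indicator_def\<close>)
    qed simp_all
    have part: "(\<integral>\<xi>. indicator {-R..R} \<xi> *\<^sub>R ?f x \<xi> \<partial>lborel) = integral {0..R} (?f x) + integral {0..R} (?f (- x))"
      if "0 \<le> R" for R
    proof -
      have "(\<integral>\<xi>. indicator {-R..R} \<xi> *\<^sub>R ?f x \<xi> \<partial>lborel) = integral {-R..R} (?f x)"
        using set_borel_integral_eq_integral(2)[of "{-R..R}" "?f x"] int
        by (simp add: set_integrable_def set_lebesgue_integral_def integrable_mult_indicator)
      also have "\<dots> = integral {-R..-0} (?f x) + integral {0..R} (?f x)"
        using that a Henstock_Kurzweil_Integration.integral_combine[of "-R" 0 R "?f x"]
        by (simp add: integrable_continuous_real continuous_on_phase_amplitude)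
      also have "integral {-R..-0} (?f x) = integral {-R..-0} (\<lambda>\<xi>. ?f (- x) (- \<xi>))"
        by (simp add: phase_def amplitude_def)
      also have "\<dots> = integral {0..R} (?f (- x))"
        by (rule Henstock_Kurzweil_Integration.integral_reflect_real[where f = "?f (- x)" and a = 0 and b = R])
      finally show ?thesis by simp
    qed
    show "norm (\<integral>\<xi>. ?f x \<xi> \<partial>lborel) \<le> 2 * C * \<bar>x\<bar> powr (- \<beta>)"
    proof (rule Lim_norm_ubound[OF _ lim])
      have "\<forall>\<^sub>F R in at_top. norm (integral {0..R} (?f x)) \<le> C * \<bar>x\<bar> powr (- \<beta>)"
        "\<forall>\<^sub>F R in at_top. norm (integral {0..R} (?f (- x))) \<le> C * \<bar>x\<bar> powr (- \<beta>)"
        using C(4)[of \<tau> c x] C(4)[of \<tau> c "- x"] * by simp_all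
      with eventually_ge_at_top[of 0]
      show "\<forall>\<^sub>F R in at_top. norm (\<integral>\<xi>. indicator {-R..R} \<xi> *\<^sub>R ?f x \<xi> \<partial>lborel) \<le> 2 * C * \<bar>x\<bar> powr (- \<beta>)"
      proof eventually_elim
        case (elim R)
        then show ?case
          using part[of R] norm_triangle_ineq[of "integral {0..R} (?f x)" "integral {0..R} (?f (- x))"] by simp
      qed
    qed simp
  qed
qed

section \<open>The Kolmogorov--Seliverstov--Plessner duality argument\<close>

lemma integrable_pair_mult:
  fixes u v :: "real \<Rightarrow> real"
  assumes u: "integrable lborel u" and v: "integrable lborel v"
  shows "integrable (lborel \<Otimes>\<^sub>M lborel) (\<lambda>(x, y). u x * v y)"
proof (rule lborel_pair.Fubini_integrable)
  note [measurable] = borel_measurable_integrable[OF u] borel_measurable_integrable[OF v]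
  show "(\<lambda>(x, y). u x * v y) \<in> borel_measurable (lborel \<Otimes>\<^sub>M lborel)" by measurable
  have "integrable lborel (\<lambda>x. \<bar>u x\<bar> * (\<integral>y. \<bar>v y\<bar> \<partial>lborel))"
    using u by (intro integrable_mult_left integrable_abs)
  then show "integrable lborel (\<lambda>x. \<integral>y. norm (case (x, y) of (x, y) \<Rightarrow> u x * v y) \<partial>lborel)"
    by (simp add: abs_mult)
  show "AE x in lborel. integrable lborel (\<lambda>y. case (x, y) of (x, y) \<Rightarrow> u x * v y)"
    using v by simp
qed

lemma Fubini_dominated:
  fixes f :: "real \<Rightarrow> real \<Rightarrow> complex"
  assumes [measurable]: "(\<lambda>(x, y). f x y) \<in> borel_measurable (lborel \<Otimes>\<^sub>M lborel)"
    and u: "integrable lborel u" and v: "integrable lborel v"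
    and bound: "\<And>x y. norm (f x y) \<le> u x * v y"
  shows "(\<integral>x. \<integral>y. f x y \<partial>lborel \<partial>lborel) = (\<integral>y. \<integral>x. f x y \<partial>lborel \<partial>lborel)"
proof (rule lborel_pair.Fubini_integral[symmetric])
  show "integrable (lborel \<Otimes>\<^sub>M lborel) (\<lambda>(x, y). f x y)"
    by (rule Bochner_Integration.integrable_bound[OF integrable_pair_mult[OF u v]])
       (auto split: prod.splits intro: order_trans[OF bound abs_ge_self])
qed

text \<open>By 2 w(x) w(y) <= w(x)^2 + w(y)^2 and the symmetry of \<open>k\<close>, the double
  integral splits into two equal halves. In each, x - y ranges within [-2, 2], so integrating out
  the other variable costs at most \<open>D\<close>.\<close>

lemma Schur_test_convolution:
  fixes w :: "real \<Rightarrow> real" and k :: "real \<Rightarrow> real"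
  assumes [measurable]: "w \<in> borel_measurable lborel" "k \<in> borel_measurable lborel"
    and w: "\<And>x. 0 \<le> w x" "\<And>x. x \<notin> {-1..1} \<Longrightarrow> w x = 0"
    and k: "\<And>z. 0 \<le> k z" "\<And>z. k (- z) = k z"
    and D: "(\<integral>\<^sup>+z\<in>{-2..2}. ennreal (k z) \<partial>lborel) \<le> ennreal D"
  shows "(\<integral>\<^sup>+x. \<integral>\<^sup>+y. ennreal (w x * (w y * k (x - y))) \<partial>lborel \<partial>lborel)
    \<le> ennreal D * (\<integral>\<^sup>+x. ennreal ((w x)\<^sup>2) \<partial>lborel)"
proof -
  define I where "I = (indicator {-1..1} :: real \<Rightarrow> real)"
  have [measurable]: "I \<in> borel_measurable lborel" by (simp add: I_def)
  have I: "0 \<le> I x" for x by (simp add: I_def)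
  define v where "v x = (w x)\<^sup>2 / 2" for x
  have [measurable]: "v \<in> borel_measurable lborel" unfolding v_def by measurable
  have v: "0 \<le> v x" for x by (simp add: v_def)
  let ?N = "\<integral>\<^sup>+x. ennreal (v x) \<partial>lborel"
  let ?S = "\<integral>\<^sup>+x. \<integral>\<^sup>+y. ennreal (v x) * ennreal (I y * k (x - y)) \<partial>lborel \<partial>lborel"
  let ?T = "\<integral>\<^sup>+x. \<integral>\<^sup>+y. ennreal (v y) * ennreal (I x * k (y - x)) \<partial>lborel \<partial>lborel"
  have S: "?S \<le> ennreal D * ?N"
  proof -
    have inner: "(\<integral>\<^sup>+y. ennreal (I y * k (x - y)) \<partial>lborel) \<le> ennreal D" if "x \<in> {-1..1}" for x
    proof -
      have "(\<integral>\<^sup>+y. ennreal (I y * k (x - y)) \<partial>lborel) = (\<integral>\<^sup>+z. ennreal (I (x - z) * k z) \<partial>lborel)"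
        by (subst nn_integral_real_affine[where c = "-1" and t = x]) simp_all
      also have "\<dots> \<le> (\<integral>\<^sup>+z\<in>{-2..2}. ennreal (k z) \<partial>lborel)"
        using that k by (intro nn_integral_mono) (auto simp: I_def indicator_def)
      finally show ?thesis using D by simp
    qed
    have "?S = (\<integral>\<^sup>+x. ennreal (v x) * (\<integral>\<^sup>+y. ennreal (I y * k (x - y)) \<partial>lborel) \<partial>lborel)"
      by (simp add: nn_integral_cmult)
    also have "\<dots> \<le> (\<integral>\<^sup>+x. ennreal D * ennreal (v x) \<partial>lborel)"
    proof (rule nn_integral_mono)
      fix x show "ennreal (v x) * (\<integral>\<^sup>+y. ennreal (I y * k (x - y)) \<partial>lborel) \<le> ennreal D * ennreal (v x)"
      proof (cases "x \<in> {-1..1}")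
        case True
        then show ?thesis unfolding mult.commute[of "ennreal D"] by (intro mult_left_mono inner) simp_all
      next
        case False
        then show ?thesis using w(2)[of x] by (simp add: v_def)
      qed
    qed
    also have "\<dots> = ennreal D * ?N"
      by (rule nn_integral_cmult) simp
    finally show ?thesis .
  qed
  have "?T = ?S" by (rule lborel_pair.Fubini') measurable
  have pt: "ennreal (w x * (w y * k (x - y)))
      \<le> ennreal (v x) * ennreal (I y * k (x - y)) + ennreal (v y) * ennreal (I x * k (y - x))" for x y
  proof (cases "x \<in> {-1..1} \<and> y \<in> {-1..1}")
    case True
    have kk: "k (y - x) = k (x - y)" using k(2)[of "x - y"] by simp
    have "(w x * w y) * k (x - y) \<le> (v x + v y) * k (x - y)"
      using k sum_squares_bound[of "w x" "w y"] by (intro mult_right_mono) (simp_all add: v_def)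
    then have "ennreal (w x * (w y * k (x - y))) \<le> ennreal (v x * k (x - y) + v y * k (x - y))"
      by (intro ennreal_leI) (simp add: distrib_right mult.assoc)
    also have "\<dots> = ennreal (v x) * ennreal (I y * k (x - y)) + ennreal (v y) * ennreal (I x * k (y - x))"
      using True k(1) v kk by (simp add: I_def ennreal_mult)
    finally show ?thesis .
  next
    case False
    then have "w x = 0 \<or> w y = 0" using w by blast
    then show ?thesis by auto
  qed
  have "(\<integral>\<^sup>+x. \<integral>\<^sup>+y. ennreal (w x * (w y * k (x - y))) \<partial>lborel \<partial>lborel)
      \<le> (\<integral>\<^sup>+x. \<integral>\<^sup>+y. ennreal (v x) * ennreal (I y * k (x - y))
       + ennreal (v y) * ennreal (I x * k (y - x)) \<partial>lborel \<partial>lborel)"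
    by (intro nn_integral_mono pt)
  also have "\<dots> = ?S + ?T" by (simp add: nn_integral_add)
  also have "\<dots> \<le> ennreal D * ?N + ennreal D * ?N" unfolding \<open>?T = ?S\<close> using S S by (rule add_mono)
  also have "\<dots> = ennreal D * (\<integral>\<^sup>+x. ennreal (v x) + ennreal (v x) \<partial>lborel)"
    by (simp add: nn_integral_add distrib_left)
  also have "(\<lambda>x. ennreal (v x) + ennreal (v x)) = (\<lambda>x. ennreal ((w x)\<^sup>2))"
    by (simp add: v_def flip: ennreal_plus)
  finally show ?thesis .
qed

text \<open>True for every \<open>f\<close>, because the Bochner integral of a nonintegrable
  function is 0 by convention.\<close>

lemma norm_integral_le_nn_integral:
  fixes f :: "'a \<Rightarrow> 'b::{banach, second_countable_topology}"
  shows "ennreal (norm (integral\<^sup>L M f)) \<le> (\<integral>\<^sup>+x. ennreal (norm (f x)) \<partial>M)"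
  by (cases "integrable M f") (simp_all add: integral_norm_bound_ennreal not_integrable_integral_eq)

lemma borel_measurable_cnj [measurable]: "cnj \<in> borel_measurable borel"
  by (intro borel_measurable_continuous_onI continuous_intros)

text \<open>Let W be the squared norm to be bounded and G that of \<open>g\<close>. Then W is the
  integral of g V, where V is the transposed operator applied to w, and Schur's test bounds the
  squared norm Q of V by D W. Hence W <= D G / 2 + Q / (2 D) <= D G / 2 + W / 2. Absorbing W / 2
  requires W to be finite, which the majorant \<open>b\<close> ensures; only \<open>D\<close>
  reaches the conclusion.\<close>

lemma TT_star_bound:
  fixes M :: "real \<Rightarrow> real \<Rightarrow> complex" and b k :: "real \<Rightarrow> real" and g :: "real \<Rightarrow> complex"
  assumes M [measurable]: "(\<lambda>(x, \<xi>). M x \<xi>) \<in> borel_measurable (lborel \<Otimes>\<^sub>M lborel)"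
    and b: "integrable lborel b" "\<And>\<xi>. b \<xi> \<le> 1" "\<And>x \<xi>. norm (M x \<xi>) \<le> b \<xi>"
    and g [measurable]: "g \<in> borel_measurable lborel" and g2: "integrable lborel (\<lambda>\<xi>. (norm (g \<xi>))\<^sup>2)"
    and [measurable]: "k \<in> borel_measurable lborel"
    and k: "\<And>z. 0 \<le> k z" "\<And>z. k (- z) = k z"
    and kernel: "\<And>x y. \<lbrakk>x \<in> {-1..1}; y \<in> {-1..1}; x \<noteq> y\<rbrakk> \<Longrightarrow> norm (\<integral>\<xi>. M x \<xi> * cnj (M y \<xi>) \<partial>lborel) \<le> k (x - y)"
    and D: "(\<integral>\<^sup>+z\<in>{-2..2}. ennreal (k z) \<partial>lborel) \<le> ennreal D" "0 < D"
  shows "(\<integral>\<^sup>+x\<in>{-1..1}. ennreal ((norm (\<integral>\<xi>. g \<xi> * M x \<xi> \<partial>lborel))\<^sup>2) \<partial>lborel)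
    \<le> ennreal D * (\<integral>\<^sup>+\<xi>. ennreal ((norm (g \<xi>))\<^sup>2) \<partial>lborel)"
proof -
  note [measurable] = borel_measurable_integrable[OF b(1)]
  have b0: "0 \<le> b \<xi>" for \<xi> using b(3)[of 0 \<xi>] norm_ge_zero order_trans by blast
  define U where "U x = (\<integral>\<xi>. g \<xi> * M x \<xi> \<partial>lborel)" for x
  \<comment> \<open>The conjugate gives w U = |w|^2, so that pairing \<open>U\<close> with
    \<open>w\<close> returns the squared norm of \<open>U\<close> on [-1, 1].\<close>
  define w where "w x = indicator {-1..1} x *\<^sub>R cnj (U x)" for x
  define V where "V \<xi> = (\<integral>x. w x * M x \<xi> \<partial>lborel)" for \<xi>
  define B where "B = (\<integral>\<xi>. norm (g \<xi>) * b \<xi> \<partial>lborel)"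
  have [measurable]: "U \<in> borel_measurable lborel" unfolding U_def by measurable
  have w_meas [measurable]: "w \<in> borel_measurable lborel" unfolding w_def by measurable
  have [measurable]: "V \<in> borel_measurable lborel" unfolding V_def by measurable
  \<comment> \<open>From 0 <= b <= 1 follows b^2 <= b, so |g| b is dominated by |g|^2 + b.\<close>
  have gb: "integrable lborel (\<lambda>\<xi>. norm (g \<xi>) * b \<xi>)"
  proof (rule Bochner_Integration.integrable_bound)
    show "integrable lborel (\<lambda>\<xi>. (norm (g \<xi>))\<^sup>2 + b \<xi>)" using g2 b(1) by simp
    show "AE \<xi> in lborel. norm (norm (g \<xi>) * b \<xi>) \<le> norm ((norm (g \<xi>))\<^sup>2 + b \<xi>)"
    proof (rule AE_I2)
      fix \<xi>
      have "(b \<xi>)\<^sup>2 \<le> b \<xi>" using b0 b(2) by (simp add: power2_eq_square mult_left_le)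
      moreover have "2 * norm (g \<xi>) * b \<xi> \<le> (norm (g \<xi>))\<^sup>2 + (b \<xi>)\<^sup>2" by (rule sum_squares_bound)
      moreover have "0 \<le> norm (g \<xi>) * b \<xi>" using b0 by simp
      ultimately show "norm (norm (g \<xi>) * b \<xi>) \<le> norm ((norm (g \<xi>))\<^sup>2 + b \<xi>)" by simp
    qed
  qed simp
  have B0: "0 \<le> B" unfolding B_def using b0 by simp
  have UB: "norm (U x) \<le> B" for x
  proof -
    have "norm (U x) \<le> (\<integral>\<xi>. norm (g \<xi> * M x \<xi>) \<partial>lborel)" unfolding U_def by (rule integral_norm_bound)
    also have "\<dots> \<le> B" unfolding B_def
    proof (rule integral_mono[OF _ gb])
      show "integrable lborel (\<lambda>\<xi>. norm (g \<xi> * M x \<xi>))"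
        by (rule Bochner_Integration.integrable_bound[OF gb])
           (auto simp: norm_mult b0 intro!: mult_left_mono b(3))
    qed (auto simp: norm_mult intro!: mult_left_mono b(3))
    finally show ?thesis .
  qed
  define i where "i = (\<lambda>x::real. B * indicator {-1..1} x)"
  have i: "integrable lborel i" unfolding i_def by simp
  have wi: "norm (w x) \<le> i x" for x using UB by (simp add: w_def i_def indicator_def)
  have wB: "norm (w x) \<le> B" for x using UB[of x] B0 by (simp add: w_def indicator_def)
  have w_int: "integrable lborel (\<lambda>x. norm (w x))"
    by (rule Bochner_Integration.integrable_bound[OF i]) (auto intro: order_trans[OF wi abs_ge_self])
  have w2_int: "integrable lborel (\<lambda>x. (norm (w x))\<^sup>2)"
  proof (rule Bochner_Integration.integrable_bound)
    show "integrable lborel (\<lambda>x. B * norm (w x))" using w_int by simp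
    show "AE x in lborel. norm ((norm (w x))\<^sup>2) \<le> norm (B * norm (w x))"
      using wB B0 by (simp add: power2_eq_square mult_right_mono)
  qed simp
  define A where "A = (\<integral>x. norm (w x) \<partial>lborel)"
  have VA: "norm (V \<xi>) \<le> A * b \<xi>" for \<xi>
  proof -
    have "norm (V \<xi>) \<le> (\<integral>x. norm (w x * M x \<xi>) \<partial>lborel)" unfolding V_def by (rule integral_norm_bound)
    also have "\<dots> \<le> (\<integral>x. norm (w x) * b \<xi> \<partial>lborel)"
    proof (rule integral_mono)
      show "integrable lborel (\<lambda>x. norm (w x * M x \<xi>))"
        by (rule Bochner_Integration.integrable_bound[OF integrable_mult_left[OF w_int, of "b \<xi>"]])
           (auto simp: norm_mult b0 intro!: mult_left_mono b(3))
    qed (use w_int in \<open>auto simp: norm_mult intro!: mult_left_mono b(3)\<close>)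
    finally show ?thesis by (simp add: A_def)
  qed
  have A0: "0 \<le> A" by (simp add: A_def)
  have VA': "norm (V \<xi>) \<le> A" for \<xi>
    using VA[of \<xi>] mult_left_mono[OF b(2)[of \<xi>] A0] by simp
  have V_int: "integrable lborel (\<lambda>\<xi>. norm (V \<xi>))"
    by (rule Bochner_Integration.integrable_bound[OF integrable_mult_right[OF b(1), of A]])
       (auto intro: order_trans[OF VA abs_ge_self])
  have V2_int: "integrable lborel (\<lambda>\<xi>. (norm (V \<xi>))\<^sup>2)"
  proof (rule Bochner_Integration.integrable_bound)
    show "integrable lborel (\<lambda>\<xi>. A * norm (V \<xi>))" using V_int by simp
    show "AE \<xi> in lborel. norm ((norm (V \<xi>))\<^sup>2) \<le> norm (A * norm (V \<xi>))"
      using VA' A0 by (simp add: power2_eq_square mult_right_mono)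
  qed simp
  define W where "W = (\<integral>x. (norm (w x))\<^sup>2 \<partial>lborel)"
  define G where "G = (\<integral>\<xi>. (norm (g \<xi>))\<^sup>2 \<partial>lborel)"
  define Q where "Q = (\<integral>\<xi>. (norm (V \<xi>))\<^sup>2 \<partial>lborel)"
  have wU: "w x * U x = of_real ((norm (w x))\<^sup>2)" for x
    by (simp add: w_def indicator_def complex_norm_square mult.commute del: of_real_power)
  have W: "of_real W = (\<integral>\<xi>. g \<xi> * V \<xi> \<partial>lborel)"
  proof -
    have "of_real W = (\<integral>x. w x * U x \<partial>lborel)" unfolding wU W_def by (rule integral_complex_of_real[symmetric])
    also have "\<dots> = (\<integral>x. \<integral>\<xi>. w x * (g \<xi> * M x \<xi>) \<partial>lborel \<partial>lborel)" by (simp add: U_def)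
    also have "\<dots> = (\<integral>\<xi>. \<integral>x. w x * (g \<xi> * M x \<xi>) \<partial>lborel \<partial>lborel)"
      by (rule Fubini_dominated[OF _ w_int gb])
         (auto simp: norm_mult intro!: mult_left_mono b(3))
    also have "\<dots> = (\<integral>\<xi>. \<integral>x. g \<xi> * (w x * M x \<xi>) \<partial>lborel \<partial>lborel)" by (simp only: mult_ac)
    finally show ?thesis by (simp add: V_def)
  qed
  define K where "K x y = (\<integral>\<xi>. M x \<xi> * cnj (M y \<xi>) \<partial>lborel)" for x y
  have [measurable]: "(\<lambda>(x, y). K x y) \<in> borel_measurable (lborel \<Otimes>\<^sub>M lborel)" unfolding K_def by measurable
  have Q: "of_real Q = (\<integral>x. w x * (\<integral>y. cnj (w y) * K x y \<partial>lborel) \<partial>lborel)"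
  proof -
    have inner: "(\<integral>\<xi>. M x \<xi> * cnj (V \<xi>) \<partial>lborel) = (\<integral>y. cnj (w y) * K x y \<partial>lborel)" for x
    proof -
      have "(\<integral>\<xi>. M x \<xi> * cnj (V \<xi>) \<partial>lborel) = (\<integral>\<xi>. \<integral>y. M x \<xi> * (cnj (w y) * cnj (M y \<xi>)) \<partial>lborel \<partial>lborel)"
      proof -
        have "cnj (V \<xi>) = (\<integral>y. cnj (w y) * cnj (M y \<xi>) \<partial>lborel)" for \<xi>
          by (simp only: V_def complex_cnj_mult flip: Bochner_Integration.integral_cnj)
        then show ?thesis by simp
      qed
      also have "\<dots> = (\<integral>y. \<integral>\<xi>. M x \<xi> * (cnj (w y) * cnj (M y \<xi>)) \<partial>lborel \<partial>lborel)"
      proof (rule Fubini_dominated[OF _ b(1) w_int])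
        fix \<xi> y
        have "norm (M y \<xi>) \<le> 1" using b(2,3) order_trans by blast
        then have "norm (M x \<xi>) * (norm (w y) * norm (M y \<xi>)) \<le> b \<xi> * (norm (w y) * 1)"
          using b0 b(3) by (intro mult_mono) simp_all
        then show "norm (M x \<xi> * (cnj (w y) * cnj (M y \<xi>))) \<le> b \<xi> * norm (w y)"
          by (simp add: norm_mult)
      qed measurable
      also have "\<dots> = (\<integral>y. \<integral>\<xi>. cnj (w y) * (M x \<xi> * cnj (M y \<xi>)) \<partial>lborel \<partial>lborel)" by (simp only: mult_ac)
      finally show ?thesis by (simp add: K_def)
    qed
    have "V \<xi> * cnj (V \<xi>) = of_real ((norm (V \<xi>))\<^sup>2)" for \<xi>
      by (simp add: complex_norm_square del: of_real_power)
    then have "of_real Q = (\<integral>\<xi>. V \<xi> * cnj (V \<xi>) \<partial>lborel)"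
      by (simp add: Q_def integral_complex_of_real del: of_real_power)
    also have "\<dots> = (\<integral>\<xi>. \<integral>x. w x * M x \<xi> * cnj (V \<xi>) \<partial>lborel \<partial>lborel)"
      by (subst V_def) simp
    also have "\<dots> = (\<integral>x. \<integral>\<xi>. w x * M x \<xi> * cnj (V \<xi>) \<partial>lborel \<partial>lborel)"
    proof (rule Fubini_dominated[OF _ V_int w_int])
      fix \<xi> x
      have "norm (M x \<xi>) \<le> 1" using b(2,3) order_trans by blast
      then have "norm (w x) * norm (M x \<xi>) * norm (V \<xi>) \<le> norm (w x) * 1 * norm (V \<xi>)"
        by (intro mult_right_mono mult_left_mono) simp_all
      then show "norm (w x * M x \<xi> * cnj (V \<xi>)) \<le> norm (V \<xi>) * norm (w x)"
        by (simp add: norm_mult mult.commute)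
    qed measurable
    also have "\<dots> = (\<integral>x. w x * (\<integral>\<xi>. M x \<xi> * cnj (V \<xi>) \<partial>lborel) \<partial>lborel)" by (simp add: mult.assoc)
    finally show ?thesis unfolding inner .
  qed
  have QW: "Q \<le> D * W"
  proof -
    have "ennreal Q = ennreal (norm (\<integral>x. w x * (\<integral>y. cnj (w y) * K x y \<partial>lborel) \<partial>lborel))"
      unfolding Q[symmetric] by (simp add: Q_def)
    also have "\<dots> \<le> (\<integral>\<^sup>+x. ennreal (norm (w x * (\<integral>y. cnj (w y) * K x y \<partial>lborel))) \<partial>lborel)"
      by (rule norm_integral_le_nn_integral)
    also have "\<dots> \<le> (\<integral>\<^sup>+x. \<integral>\<^sup>+y. ennreal (norm (w x) * (norm (w y) * k (x - y))) \<partial>lborel \<partial>lborel)"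
    proof (rule nn_integral_mono)
      fix x
      have "ennreal (norm (w x * (\<integral>y. cnj (w y) * K x y \<partial>lborel)))
         = ennreal (norm (w x)) * ennreal (norm (\<integral>y. cnj (w y) * K x y \<partial>lborel))"
        by (simp add: norm_mult ennreal_mult)
      also have "\<dots> \<le> ennreal (norm (w x)) * (\<integral>\<^sup>+y. ennreal (norm (cnj (w y) * K x y)) \<partial>lborel)"
        by (intro mult_left_mono norm_integral_le_nn_integral) simp
      also have "\<dots> = (\<integral>\<^sup>+y. ennreal (norm (w x) * (norm (w y) * norm (K x y))) \<partial>lborel)"
        by (simp add: norm_mult ennreal_mult nn_integral_cmult)
      also have "\<dots> \<le> (\<integral>\<^sup>+y. ennreal (norm (w x) * (norm (w y) * k (x - y))) \<partial>lborel)"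
      proof (rule nn_integral_mono_AE)
        \<comment> \<open>The kernel is controlled only off the diagonal; for fixed \<open>x\<close>
          the diagonal is a null set of \<open>y\<close>.\<close>
        have "AE y in lborel. y \<noteq> x" by (rule AE_lborel_singleton)
        then show "AE y in lborel. ennreal (norm (w x) * (norm (w y) * norm (K x y)))
           \<le> ennreal (norm (w x) * (norm (w y) * k (x - y)))"
        proof (rule AE_mp, intro AE_I2 impI ennreal_leI)
          fix y assume "y \<noteq> x"
          show "norm (w x) * (norm (w y) * norm (K x y)) \<le> norm (w x) * (norm (w y) * k (x - y))"
          proof (cases "x \<in> {-1..1} \<and> y \<in> {-1..1}")
            case True
            then have "norm (K x y) \<le> k (x - y)" unfolding K_def using \<open>y \<noteq> x\<close> by (intro kernel) auto
            then show ?thesis by (intro mult_left_mono) simp_all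
          next
            case False
            then have "w x = 0 \<or> w y = 0" by (auto simp: w_def)
            then show ?thesis by auto
          qed
        qed
      qed
      finally show "ennreal (norm (w x * (\<integral>y. cnj (w y) * K x y \<partial>lborel)))
         \<le> (\<integral>\<^sup>+y. ennreal (norm (w x) * (norm (w y) * k (x - y))) \<partial>lborel)" .
    qed
    also have "\<dots> \<le> ennreal D * (\<integral>\<^sup>+x. ennreal ((norm (w x))\<^sup>2) \<partial>lborel)"
      by (rule Schur_test_convolution) (use k D in \<open>auto simp: w_def\<close>)
    also have "(\<integral>\<^sup>+x. ennreal ((norm (w x))\<^sup>2) \<partial>lborel) = ennreal W"
      unfolding W_def using w2_int by (intro nn_integral_eq_integral) simp_all
    also have "ennreal D * ennreal W = ennreal (D * W)"
      using D by (simp add: W_def ennreal_mult)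
    finally show ?thesis using D by (subst (asm) ennreal_le_iff) (simp_all add: W_def)
  qed
  have "W \<le> D / 2 * G + Q / (2 * D)"
  proof -
    have "W = norm (\<integral>\<xi>. g \<xi> * V \<xi> \<partial>lborel)" unfolding W[symmetric] by (simp add: W_def)
    also have "\<dots> \<le> (\<integral>\<xi>. norm (g \<xi> * V \<xi>) \<partial>lborel)" by (rule integral_norm_bound)
    also have "\<dots> \<le> (\<integral>\<xi>. D / 2 * (norm (g \<xi>))\<^sup>2 + (norm (V \<xi>))\<^sup>2 / (2 * D) \<partial>lborel)"
    proof (rule integral_mono')
      show "integrable lborel (\<lambda>\<xi>. D / 2 * (norm (g \<xi>))\<^sup>2 + (norm (V \<xi>))\<^sup>2 / (2 * D))"
        using g2 V2_int by simp
      fix \<xi>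
      \<comment> \<open>Weighted by \<open>D\<close> so that the contribution of \<open>V\<close>
        becomes Q / (2 D), which is at most W / 2.\<close>
      have "0 \<le> (D * norm (g \<xi>) - norm (V \<xi>))\<^sup>2" by simp
      then have "2 * D * (norm (g \<xi>) * norm (V \<xi>)) \<le> D * D * (norm (g \<xi>))\<^sup>2 + (norm (V \<xi>))\<^sup>2"
        by (simp add: power2_eq_square algebra_simps)
      then show "norm (g \<xi> * V \<xi>) \<le> D / 2 * (norm (g \<xi>))\<^sup>2 + (norm (V \<xi>))\<^sup>2 / (2 * D)"
        using D by (simp add: norm_mult field_simps)
    qed (use D in simp)
    also have "\<dots> = D / 2 * G + Q / (2 * D)"
      using g2 V2_int by (simp add: G_def Q_def)
    finally show ?thesis .
  qed
  moreover have "Q / (2 * D) \<le> W / 2" using QW D by (simp add: field_simps)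
  ultimately have WG: "W \<le> D * G" by simp
  have "(\<integral>\<^sup>+x\<in>{-1..1}. ennreal ((norm (U x))\<^sup>2) \<partial>lborel) = (\<integral>\<^sup>+x. ennreal ((norm (w x))\<^sup>2) \<partial>lborel)"
    by (intro nn_integral_cong) (simp add: w_def indicator_def)
  also have "\<dots> = ennreal W"
    unfolding W_def using w2_int by (intro nn_integral_eq_integral) simp_all
  also have "\<dots> \<le> ennreal D * ennreal G"
    using WG D by (simp add: G_def ennreal_leI flip: ennreal_mult)
  also have "ennreal G = (\<integral>\<^sup>+\<xi>. ennreal ((norm (g \<xi>))\<^sup>2) \<partial>lborel)"
    unfolding G_def using g2 by (intro nn_integral_eq_integral[symmetric]) simp_all
  finally show ?thesis unfolding U_def .
qed

section \<open>The maximal estimate\<close>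

lemma ennsqrt_mono: "u \<le> v \<Longrightarrow> ennsqrt u \<le> ennsqrt v"
  by (auto simp: ennsqrt_def top_unique less_top intro!: ennreal_leI enn2real_mono)

lemma ennsqrt_cmult:
  assumes "0 < d"
  shows "ennsqrt (ennreal d * u) = ennreal (sqrt d) * ennsqrt u"
proof (cases u)
  case (real r)
  then show ?thesis using assms
    by (simp add: ennsqrt_def real_sqrt_mult flip: ennreal_mult)
next
  case top
  then show ?thesis using assms by (simp add: ennsqrt_def ennreal_mult_top)
qed

text \<open>A new time replaces the current choice wherever it does at least as well. Measurability
  of the selected values is carried through the induction, because nothing is assumed about
  \<open>h\<close> jointly in both arguments.\<close>

lemma measurable_argmax:
  fixes h :: "real \<Rightarrow> real \<Rightarrow> real"
  assumes "finite F" "F \<noteq> {}" and [measurable]: "\<And>r. r \<in> F \<Longrightarrow> h r \<in> borel_measurable borel"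
  shows "\<exists>t \<in> borel_measurable borel. (\<lambda>x. h (t x) x) \<in> borel_measurable borel \<and>
    (\<forall>x. t x \<in> F \<and> (\<forall>r\<in>F. h r x \<le> h (t x) x))"
  using assms
proof (induction rule: finite_ne_induct)
  case (singleton r)
  then have "h r \<in> borel_measurable borel" by simp
  then show ?case by (intro bexI[of _ "\<lambda>_. r"] conjI) simp_all
next
  case (insert r F)
  have "\<exists>t \<in> borel_measurable borel. (\<lambda>x. h (t x) x) \<in> borel_measurable borel \<and>
    (\<forall>x. t x \<in> F \<and> (\<forall>r\<in>F. h r x \<le> h (t x) x))"
    using insert.prems by (intro insert.IH) simp
  then obtain t where t_meas: "t \<in> borel_measurable borel" "(\<lambda>x. h (t x) x) \<in> borel_measurable borel"
    and t: "\<forall>x. t x \<in> F \<and> (\<forall>r\<in>F. h r x \<le> h (t x) x)"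
    by (elim bexE conjE)
  have r_meas: "h r \<in> borel_measurable borel" using insert.prems by simp
  define t' where "t' x = (if h (t x) x \<le> h r x then r else t x)" for x
  have eq: "h (t' x) x = max (h (t x) x) (h r x)" for x
    by (simp add: t'_def max_def)
  show ?case
  proof (intro bexI conjI allI ballI)
    show "t' \<in> borel_measurable borel" unfolding t'_def using t_meas r_meas by measurable
    show "(\<lambda>x. h (t' x) x) \<in> borel_measurable borel" unfolding eq using t_meas r_meas by measurable
    show "t' x \<in> insert r F" for x using t by (simp add: t'_def)
    show "h q x \<le> h (t' x) x" if "q \<in> insert r F" for q x
      using that t unfolding eq by (cases "q = r") (simp_all add: le_max_iff_disj)
  qed
qed

lemma nn_integral_abs_powr_finite:
  fixes C \<beta> :: real
  assumes "0 \<le> C" "\<beta> < 1"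
  obtains D where "0 < D" "(\<integral>\<^sup>+z\<in>{-2..2}. ennreal (C * \<bar>z\<bar> powr (- \<beta>)) \<partial>lborel) \<le> ennreal D"
proof -
  define I where "I = 2 powr (- \<beta> + 1) / (- \<beta> + 1)"
  define p where "p z = (if z \<in> {0..2} then z powr (- \<beta>) else 0)" for z :: real
  have "((\<lambda>z. z powr (- \<beta>)) has_integral I) {0..2}"
    unfolding I_def using assms by (intro has_integral_powr_from_0) simp_all
  then have "(p has_integral I) UNIV" unfolding p_def by (simp only: has_integral_restrict_UNIV)
  moreover have p_meas [measurable]: "p \<in> borel_measurable borel" unfolding p_def by measurable
  moreover have p0: "0 \<le> p z" for z by (simp add: p_def)
  ultimately have I: "(\<integral>\<^sup>+z. ennreal (p z) \<partial>lborel) = ennreal I"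
    by (intro nn_integral_has_integral_lborel) auto
  have I': "(\<integral>\<^sup>+z. ennreal (p (- z)) \<partial>lborel) = ennreal I"
    using I nn_integral_real_affine[of "\<lambda>z. ennreal (p z)" "-1" 0] by simp
  have "(\<integral>\<^sup>+z\<in>{-2..2}. ennreal (C * \<bar>z\<bar> powr (- \<beta>)) \<partial>lborel)
     \<le> (\<integral>\<^sup>+z. ennreal C * (ennreal (p z) + ennreal (p (- z))) \<partial>lborel)"
  proof (rule nn_integral_mono)
    fix z :: real
    have "\<bar>z\<bar> powr (- \<beta>) \<le> p z + p (- z)" if "z \<in> {-2..2}"
      using that by (auto simp: p_def abs_if)
    then have "C * \<bar>z\<bar> powr (- \<beta>) \<le> C * (p z + p (- z))" if "z \<in> {-2..2}"
      using that assms by (intro mult_left_mono) simp_all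
    then show "ennreal (C * \<bar>z\<bar> powr (- \<beta>)) * indicator {-2..2} z \<le> ennreal C * (ennreal (p z) + ennreal (p (- z)))"
      using p0 assms by (auto simp: indicator_def simp flip: ennreal_mult ennreal_plus intro!: ennreal_leI)
  qed
  also have "\<dots> = ennreal C * (ennreal I + ennreal I)"
    by (simp add: nn_integral_cmult nn_integral_add I I')
  also have "\<dots> = ennreal (C * (2 * I))"
    using assms by (simp add: I_def flip: ennreal_mult ennreal_plus)
  \<comment> \<open>The added 1 makes the constant positive even when \<open>C\<close> is 0.\<close>
  also have "\<dots> \<le> ennreal (C * (2 * I) + 1)" by (intro ennreal_leI) simp
  finally show ?thesis using assms by (intro that[of "C * (2 * I) + 1"]) (simp_all add: I_def add_nonneg_pos)
qed

text \<open>The factor (1 + \<xi>^2)^(s / 2) is moved onto the transform of \<open>f\<close>, whose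
  L2 norm then is the Sobolev norm, and its inverse becomes decay of the multiplier.
  \<open>s\<close> is free: s = 0 gives the plain form used for measurability.\<close>

lemma P_eq:
  "P a \<gamma> t f x = (\<integral>\<xi>. (fourier f \<xi> * of_real ((1 + \<xi>\<^sup>2) powr (s / 2)))
     * (cis (phase a t x \<xi>) * of_real (amplitude a (s / 2) (t powr \<gamma>) \<xi>)) \<partial>lborel)"
  unfolding P_def
proof (rule Bochner_Integration.integral_cong[OF refl])
  fix \<xi> :: real
  have "(1 + \<xi>\<^sup>2) powr (s / 2) * (1 + \<xi>\<^sup>2) powr (- (s / 2)) = 1"
    by (simp flip: powr_add add: order_less_imp_not_eq2[OF one_plus_square_pos])
  then have "complex_of_real ((1 + \<xi>\<^sup>2) powr (s / 2)) * of_real ((1 + \<xi>\<^sup>2) powr (- (s / 2))) = 1"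
    by (metis of_real_1 of_real_mult)
  moreover have "cis (phase a t x \<xi>) = exp (\<i> * of_real (t * \<bar>\<xi>\<bar> powr a)) * exp (\<i> * of_real (x * \<xi>))"
    by (simp add: phase_def cis_conv_exp distrib_left exp_add)
  ultimately show "fourier f \<xi> * exp (\<i> * of_real (t * \<bar>\<xi>\<bar> powr a))
            * of_real (exp (- (t powr \<gamma>) * \<bar>\<xi>\<bar> powr a)) * exp (\<i> * of_real (x * \<xi>))
     = (fourier f \<xi> * of_real ((1 + \<xi>\<^sup>2) powr (s / 2)))
     * (cis (phase a t x \<xi>) * of_real (amplitude a (s / 2) (t powr \<gamma>) \<xi>))"
    by (simp add: amplitude_def)
qed

lemma borel_measurable_P [measurable]:
  assumes [measurable]: "fourier f \<in> borel_measurable borel" "t \<in> borel_measurable M" "x \<in> borel_measurable M"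
  shows "(\<lambda>w. P a \<gamma> (t w) f (x w)) \<in> borel_measurable M"
  unfolding P_eq[where s = 0] by measurable

lemma weighted_fourier_square:
  "(norm (fourier f \<xi> * of_real ((1 + \<xi>\<^sup>2) powr (s / 2))))\<^sup>2 = (1 + \<xi>\<^sup>2) powr s * (cmod (fourier f \<xi>))\<^sup>2"
proof -
  have "((1 + \<xi>\<^sup>2) powr (s / 2))\<^sup>2 = (1 + \<xi>\<^sup>2) powr s"
    by (simp add: power2_eq_square flip: powr_add)
  then show ?thesis by (simp add: norm_mult power_mult_distrib)
qed

text \<open>The multiplier at \<open>x\<close> times the conjugate one at \<open>y\<close> is the
  kernel integrand with \<tau> = t x - t y and c = (t x)^\<gamma> + (t y)^\<gamma>. As both times
  are positive, |\<tau>| is at most the larger one, which gives |\<tau>|^\<gamma> <= c.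
  \<open>t0\<close> supplies the integrable majorant, and \<open>D\<close> does not depend on
  it.\<close>

lemma P_linearized_bound:
  fixes a \<gamma> s C \<beta> D t0 :: real and t :: "real \<Rightarrow> real"
  assumes a: "1 < a" and \<gamma>: "0 < \<gamma>" and s: "0 < s" and C: "0 \<le> C"
    and kernel: "\<And>\<tau> c x. \<lbrakk>\<bar>\<tau>\<bar> powr \<gamma> \<le> c; 0 < c; x \<noteq> 0; \<bar>x\<bar> \<le> 2\<rbrakk> \<Longrightarrow>
       norm (\<integral>\<xi>. cis (phase a \<tau> x \<xi>) * of_real (amplitude a s c \<xi>) \<partial>lborel) \<le> C * \<bar>x\<bar> powr (- \<beta>)"
    and D: "0 < D" "(\<integral>\<^sup>+z\<in>{-2..2}. ennreal (C * \<bar>z\<bar> powr (- \<beta>)) \<partial>lborel) \<le> ennreal D"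
    and f [measurable]: "fourier f \<in> borel_measurable borel"
    and fin: "integrable lborel (\<lambda>\<xi>. (1 + \<xi>\<^sup>2) powr s * (cmod (fourier f \<xi>))\<^sup>2)"
    and t [measurable]: "t \<in> borel_measurable borel" and t0: "0 < t0" "\<And>x. t0 \<le> t x"
  shows "(\<integral>\<^sup>+x\<in>{-1..1}. ennreal ((cmod (P a \<gamma> (t x) f x))\<^sup>2) \<partial>lborel)
    \<le> ennreal D * (\<integral>\<^sup>+\<xi>. ennreal ((1 + \<xi>\<^sup>2) powr s * (cmod (fourier f \<xi>))\<^sup>2) \<partial>lborel)"
  unfolding P_eq[of a \<gamma> _ f _ s] weighted_fourier_square[symmetric]
proof (rule TT_star_bound[where b = "\<lambda>\<xi>. exp (- (t0 powr \<gamma>) * \<bar>\<xi>\<bar> powr a)" and k = "\<lambda>z. C * \<bar>z\<bar> powr (- \<beta>)"])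
  show "integrable lborel (\<lambda>\<xi>. exp (- (t0 powr \<gamma>) * \<bar>\<xi>\<bar> powr a))"
    using a t0 by (intro integrable_exp_abs_powr) simp_all
  show "norm (cis (phase a (t x) x \<xi>) * of_real (amplitude a (s / 2) (t x powr \<gamma>) \<xi>))
      \<le> exp (- (t0 powr \<gamma>) * \<bar>\<xi>\<bar> powr a)" for x \<xi>
  proof -
    have "amplitude a (s / 2) (t x powr \<gamma>) \<xi> \<le> exp (- (t x powr \<gamma>) * \<bar>\<xi>\<bar> powr a)"
      using s by (intro amplitude_le_exp) simp
    also have "\<dots> \<le> exp (- (t0 powr \<gamma>) * \<bar>\<xi>\<bar> powr a)"
      using t0 \<gamma> by (simp add: powr_mono2 mult_right_mono)
    finally show ?thesis by (simp add: norm_mult)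
  qed
  show "integrable lborel (\<lambda>\<xi>. (norm (fourier f \<xi> * of_real ((1 + \<xi>\<^sup>2) powr (s / 2))))\<^sup>2)"
    unfolding weighted_fourier_square by (rule fin)
  fix x y :: real assume xy: "x \<in> {-1..1}" "y \<in> {-1..1}" "x \<noteq> y"
  have tp: "0 < t x" for x using t0(1) t0(2)[of x] by linarith
  define c where "c = t x powr \<gamma> + t y powr \<gamma>"
  have "cis (phase a (t x) x \<xi>) * of_real (amplitude a (s / 2) (t x powr \<gamma>) \<xi>)
     * cnj (cis (phase a (t y) y \<xi>) * of_real (amplitude a (s / 2) (t y powr \<gamma>) \<xi>))
     = cis (phase a (t x - t y) (x - y) \<xi>) * of_real (amplitude a s c \<xi>)" for \<xi>
  proof -
    have "amplitude a (s / 2) (t x powr \<gamma>) \<xi> * amplitude a (s / 2) (t y powr \<gamma>) \<xi>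
      = exp (- (t x powr \<gamma>) * \<bar>\<xi>\<bar> powr a) * exp (- (t y powr \<gamma>) * \<bar>\<xi>\<bar> powr a)
        * ((1 + \<xi>\<^sup>2) powr (- (s / 2)) * (1 + \<xi>\<^sup>2) powr (- (s / 2)))"
      by (simp only: amplitude_def mult_ac)
    also have "\<dots> = amplitude a s c \<xi>"
      by (simp add: amplitude_def c_def algebra_simps flip: exp_add powr_add)
    finally have A: "complex_of_real (amplitude a (s / 2) (t x powr \<gamma>) \<xi>) * of_real (amplitude a (s / 2) (t y powr \<gamma>) \<xi>)
       = of_real (amplitude a s c \<xi>)" by (simp flip: of_real_mult)
    have "phase a (t x) x \<xi> + - phase a (t y) y \<xi> = phase a (t x - t y) (x - y) \<xi>"
      by (simp add: phase_def algebra_simps)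
    then have "cis (phase a (t x) x \<xi>) * cnj (cis (phase a (t y) y \<xi>)) = cis (phase a (t x - t y) (x - y) \<xi>)"
      by (simp only: cis_cnj cis_mult)
    with A show ?thesis by (simp add: mult_ac)
  qed
  moreover have "norm (\<integral>\<xi>. cis (phase a (t x - t y) (x - y) \<xi>) * of_real (amplitude a s c \<xi>) \<partial>lborel)
     \<le> C * \<bar>x - y\<bar> powr (- \<beta>)"
  proof (rule kernel)
    have "\<bar>t x - t y\<bar> powr \<gamma> \<le> max (t x) (t y) powr \<gamma>"
      using tp[of x] tp[of y] \<gamma> by (intro powr_mono2) auto
    also have "\<dots> \<le> c" by (simp add: c_def max_def)
    finally show "\<bar>t x - t y\<bar> powr \<gamma> \<le> c" .
    show "0 < c" using tp by (simp add: c_def add_pos_nonneg order_less_imp_not_eq2)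
  qed (use xy in auto)
  ultimately show "norm (\<integral>\<xi>. cis (phase a (t x) x \<xi>) * of_real (amplitude a (s / 2) (t x powr \<gamma>) \<xi>)
     * cnj (cis (phase a (t y) y \<xi>) * of_real (amplitude a (s / 2) (t y powr \<gamma>) \<xi>)) \<partial>lborel) \<le> C * \<bar>x - y\<bar> powr (- \<beta>)"
    by simp
qed (use C D in simp_all)

text \<open>This allows the supremum over times to be taken over rational ones. The condition r n >=
  t / 2 provides a common damping b <= 1, and |F| b <= |F|^2 + b is integrable for the transform F
  of \<open>f\<close>.\<close>

lemma P_continuous_in_time:
  assumes a: "1 < a" and \<gamma>: "0 < \<gamma>" and s: "0 < s"
    and f [measurable]: "fourier f \<in> borel_measurable borel"
    and fin: "integrable lborel (\<lambda>\<xi>. (1 + \<xi>\<^sup>2) powr s * (cmod (fourier f \<xi>))\<^sup>2)"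
    and t: "0 < t" and r: "r \<longlonglongrightarrow> t" "\<And>n. t / 2 \<le> r n"
  shows "(\<lambda>n. P a \<gamma> (r n) f x) \<longlonglongrightarrow> P a \<gamma> t f x"
  unfolding P_def
proof (rule integral_dominated_convergence)
  let ?b = "\<lambda>\<xi>. exp (- ((t / 2) powr \<gamma>) * \<bar>\<xi>\<bar> powr a)"
  show "integrable lborel (\<lambda>\<xi>. cmod (fourier f \<xi>) * ?b \<xi>)"
  proof (rule Bochner_Integration.integrable_bound)
    show "integrable lborel (\<lambda>\<xi>. (1 + \<xi>\<^sup>2) powr s * (cmod (fourier f \<xi>))\<^sup>2 + ?b \<xi>)"
      using a t by (intro Bochner_Integration.integrable_add fin integrable_exp_abs_powr) simp_all
    show "AE \<xi> in lborel. norm (cmod (fourier f \<xi>) * ?b \<xi>) \<le> norm ((1 + \<xi>\<^sup>2) powr s * (cmod (fourier f \<xi>))\<^sup>2 + ?b \<xi>)"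
    proof (rule AE_I2)
      fix \<xi> :: real
      have b: "0 \<le> ?b \<xi>" "?b \<xi> \<le> 1" by simp_all
      have "1 powr s \<le> (1 + \<xi>\<^sup>2) powr s" using s by (intro powr_mono2) simp_all
      then have "1 * (cmod (fourier f \<xi>))\<^sup>2 \<le> (1 + \<xi>\<^sup>2) powr s * (cmod (fourier f \<xi>))\<^sup>2"
        by (intro mult_right_mono) simp_all
      moreover have "2 * cmod (fourier f \<xi>) * ?b \<xi> \<le> (cmod (fourier f \<xi>))\<^sup>2 + (?b \<xi>)\<^sup>2" by (rule sum_squares_bound)
      moreover have "(?b \<xi>)\<^sup>2 \<le> ?b \<xi>" using b by (simp only: power2_eq_square mult_left_le)
      moreover have "0 \<le> cmod (fourier f \<xi>) * ?b \<xi>" by simp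
      ultimately show "norm (cmod (fourier f \<xi>) * ?b \<xi>) \<le> norm ((1 + \<xi>\<^sup>2) powr s * (cmod (fourier f \<xi>))\<^sup>2 + ?b \<xi>)"
        unfolding real_norm_def by linarith
    qed
  qed simp
  show "AE \<xi> in lborel. (\<lambda>n. fourier f \<xi> * exp (\<i> * of_real (r n * \<bar>\<xi>\<bar> powr a))
      * of_real (exp (- (r n powr \<gamma>) * \<bar>\<xi>\<bar> powr a)) * exp (\<i> * of_real (x * \<xi>)))
     \<longlonglongrightarrow> fourier f \<xi> * exp (\<i> * of_real (t * \<bar>\<xi>\<bar> powr a))
      * of_real (exp (- (t powr \<gamma>) * \<bar>\<xi>\<bar> powr a)) * exp (\<i> * of_real (x * \<xi>))"
    using t by (intro AE_I2 tendsto_intros r) simp_all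
  show "AE \<xi> in lborel. norm (fourier f \<xi> * exp (\<i> * of_real (r n * \<bar>\<xi>\<bar> powr a))
      * of_real (exp (- (r n powr \<gamma>) * \<bar>\<xi>\<bar> powr a)) * exp (\<i> * of_real (x * \<xi>))) \<le> cmod (fourier f \<xi>) * ?b \<xi>" for n
  proof (rule AE_I2)
    fix \<xi> :: real
    have "exp (- (r n powr \<gamma>) * \<bar>\<xi>\<bar> powr a) \<le> ?b \<xi>"
      using t \<gamma> r(2)[of n] by (simp add: powr_mono2 mult_right_mono)
    then show "norm (fourier f \<xi> * exp (\<i> * of_real (r n * \<bar>\<xi>\<bar> powr a))
      * of_real (exp (- (r n powr \<gamma>) * \<bar>\<xi>\<bar> powr a)) * exp (\<i> * of_real (x * \<xi>))) \<le> cmod (fourier f \<xi>) * ?b \<xi>"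
      by (simp add: norm_mult mult_left_mono)
  qed
qed measurable

text \<open>For an increasing sequence, both indices of a product may be raised to their
  maximum.\<close>

lemma SUP_square_le:
  fixes h :: "nat \<Rightarrow> ennreal"
  assumes "incseq h"
  shows "(SUP n. h n)\<^sup>2 \<le> (SUP n. (h n)\<^sup>2)"
proof -
  have "(SUP n. h n)\<^sup>2 = (SUP m. SUP n. h n * h m)"
    by (simp add: power2_eq_square SUP_mult_left_ennreal SUP_mult_right_ennreal)
  also have "\<dots> \<le> (SUP n. (h n)\<^sup>2)"
  proof (intro SUP_least)
    fix m n
    have "h n * h m \<le> h (max m n) * h (max m n)"
      using assms by (intro mult_mono) (simp_all add: incseqD)
    then show "h n * h m \<le> (SUP n. (h n)\<^sup>2)"
      by (intro SUP_upper2[of "max m n"]) (simp_all add: power2_eq_square)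
  qed
  finally show ?thesis .
qed

text \<open>The rational times are exhausted by finite sets. On each of them a measurable maximiser
  turns the maximum into a linearised operator, the bound for which is the same for all sets, and
  monotone convergence yields the supremum.\<close>

lemma P_max_square_bound:
  fixes a \<gamma> s D :: real
  assumes a: "1 < a" and \<gamma>: "0 < \<gamma>" and s: "0 < s" and D: "0 < D"
    and f [measurable]: "fourier f \<in> borel_measurable borel"
    and linearized: "\<And>t t0. \<lbrakk>integrable lborel (\<lambda>\<xi>. (1 + \<xi>\<^sup>2) powr s * (cmod (fourier f \<xi>))\<^sup>2);
        t \<in> borel_measurable borel; 0 < t0; \<And>x. t0 \<le> t x\<rbrakk> \<Longrightarrow>
      (\<integral>\<^sup>+x\<in>{-1..1}. ennreal ((cmod (P a \<gamma> (t x) f x))\<^sup>2) \<partial>lborel)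
        \<le> ennreal D * (\<integral>\<^sup>+\<xi>. ennreal ((1 + \<xi>\<^sup>2) powr s * (cmod (fourier f \<xi>))\<^sup>2) \<partial>lborel)"
  shows "(\<integral>\<^sup>+x\<in>{-1..1}. (P_max a \<gamma> f x)\<^sup>2 \<partial>lborel)
    \<le> ennreal D * (\<integral>\<^sup>+\<xi>. ennreal ((1 + \<xi>\<^sup>2) powr s * (cmod (fourier f \<xi>))\<^sup>2) \<partial>lborel)"
    (is "_ \<le> ennreal D * ?N")
proof (cases "?N = \<infinity>")
  case True
  then show ?thesis using D by (simp add: ennreal_mult_top)
next
  case False
  then have fin: "integrable lborel (\<lambda>\<xi>. (1 + \<xi>\<^sup>2) powr s * (cmod (fourier f \<xi>))\<^sup>2)"
    by (intro integrableI_nonneg) (auto simp: less_top)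
  define R where "R = {0<..<1::real} \<inter> \<rat>"
  have "1 / 2 \<in> R" by (simp add: R_def)
  then have "R \<noteq> {}" by blast
  moreover have "countable R" unfolding R_def by (rule countable_subset[OF _ countable_rat]) simp
  ultimately have R: "R \<noteq> {}" "countable R" .
  define F where "F n = from_nat_into R ` {..n::nat}" for n
  have FR: "F n \<subseteq> R" "finite (F n)" "F n \<noteq> {}" for n
    using from_nat_into[OF R(1)] by (auto simp: F_def)
  define h where "h n x = (SUP r\<in>F n. ennreal (cmod (P a \<gamma> r f x)))" for n x
  have [measurable]: "h n \<in> borel_measurable borel" for n
    unfolding h_def using FR(2)[of n] by (intro borel_measurable_SUP countable_finite) measurable
  have inc: "incseq (\<lambda>n. h n x)" for x
    unfolding h_def by (intro incseq_SucI SUP_subset_mono) (auto simp: F_def)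
  have rat: "ennreal (cmod (P a \<gamma> r f x)) \<le> (SUP n. h n x)" if "r \<in> R" for r x
  proof -
    obtain n where "r = from_nat_into R n" using from_nat_into_surj[OF R(2) \<open>r \<in> R\<close>] by metis
    then have "r \<in> F n" by (auto simp: F_def)
    then have "ennreal (cmod (P a \<gamma> r f x)) \<le> h n x" unfolding h_def by (rule SUP_upper)
    also have "\<dots> \<le> (SUP n. h n x)" by (rule SUP_upper) simp
    finally show ?thesis .
  qed
  have sup: "P_max a \<gamma> f x \<le> (SUP n. h n x)" for x
    unfolding P_max_def
  proof (rule SUP_least)
    fix t :: real assume t: "t \<in> {0<..<1}"
    \<comment> \<open>Approximating from below keeps the rational times in (0, 1); staying above t /
      2 keeps the damping needed for dominated convergence.\<close>
    have "\<exists>q\<in>\<rat>. max (t / 2) (t - inverse (real (Suc n))) < q \<and> q < t" for n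
      using t by (intro Rats_dense_in_real) (simp add: less_imp_le)
    then obtain r where r: "\<And>n. r n \<in> \<rat>" "\<And>n. max (t / 2) (t - inverse (real (Suc n))) < r n" "\<And>n. r n < t"
      by metis
    have lim: "r \<longlonglongrightarrow> t"
    proof (rule tendsto_sandwich)
      show "(\<lambda>n. t - inverse (real (Suc n))) \<longlonglongrightarrow> t"
        using tendsto_diff[OF tendsto_const LIMSEQ_inverse_real_of_nat, of t] by simp
      show "\<forall>\<^sub>F n in sequentially. t - inverse (real (Suc n)) \<le> r n"
        "\<forall>\<^sub>F n in sequentially. r n \<le> t"
        using r(2,3) by (auto intro!: always_eventually less_imp_le)
    qed simp
    have half: "t / 2 \<le> r n" for n using r(2)[of n] by simp
    have "(\<lambda>n. ennreal (cmod (P a \<gamma> (r n) f x))) \<longlonglongrightarrow> ennreal (cmod (P a \<gamma> t f x))"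
      using t half lim by (intro tendsto_ennrealI tendsto_norm P_continuous_in_time[OF a \<gamma> s f fin]) simp_all
    moreover have "ennreal (cmod (P a \<gamma> (r n) f x)) \<le> (SUP n. h n x)" for n
    proof (rule rat)
      have "0 < r n" using half[of n] t by simp
      then show "r n \<in> R" using r(1,3)[of n] t by (simp add: R_def)
    qed
    ultimately show "ennreal (cmod (P a \<gamma> t f x)) \<le> (SUP n. h n x)"
      by (intro LIMSEQ_le_const2) blast+
  qed
  have fixed: "(\<integral>\<^sup>+x\<in>{-1..1}. (h n x)\<^sup>2 \<partial>lborel) \<le> ennreal D * ?N" for n
  proof -
    obtain t where t: "t \<in> borel_measurable borel" "\<And>x. t x \<in> F n"
      "\<And>x r. r \<in> F n \<Longrightarrow> cmod (P a \<gamma> r f x) \<le> cmod (P a \<gamma> (t x) f x)"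
      using measurable_argmax[OF FR(2,3), of n "\<lambda>r x. cmod (P a \<gamma> r f x)"] by auto
    have "(\<integral>\<^sup>+x\<in>{-1..1}. (h n x)\<^sup>2 \<partial>lborel) \<le> (\<integral>\<^sup>+x\<in>{-1..1}. ennreal ((cmod (P a \<gamma> (t x) f x))\<^sup>2) \<partial>lborel)"
    proof (intro nn_integral_mono mult_right_mono)
      fix x
      have "h n x \<le> ennreal (cmod (P a \<gamma> (t x) f x))"
        unfolding h_def using t(3) by (intro SUP_least ennreal_leI)
      then have "(h n x)\<^sup>2 \<le> (ennreal (cmod (P a \<gamma> (t x) f x)))\<^sup>2" by (rule power_mono) simp
      then show "(h n x)\<^sup>2 \<le> ennreal ((cmod (P a \<gamma> (t x) f x))\<^sup>2)" by (simp add: ennreal_power)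
    qed simp
    also have "\<dots> \<le> ennreal D * ?N"
    proof (rule linearized[OF fin t(1)])
      \<comment> \<open>This lower bound may shrink as \<open>n\<close> grows, which is harmless
        because \<open>D\<close> does not depend on it.\<close>
      show "0 < Min (F n)" using FR[of n] by (auto simp: R_def)
      show "Min (F n) \<le> t x" for x using FR(2) t(2) by (rule Min_le)
    qed
    finally show ?thesis .
  qed
  have "(\<integral>\<^sup>+x\<in>{-1..1}. (P_max a \<gamma> f x)\<^sup>2 \<partial>lborel) \<le> (\<integral>\<^sup>+x. (SUP n. (h n x)\<^sup>2 * indicator {-1..1} x) \<partial>lborel)"
  proof (rule nn_integral_mono)
    fix x
    have "(P_max a \<gamma> f x)\<^sup>2 \<le> (SUP n. h n x)\<^sup>2" using sup by (intro power_mono) simp_all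
    also have "\<dots> \<le> (SUP n. (h n x)\<^sup>2)" by (rule SUP_square_le[OF inc])
    finally show "(P_max a \<gamma> f x)\<^sup>2 * indicator {-1..1} x \<le> (SUP n. (h n x)\<^sup>2 * indicator {-1..1} x)"
      by (simp add: SUP_mult_right_ennreal[symmetric] mult_right_mono)
  qed
  also have "\<dots> = (SUP n. \<integral>\<^sup>+x\<in>{-1..1}. (h n x)\<^sup>2 \<partial>lborel)"
  proof (rule nn_integral_monotone_convergence_SUP)
    show "incseq (\<lambda>n x. (h n x)\<^sup>2 * indicator {-1..1} x)"
      by (intro incseq_SucI le_funI mult_right_mono power_mono incseq_SucD[OF inc]) simp_all
  qed measurable
  also have "\<dots> \<le> ennreal D * ?N" by (intro SUP_least fixed)
  finally show ?thesis .
qed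

section \<open>Schwartz functions and the upper estimate\<close>

lemma schwartz_imp_continuous:
  assumes "f \<in> schwartz"
  shows "continuous_on UNIV f"
proof -
  have "iter_deriv 0 f differentiable (at x)" for x using assms by (simp add: schwartz_def)
  then have "f differentiable (at x)" for x by (simp add: iter_deriv_def)
  then show ?thesis
    by (simp add: continuous_at_imp_continuous_on differentiable_imp_continuous_within)
qed

lemma borel_measurable_fourier:
  assumes "f \<in> schwartz"
  shows "fourier f \<in> borel_measurable borel"
proof -
  have [measurable]: "f \<in> borel_measurable borel"
    using schwartz_imp_continuous[OF assms] by (rule borel_measurable_continuous_onI)
  show ?thesis unfolding fourier_def by measurable
qed

lemma maximal_estimate:
  fixes a \<gamma> s :: real
  assumes a: "1 < a" and \<gamma>: "0 < \<gamma>" and s: "0 < s" "s < 1 / 2"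
    and s': "1 / 4 < s \<or> s < 1 / 4 \<and> a * (\<gamma> - 1) < 4 * s * \<gamma>"
  shows "\<exists>C::real. \<forall>f\<in>schwartz. L2_norm_on {-1..1} (P_max a \<gamma> f) \<le> ennreal C * sobolev_norm s f"
proof -
  obtain C \<beta> where C: "0 \<le> C" "0 \<le> \<beta>" "\<beta> < 1"
    and kernel: "\<And>\<tau> c x. \<lbrakk>\<bar>\<tau>\<bar> powr \<gamma> \<le> c; 0 < c; x \<noteq> 0; \<bar>x\<bar> \<le> 2\<rbrakk> \<Longrightarrow>
       norm (\<integral>\<xi>. cis (phase a \<tau> x \<xi>) * of_real (amplitude a s c \<xi>) \<partial>lborel) \<le> C * \<bar>x\<bar> powr (- \<beta>)"
    using kernel_bound[OF a \<gamma> s s'] by blast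
  obtain D where D: "0 < D" "(\<integral>\<^sup>+z\<in>{-2..2}. ennreal (C * \<bar>z\<bar> powr (- \<beta>)) \<partial>lborel) \<le> ennreal D"
    using nn_integral_abs_powr_finite[OF C(1,3)] .
  show ?thesis
  proof (intro exI ballI)
    fix f assume "f \<in> schwartz"
    note f = borel_measurable_fourier[OF this]
    have "(\<integral>\<^sup>+x\<in>{-1..1}. (P_max a \<gamma> f x)\<^sup>2 \<partial>lborel)
      \<le> ennreal D * (\<integral>\<^sup>+\<xi>. ennreal ((1 + \<xi>\<^sup>2) powr s * (cmod (fourier f \<xi>))\<^sup>2) \<partial>lborel)"
    proof (rule P_max_square_bound[OF a \<gamma> s(1) D(1) f])
      fix t :: "real \<Rightarrow> real" and t0 :: real
      assume "integrable lborel (\<lambda>\<xi>. (1 + \<xi>\<^sup>2) powr s * (cmod (fourier f \<xi>))\<^sup>2)"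
        "t \<in> borel_measurable borel" "0 < t0" "\<And>x. t0 \<le> t x"
      then show "(\<integral>\<^sup>+x\<in>{-1..1}. ennreal ((cmod (P a \<gamma> (t x) f x))\<^sup>2) \<partial>lborel)
        \<le> ennreal D * (\<integral>\<^sup>+\<xi>. ennreal ((1 + \<xi>\<^sup>2) powr s * (cmod (fourier f \<xi>))\<^sup>2) \<partial>lborel)"
        using a \<gamma> s(1) C(1) kernel D f by (intro P_linearized_bound[where C = C and \<beta> = \<beta>])
    qed
    then show "L2_norm_on {-1..1} (P_max a \<gamma> f) \<le> ennreal (sqrt D) * sobolev_norm s f"
      unfolding L2_norm_on_def sobolev_norm_def ennsqrt_cmult[OF D(1), symmetric] by (rule ennsqrt_mono)
  qed
qed

section \<open>Focusing wave packets\<close>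

text \<open>\<open>\<delta>\<close> is the width in frequency: the spatial envelope has width 1 /
  \<delta>, and the transform is a positive Gaussian of width \<delta> centred at
  \<open>N\<close>.\<close>

definition wave_packet :: "real \<Rightarrow> real \<Rightarrow> real \<Rightarrow> complex" where
  "wave_packet N \<delta> x = exp (of_real (- (\<delta> * x)\<^sup>2 / 2) + \<i> * of_real (N * x))"

lemma norm_wave_packet: "norm (wave_packet N \<delta> x) = exp (- (\<delta> * x)\<^sup>2 / 2)"
  by (simp add: wave_packet_def)

text \<open>Polynomial multiples of a packet are closed under differentiation, which reduces the
  Schwartz conditions to bounds for polynomials times Gaussians. The derivative is taken of the
  entire extension and restricted to the real line.\<close>

lemma poly_wave_packet_has_vector_derivative:
  "((\<lambda>x. poly q (of_real x) * wave_packet N \<delta> x) has_vector_derivative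
     poly (pderiv q + q * [:\<i> * of_real N, - of_real (\<delta>\<^sup>2):]) (of_real x) * wave_packet N \<delta> x) (at x)"
proof -
  let ?E = "\<lambda>z. exp (- (of_real \<delta> * z)\<^sup>2 / 2 + \<i> * (of_real N * z))"
  have "((\<lambda>z. poly q z * ?E z) has_field_derivative
     poly (pderiv q + q * [:\<i> * of_real N, - of_real (\<delta>\<^sup>2):]) (of_real x) * ?E (of_real x)) (at (of_real x))"
    by (auto intro!: derivative_eq_intros poly_DERIV simp: algebra_simps power2_eq_square)
  moreover have "(of_real has_vector_derivative (1::complex)) (at x)"
    using has_vector_derivative_of_real[of "\<lambda>x. x" 1 "at x"] by simp
  ultimately have "((\<lambda>z. poly q z * ?E z) \<circ> of_real has_vector_derivative
     1 * (poly (pderiv q + q * [:\<i> * of_real N, - of_real (\<delta>\<^sup>2):]) (of_real x) * ?E (of_real x))) (at x)"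
    by (intro field_vector_diff_chain_at)
  then show ?thesis by (simp add: o_def wave_packet_def)
qed

lemma iter_deriv_wave_packet:
  "\<exists>q. iter_deriv n (wave_packet N \<delta>) = (\<lambda>x. poly q (of_real x) * wave_packet N \<delta> x)"
proof (induction n)
  case 0
  show ?case by (rule exI[of _ 1]) (simp add: iter_deriv_def)
next
  case (Suc n)
  then obtain q where q: "iter_deriv n (wave_packet N \<delta>) = (\<lambda>x. poly q (of_real x) * wave_packet N \<delta> x)" ..
  have "iter_deriv (Suc n) (wave_packet N \<delta>) = (\<lambda>x. vector_derivative (iter_deriv n (wave_packet N \<delta>)) (at x))"
    by (simp add: iter_deriv_def)
  also have "\<dots> = (\<lambda>x. poly (pderiv q + q * [:\<i> * of_real N, - of_real (\<delta>\<^sup>2):]) (of_real x) * wave_packet N \<delta> x)"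
    unfolding q by (rule ext, rule vector_derivative_at[OF poly_wave_packet_has_vector_derivative])
  finally show ?case by blast
qed

lemma power_mult_Gaussian_bounded:
  assumes "0 < \<delta>"
  shows "\<exists>B. \<forall>x::real. \<bar>x\<bar> ^ m * exp (- (\<delta> * x)\<^sup>2 / 2) \<le> B"
proof (cases "m = 0")
  case True
  then show ?thesis by (intro exI[of _ 1]) simp
next
  case False
  define q where "q = real m / 2"
  define K where "K = q powr q * (\<delta>\<^sup>2 / 2) powr (- q)"
  have "\<bar>x\<bar> ^ m * exp (- (\<delta> * x)\<^sup>2 / 2) \<le> K" for x :: real
  proof (cases "x = 0")
    case True
    then show ?thesis using \<open>m \<noteq> 0\<close> by (simp add: K_def power_0_left)
  next
    case x: False
    have u: "(\<delta> * x)\<^sup>2 / 2 = \<delta>\<^sup>2 / 2 * \<bar>x\<bar> powr 2" using x by (simp add: power_mult_distrib)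
    have "exp (- ((\<delta> * x)\<^sup>2 / 2)) \<le> q powr q * ((\<delta> * x)\<^sup>2 / 2) powr (- q)"
      using assms x \<open>m \<noteq> 0\<close> by (intro exp_minus_le_powr) (simp_all add: q_def)
    also have "((\<delta> * x)\<^sup>2 / 2) powr (- q) = (\<delta>\<^sup>2 / 2) powr (- q) * \<bar>x\<bar> powr (- real m)"
      unfolding u powr_mult powr_powr q_def by simp
    also have "\<bar>x\<bar> powr (- real m) = 1 / \<bar>x\<bar> ^ m"
      using x by (simp add: powr_minus_divide powr_realpow)
    finally show ?thesis using x by (simp add: K_def field_simps)
  qed
  then show ?thesis by blast
qed

text \<open>Splitting off the constant coefficient multiplies the remaining polynomial by x, so the
  induction needs the power \<open>m\<close> arbitrary.\<close>

lemma poly_mult_Gaussian_bounded: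
  fixes q :: "complex poly"
  assumes "0 < \<delta>"
  shows "\<exists>B. \<forall>x. \<bar>x\<bar> ^ m * cmod (poly q (of_real x)) * exp (- (\<delta> * x)\<^sup>2 / 2) \<le> B"
proof (induction q arbitrary: m)
  case 0
  show ?case by (rule exI[of _ 0]) simp
next
  case (pCons a q)
  obtain B where B: "\<And>x::real. \<bar>x\<bar> ^ m * exp (- (\<delta> * x)\<^sup>2 / 2) \<le> B"
    using power_mult_Gaussian_bounded[OF assms] by blast
  obtain B' where B': "\<And>x. \<bar>x\<bar> ^ Suc m * cmod (poly q (of_real x)) * exp (- (\<delta> * x)\<^sup>2 / 2) \<le> B'"
    using pCons.IH by blast
  have "\<bar>x\<bar> ^ m * cmod (poly (pCons a q) (of_real x)) * exp (- (\<delta> * x)\<^sup>2 / 2) \<le> cmod a * B + B'" for x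
  proof -
    have "cmod (poly (pCons a q) (of_real x)) \<le> cmod a + \<bar>x\<bar> * cmod (poly q (of_real x))"
      using norm_triangle_ineq[of a "of_real x * poly q (of_real x)"] by (simp add: norm_mult)
    then have "\<bar>x\<bar> ^ m * cmod (poly (pCons a q) (of_real x)) * exp (- (\<delta> * x)\<^sup>2 / 2)
       \<le> \<bar>x\<bar> ^ m * (cmod a + \<bar>x\<bar> * cmod (poly q (of_real x))) * exp (- (\<delta> * x)\<^sup>2 / 2)"
      by (intro mult_left_mono mult_right_mono) simp_all
    also have "\<dots> = cmod a * (\<bar>x\<bar> ^ m * exp (- (\<delta> * x)\<^sup>2 / 2))
       + \<bar>x\<bar> ^ Suc m * cmod (poly q (of_real x)) * exp (- (\<delta> * x)\<^sup>2 / 2)"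
      by (simp add: algebra_simps)
    also have "\<dots> \<le> cmod a * B + B'"
      by (intro add_mono mult_left_mono B B') simp
    finally show ?thesis .
  qed
  then show ?case by blast
qed

lemma wave_packet_schwartz:
  assumes "0 < \<delta>"
  shows "wave_packet N \<delta> \<in> schwartz"
  unfolding schwartz_def
proof (intro CollectI allI conjI)
  fix n
  obtain q where q: "iter_deriv n (wave_packet N \<delta>) = (\<lambda>x. poly q (of_real x) * wave_packet N \<delta> x)"
    using iter_deriv_wave_packet by blast
  show "iter_deriv n (wave_packet N \<delta>) differentiable (at x)" for x
    unfolding q using poly_wave_packet_has_vector_derivative by (rule differentiableI_vector)
  fix m
  obtain B where "\<And>x. \<bar>x\<bar> ^ m * cmod (poly q (of_real x)) * exp (- (\<delta> * x)\<^sup>2 / 2) \<le> B"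
    using poly_mult_Gaussian_bounded[OF assms] by blast
  then show "bounded (range (\<lambda>x. x ^ m *\<^sub>R iter_deriv n (wave_packet N \<delta>) x))"
    by (intro boundedI[of _ B]) (auto simp: q norm_mult norm_wave_packet power_abs mult_ac)
qed

section \<open>Gaussian integrals and the Sobolev norm of a packet\<close>

lemma Gaussian_eq_std_normal_density: "exp (- u\<^sup>2 / 2) = sqrt (2 * pi) * std_normal_density u"
  by (simp add: std_normal_density_def)

lemma integrable_Gaussian: "integrable lborel (\<lambda>u::real. exp (- u\<^sup>2 / 2))"
  unfolding Gaussian_eq_std_normal_density by simp

lemma integral_Gaussian: "(\<integral>u. exp (- u\<^sup>2 / 2) \<partial>lborel) = sqrt (2 * pi)"
  unfolding Gaussian_eq_std_normal_density by simp

lemma nn_integral_Gaussian: "(\<integral>\<^sup>+u. ennreal (exp (- u\<^sup>2 / 2)) \<partial>lborel) = ennreal (sqrt (2 * pi))"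
  using nn_integral_eq_integral[OF integrable_Gaussian] unfolding integral_Gaussian by simp

text \<open>Up to sqrt (2 pi) this is the characteristic function of the standard normal
  distribution.\<close>

lemma fourier_Gaussian:
  "(\<integral>u. of_real (exp (- u\<^sup>2 / 2)) * exp (\<i> * of_real (t * u)) \<partial>lborel) = complex_of_real (sqrt (2 * pi) * exp (- t\<^sup>2 / 2))"
proof -
  have "complex_of_real (exp (- (t\<^sup>2) / 2)) = char std_normal_distribution t"
    by (simp add: char_std_normal_distribution)
  also have "\<dots> = (\<integral>u. std_normal_density u *\<^sub>R exp (\<i> * of_real (t * u)) \<partial>lborel)"
    unfolding char_def by (subst integral_density) simp_all
  finally have "complex_of_real (sqrt (2 * pi)) * of_real (exp (- (t\<^sup>2) / 2))
     = of_real (sqrt (2 * pi)) * (\<integral>u. std_normal_density u *\<^sub>R exp (\<i> * of_real (t * u)) \<partial>lborel)"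
    by simp
  also have "\<dots> = (\<integral>u. of_real (sqrt (2 * pi)) * (std_normal_density u *\<^sub>R exp (\<i> * of_real (t * u))) \<partial>lborel)"
    by (rule integral_mult_right_zero[symmetric])
  also have "\<dots> = (\<integral>u. of_real (exp (- u\<^sup>2 / 2)) * exp (\<i> * of_real (t * u)) \<partial>lborel)"
    unfolding Gaussian_eq_std_normal_density by (simp add: scaleR_conv_of_real mult.assoc)
  finally show ?thesis by simp
qed

lemma fourier_wave_packet:
  assumes "0 < \<delta>"
  shows "fourier (wave_packet N \<delta>) \<xi> = of_real (sqrt (2 * pi) / \<delta> * exp (- ((\<xi> - N) / \<delta>)\<^sup>2 / 2))"
proof -
  have "fourier (wave_packet N \<delta>) \<xi> = (1 / \<delta>) *\<^sub>R (\<integral>u. wave_packet N \<delta> (0 + 1 / \<delta> * u) * exp (- \<i> * of_real ((0 + 1 / \<delta> * u) * \<xi>)) \<partial>lborel)"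
    unfolding fourier_def using assms by (subst lborel_integral_real_affine[where c = "1 / \<delta>" and t = 0]) simp_all
  also have "(\<lambda>u. wave_packet N \<delta> (0 + 1 / \<delta> * u) * exp (- \<i> * of_real ((0 + 1 / \<delta> * u) * \<xi>)))
     = (\<lambda>u. of_real (exp (- u\<^sup>2 / 2)) * exp (\<i> * of_real (((N - \<xi>) / \<delta>) * u)))"
    using assms by (intro ext) (simp add: wave_packet_def algebra_simps diff_divide_distrib flip: exp_of_real exp_add)
  finally show ?thesis
    unfolding fourier_Gaussian by (simp add: scaleR_conv_of_real power_divide power2_commute[of N \<xi>])
qed

text \<open>After \<xi> = N + \<delta> u the weight is at most N^(2 s) (3 + 2 u^2), and the squared
  transform is 2 pi / \<delta>^2 times exp (- u^2). Half of this Gaussian absorbs the weight through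
  3 + 2 u^2 <= 4 exp (u^2 / 2); the other half integrates to sqrt (2 pi).\<close>

lemma sobolev_integral_wave_packet:
  assumes s: "0 \<le> s" "s \<le> 1" and N: "1 \<le> N" and \<delta>: "0 < \<delta>" "\<delta> \<le> N"
  shows "(\<integral>\<^sup>+\<xi>. ennreal ((1 + \<xi>\<^sup>2) powr s * (cmod (fourier (wave_packet N \<delta>) \<xi>))\<^sup>2) \<partial>lborel)
    \<le> ennreal (8 * pi * sqrt (2 * pi) * N powr (2 * s) / \<delta>)"
proof -
  have pt: "(1 + (N + \<delta> * u)\<^sup>2) powr s * (cmod (fourier (wave_packet N \<delta>) (N + \<delta> * u)))\<^sup>2
      \<le> 8 * pi * N powr (2 * s) / \<delta>\<^sup>2 * exp (- u\<^sup>2 / 2)" for u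
  proof -
    have "1 + (N + \<delta> * u)\<^sup>2 \<le> N\<^sup>2 * (3 + 2 * u\<^sup>2)"
    proof -
      have "(N + \<delta> * u)\<^sup>2 \<le> 2 * N\<^sup>2 + 2 * (\<delta> * u)\<^sup>2"
        using sum_squares_bound[of N "\<delta> * u"] by (simp add: power2_sum)
      also have "(\<delta> * u)\<^sup>2 \<le> N\<^sup>2 * u\<^sup>2"
        using \<delta> by (simp add: power_mult_distrib mult_right_mono power_mono)
      finally show ?thesis using one_le_power[OF N, of 2] by (simp add: algebra_simps)
    qed
    then have "(1 + (N + \<delta> * u)\<^sup>2) powr s \<le> (N\<^sup>2 * (3 + 2 * u\<^sup>2)) powr s"
      using s by (intro powr_mono2) simp_all
    also have "\<dots> = N powr (2 * s) * (3 + 2 * u\<^sup>2) powr s"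
      using N by (simp add: powr_mult powr_powr flip: powr_numeral)
    also have "(3 + 2 * u\<^sup>2) powr s \<le> (3 + 2 * u\<^sup>2) powr 1"
      using s by (intro powr_mono) simp_all
    also have "(3 + 2 * u\<^sup>2) powr 1 = 3 + 2 * u\<^sup>2" by simp
    also have "\<dots> \<le> 4 * exp (u\<^sup>2 / 2)"
      using exp_ge_add_one_self[of "u\<^sup>2 / 2"] by linarith
    finally have A: "(1 + (N + \<delta> * u)\<^sup>2) powr s \<le> N powr (2 * s) * (4 * exp (u\<^sup>2 / 2))"
      by (simp add: mult_left_mono)
    have "(N + \<delta> * u - N) / \<delta> = u" using \<delta> by simp
    then have "(cmod (fourier (wave_packet N \<delta>) (N + \<delta> * u)))\<^sup>2 = (sqrt (2 * pi) / \<delta> * exp (- u\<^sup>2 / 2))\<^sup>2"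
      using \<delta> by (simp only: fourier_wave_packet norm_of_real power2_abs)
    also have "\<dots> = 2 * pi / \<delta>\<^sup>2 * (exp (- u\<^sup>2 / 2) * exp (- u\<^sup>2 / 2))"
      by (simp add: power_mult_distrib power_divide power2_eq_square)
    finally have B: "(cmod (fourier (wave_packet N \<delta>) (N + \<delta> * u)))\<^sup>2 = 2 * pi / \<delta>\<^sup>2 * (exp (- u\<^sup>2 / 2) * exp (- u\<^sup>2 / 2))" .
    have "(1 + (N + \<delta> * u)\<^sup>2) powr s * (cmod (fourier (wave_packet N \<delta>) (N + \<delta> * u)))\<^sup>2
       \<le> N powr (2 * s) * (4 * exp (u\<^sup>2 / 2)) * (2 * pi / \<delta>\<^sup>2 * (exp (- u\<^sup>2 / 2) * exp (- u\<^sup>2 / 2)))"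
      unfolding B using A by (rule mult_right_mono) simp
    also have "\<dots> = 8 * pi * N powr (2 * s) / \<delta>\<^sup>2 * exp (- u\<^sup>2 / 2) * (exp (u\<^sup>2 / 2) * exp (- u\<^sup>2 / 2))"
      by (simp add: field_simps)
    also have "exp (u\<^sup>2 / 2) * exp (- u\<^sup>2 / 2) = 1" by (simp flip: exp_add)
    finally show ?thesis by simp
  qed
  have [measurable]: "fourier (wave_packet N \<delta>) \<in> borel_measurable borel"
    unfolding fourier_wave_packet[OF \<delta>(1)] by measurable
  have "(\<integral>\<^sup>+\<xi>. ennreal ((1 + \<xi>\<^sup>2) powr s * (cmod (fourier (wave_packet N \<delta>) \<xi>))\<^sup>2) \<partial>lborel)
     = ennreal \<delta> * (\<integral>\<^sup>+u. ennreal ((1 + (N + \<delta> * u)\<^sup>2) powr s * (cmod (fourier (wave_packet N \<delta>) (N + \<delta> * u)))\<^sup>2) \<partial>lborel)"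
    using \<delta> by (subst nn_integral_real_affine[where c = \<delta> and t = N]) simp_all
  also have "\<dots> \<le> ennreal \<delta> * (\<integral>\<^sup>+u. ennreal (8 * pi * N powr (2 * s) / \<delta>\<^sup>2) * ennreal (exp (- u\<^sup>2 / 2)) \<partial>lborel)"
    using pt by (intro mult_left_mono nn_integral_mono) (simp_all add: ennreal_leI flip: ennreal_mult)
  also have "\<dots> = ennreal \<delta> * (ennreal (8 * pi * N powr (2 * s) / \<delta>\<^sup>2) * ennreal (sqrt (2 * pi)))"
    by (subst nn_integral_cmult) (simp_all only: nn_integral_Gaussian, measurable)
  also have "\<dots> = ennreal (8 * pi * sqrt (2 * pi) * N powr (2 * s) / \<delta>)"
    using \<delta> by (simp add: power2_eq_square mult_ac flip: ennreal_mult)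
  finally show ?thesis .
qed

text \<open>Rotate by the phase at 0 and take real parts. For |u| <= M the cosine is at least 1/2,
  so the integrand is nonnegative there and [-1, 1] alone contributes r exp (- 1 / 2). For |u| > M
  it is at most exp (- M^2 / 4) exp (- u^2 / 4) in modulus, and the integral of that over the line
  is the subtracted term.\<close>

lemma Gaussian_oscillatory_lower_bound:
  fixes \<theta> \<rho> :: "real \<Rightarrow> real" and M r :: real
  assumes [measurable]: "\<theta> \<in> borel_measurable borel" "\<rho> \<in> borel_measurable borel"
    and \<theta>: "\<And>u. \<bar>u\<bar> \<le> M \<Longrightarrow> \<bar>\<theta> u - \<theta> 0\<bar> \<le> 1"
    and \<rho>: "\<And>u. 0 \<le> \<rho> u" "\<And>u. \<rho> u \<le> 1" "\<And>u. \<bar>u\<bar> \<le> 1 \<Longrightarrow> r \<le> \<rho> u" and r: "0 \<le> r" and M: "1 \<le> M"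
  shows "r * exp (- 1 / 2) - exp (- M\<^sup>2 / 4) * (2 * sqrt pi)
     \<le> norm (\<integral>u. of_real (exp (- u\<^sup>2 / 2)) * (cis (\<theta> u) * of_real (\<rho> u)) \<partial>lborel)"
proof -
  let ?f = "\<lambda>u. complex_of_real (exp (- u\<^sup>2 / 2)) * (cis (\<theta> u) * of_real (\<rho> u))"
  let ?J = "\<lambda>u. exp (- u\<^sup>2 / 2) * (cos (\<theta> u - \<theta> 0) * \<rho> u)"
  let ?low = "\<lambda>u. r * exp (- 1 / 2) / 2 * indicator {-1..1} u - exp (- M\<^sup>2 / 4) * exp (- u\<^sup>2 / 4)"
  have dil: "((\<lambda>u. exp (- (1 / sqrt 2 * u)\<^sup>2 / 2))) = (\<lambda>u::real. exp (- u\<^sup>2 / 4))"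
    by (simp add: power_mult_distrib power_divide)
  have G_int: "integrable lborel (\<lambda>u::real. exp (- u\<^sup>2 / 4))"
    using lborel_integrable_real_affine[OF integrable_Gaussian, of "1 / sqrt 2" 0] dil by simp
  have G: "(\<integral>u. exp (- u\<^sup>2 / 4) \<partial>lborel) = 2 * sqrt pi"
  proof -
    have "sqrt (2 * pi) = 1 / sqrt 2 * (\<integral>u. exp (- u\<^sup>2 / 4) \<partial>lborel)"
      using lborel_integral_real_affine[of "1 / sqrt 2" "\<lambda>u::real. exp (- u\<^sup>2 / 2)" 0] dil integral_Gaussian by simp
    then have "(\<integral>u. exp (- u\<^sup>2 / 4) \<partial>lborel) = sqrt 2 * (sqrt 2 * sqrt pi)"
      by (simp add: real_sqrt_mult field_simps)
    then show ?thesis by simp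
  qed
  have f_int: "integrable lborel ?f"
    by (rule Bochner_Integration.integrable_bound[OF integrable_Gaussian])
       (use \<rho> in \<open>auto simp: norm_mult mult_left_le\<close>)
  have rot: "cnj (cis (\<theta> 0)) * ?f u = of_real (exp (- u\<^sup>2 / 2) * \<rho> u) * cis (\<theta> u - \<theta> 0)" for u
  proof -
    have "cis (\<theta> u - \<theta> 0) = cnj (cis (\<theta> 0)) * cis (\<theta> u)"
      unfolding cis_cnj cis_mult by simp
    then show ?thesis by (simp only: of_real_mult mult_ac)
  qed
  have re: "Re (cnj (cis (\<theta> 0)) * ?f u) = ?J u" for u
    unfolding rot by simp
  have J_int: "integrable lborel ?J"
    unfolding re[symmetric] by (intro integrable_Re integrable_mult_right f_int)
  have low_int: "integrable lborel ?low"
    using G_int by (intro Bochner_Integration.integrable_diff integrable_mult_right) simp_all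
  have "r * exp (- 1 / 2) - exp (- M\<^sup>2 / 4) * (2 * sqrt pi) = (\<integral>u. ?low u \<partial>lborel)"
    using G_int G by simp
  also have "\<dots> \<le> (\<integral>u. ?J u \<partial>lborel)"
  proof (rule integral_mono[OF low_int J_int])
    fix u :: real
    have tail: "0 \<le> exp (- M\<^sup>2 / 4) * exp (- u\<^sup>2 / 4)" by simp
    have half: "1 / 2 \<le> cos (\<theta> u - \<theta> 0)" if "\<bar>u\<bar> \<le> M"
    proof -
      \<comment> \<open>A deviation of at most 1 stays below pi / 3, where the cosine is
        1/2.\<close>
      have "cos (pi / 3) \<le> cos \<bar>\<theta> u - \<theta> 0\<bar>"
        using \<theta>[OF that] pi_gt3 by (intro cos_monotone_0_pi_le) simp_all
      then show ?thesis by (simp add: cos_60)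
    qed
    consider "\<bar>u\<bar> \<le> 1" | "1 < \<bar>u\<bar>" "\<bar>u\<bar> \<le> M" | "M < \<bar>u\<bar>" by linarith
    then show "?low u \<le> ?J u"
    proof cases
      case 1
      then have "exp (- 1 / 2) * (1 / 2 * r) \<le> ?J u"
        using half \<rho> r M abs_square_le_1[of u] by (intro mult_mono) simp_all
      moreover have "?low u = exp (- 1 / 2) * (1 / 2 * r) - exp (- M\<^sup>2 / 4) * exp (- u\<^sup>2 / 4)"
        using 1 by (simp add: indicator_def abs_le_iff)
      ultimately show ?thesis using tail by linarith
    next
      case 2
      then have "0 \<le> ?J u" using half \<rho>(1)[of u] by (intro mult_nonneg_nonneg) simp_all
      moreover have "?low u = - (exp (- M\<^sup>2 / 4) * exp (- u\<^sup>2 / 4))" using 2 by (auto simp: indicator_def)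
      ultimately show ?thesis using tail by linarith
    next
      case 3
      have "M\<^sup>2 \<le> u\<^sup>2" using 3 M by (simp add: abs_le_square_iff[symmetric])
      then have "exp (- u\<^sup>2 / 2) \<le> exp (- M\<^sup>2 / 4) * exp (- u\<^sup>2 / 4)"
        by (simp flip: exp_add)
      moreover have "\<bar>?J u\<bar> \<le> exp (- u\<^sup>2 / 2)"
        using \<rho>(1,2)[of u] by (simp add: abs_mult mult_le_one mult_left_le)
      moreover have "?low u = - (exp (- M\<^sup>2 / 4) * exp (- u\<^sup>2 / 4))" using 3 M by (auto simp: indicator_def)
      ultimately show ?thesis by linarith
    qed
  qed
  also have "\<dots> = Re (cnj (cis (\<theta> 0)) * (\<integral>u. ?f u \<partial>lborel))"
    unfolding re[symmetric] integral_Re[OF integrable_mult_right[OF f_int]] integral_mult_right_zero ..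
  also have "\<dots> \<le> norm (cnj (cis (\<theta> 0)) * (\<integral>u. ?f u \<partial>lborel))" by (rule complex_Re_le_cmod)
  also have "\<dots> = norm (\<integral>u. ?f u \<partial>lborel)" by (simp add: norm_mult)
  finally show ?thesis .
qed


lemma P_wave_packet:
  assumes "0 < \<delta>"
  shows "P a \<gamma> t (wave_packet N \<delta>) x = of_real (sqrt (2 * pi)) *
    (\<integral>u. of_real (exp (- u\<^sup>2 / 2)) * (cis (phase a t x (N + \<delta> * u))
       * of_real (exp (- (t powr \<gamma>) * \<bar>N + \<delta> * u\<bar> powr a))) \<partial>lborel)"
proof -
  let ?h = "\<lambda>\<xi>. fourier (wave_packet N \<delta>) \<xi> * exp (\<i> * of_real (t * \<bar>\<xi>\<bar> powr a))
            * of_real (exp (- (t powr \<gamma>) * \<bar>\<xi>\<bar> powr a)) * exp (\<i> * of_real (x * \<xi>))"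
  let ?g = "\<lambda>u. of_real (exp (- u\<^sup>2 / 2)) * (cis (phase a t x (N + \<delta> * u))
       * of_real (exp (- (t powr \<gamma>) * \<bar>N + \<delta> * u\<bar> powr a)))"
  have h: "\<delta> *\<^sub>R ?h (N + \<delta> * u) = of_real (sqrt (2 * pi)) * ?g u" for u
  proof -
    have "(N + \<delta> * u - N) / \<delta> = u" using assms by simp
    then have "fourier (wave_packet N \<delta>) (N + \<delta> * u) = of_real (sqrt (2 * pi) / \<delta> * exp (- u\<^sup>2 / 2))"
      using assms by (simp only: fourier_wave_packet)
    moreover have "cis (phase a t x \<xi>) = exp (\<i> * of_real (t * \<bar>\<xi>\<bar> powr a)) * exp (\<i> * of_real (x * \<xi>))" for \<xi>
      by (simp add: phase_def cis_conv_exp distrib_left exp_add)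
    ultimately show ?thesis using assms by (simp add: scaleR_conv_of_real)
  qed
  have "P a \<gamma> t (wave_packet N \<delta>) x = \<delta> *\<^sub>R (\<integral>u. ?h (N + \<delta> * u) \<partial>lborel)"
    unfolding P_def using assms by (subst lborel_integral_real_affine[where c = \<delta> and t = N]) simp_all
  also have "\<dots> = (\<integral>u. \<delta> *\<^sub>R ?h (N + \<delta> * u) \<partial>lborel)"
    by (rule integral_scaleR_right[symmetric])
  also have "\<dots> = of_real (sqrt (2 * pi)) * (\<integral>u. ?g u \<partial>lborel)"
    unfolding h by (rule integral_mult_right_zero)
  finally show ?thesis .
qed

text \<open>This position makes \<open>N\<close> stationary, so the deviation is quadratic in
  \<open>R\<close>. The mean value inequality is applied twice, with a bound for the second
  derivative valid on [N / 2, 2 N].\<close>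

lemma phase_quadratic_bound:
  fixes a N R t :: real
  assumes a: "1 < a" and N: "0 < N" and R: "0 \<le> R" "R \<le> N / 2" and t: "0 \<le> t"
    and \<xi>: "\<bar>\<xi> - N\<bar> \<le> R"
  shows "\<bar>phase a t (- (t * a * N powr (a - 1))) \<xi> - phase a t (- (t * a * N powr (a - 1))) N\<bar>
    \<le> t * a * (a - 1) * N powr (a - 2) * 2 powr \<bar>a - 2\<bar> * R\<^sup>2"
proof -
  let ?x = "- (t * a * N powr (a - 1))"
  let ?B = "t * a * (a - 1) * N powr (a - 2) * 2 powr \<bar>a - 2\<bar>"
  interpret oscillatory "{0<..}" "phase a t ?x" "\<lambda>\<xi>. t * a * \<xi> powr (a - 1) + ?x"
    "\<lambda>\<xi>. t * a * (a - 1) * \<xi> powr (a - 2)" "amplitude a 1 0"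
    "\<lambda>\<xi>. - amplitude a 1 0 \<xi> * (0 * a * \<xi> powr (a - 1) + 2 * 1 * \<xi> / (1 + \<xi>\<^sup>2))"
    using a t by (intro oscillatory_phase_amplitude) simp_all
  have S: "\<eta> \<in> {0<..}" if "\<eta> \<in> {N - R..N + R}" for \<eta>
    using that R N by auto
  have in_S: "N \<in> {N - R..N + R}" "\<xi> \<in> {N - R..N + R}" using R \<xi> by auto
  have d2: "norm (t * a * (a - 1) * \<eta> powr (a - 2)) \<le> ?B" if "\<eta> \<in> {N - R..N + R}" for \<eta>
  proof -
    have \<eta>: "N / 2 \<le> \<eta>" "\<eta> \<le> 2 * N" using that R N by auto
    have "(\<eta> / N) powr (a - 2) \<le> 2 powr \<bar>a - 2\<bar>"
    proof (cases "2 \<le> a")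
      case True
      then show ?thesis using \<eta> N by (simp add: powr_mono2 divide_simps)
    next
      case False
      then have "(\<eta> / N) powr (a - 2) \<le> (1 / 2) powr (a - 2)"
        using \<eta> N by (intro powr_mono2') (simp_all add: divide_simps)
      also have "\<dots> = 2 powr \<bar>a - 2\<bar>" using False by (simp add: powr_divide powr_diff)
      finally show ?thesis .
    qed
    then have "\<eta> powr (a - 2) \<le> N powr (a - 2) * 2 powr \<bar>a - 2\<bar>"
      using \<eta> N by (simp add: powr_divide divide_simps mult.commute)
    then have "t * a * (a - 1) * \<eta> powr (a - 2) \<le> t * a * (a - 1) * (N powr (a - 2) * 2 powr \<bar>a - 2\<bar>)"
      using a t by (intro mult_left_mono) simp_all
    then show ?thesis using a t by (simp add: mult.assoc)
  qed
  have B: "0 \<le> ?B" using a t by simp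
  have d1: "norm (t * a * \<eta> powr (a - 1) + ?x) \<le> ?B * R" if \<eta>: "\<eta> \<in> {N - R..N + R}" for \<eta>
  proof -
    have "norm ((t * a * \<eta> powr (a - 1) + ?x) - (t * a * N powr (a - 1) + ?x)) \<le> ?B * norm (\<eta> - N)"
    proof (rule field_differentiable_bound)
      show "((\<lambda>\<eta>. t * a * \<eta> powr (a - 1) + ?x) has_real_derivative t * a * (a - 1) * \<zeta> powr (a - 2))
          (at \<zeta> within {N - R..N + R})" if "\<zeta> \<in> {N - R..N + R}" for \<zeta>
        using that by (intro has_field_derivative_at_within[OF d\<phi>'] S)
    qed (use in_S \<eta> d2 in simp_all)
    also have "\<dots> \<le> ?B * R" using \<eta> B by (intro mult_left_mono) auto
    finally show ?thesis by simp
  qed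
  have "norm (phase a t ?x \<xi> - phase a t ?x N) \<le> ?B * R * norm (\<xi> - N)"
  proof (rule field_differentiable_bound)
    show "(phase a t ?x has_real_derivative t * a * \<zeta> powr (a - 1) + ?x) (at \<zeta> within {N - R..N + R})"
      if "\<zeta> \<in> {N - R..N + R}" for \<zeta>
      using that by (intro has_field_derivative_at_within[OF d\<phi>] S)
  qed (use in_S d1 in simp_all)
  also have "\<dots> \<le> ?B * R * R" using B R \<xi> by (intro mult_left_mono) simp_all
  finally show ?thesis by (simp add: power2_eq_square mult.assoc)
qed


text \<open>The focusing time is at most N^(\<sigma> - a) / a. For frequencies within M times the
  packet width of N, the phase varies by at most A (c M)^2 |x| N^(1 - \<sigma>) <= 1. Within one
  width of N the damping exponent is at most 2^a N^(\<gamma> (\<sigma> - a) + a), hence at most 2^a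
  by \<gamma> \<sigma> <= a (\<gamma> - 1).\<close>

lemma wave_packet_focusing:
  fixes a \<gamma> \<sigma> :: real
  assumes a: "1 < a" and \<gamma>: "0 < \<gamma>" and \<sigma>: "0 < \<sigma>" "\<sigma> \<le> 1" "\<gamma> * \<sigma> \<le> a * (\<gamma> - 1)"
  obtains c C where "0 < c" "c \<le> 1" "0 < C"
    "\<And>N x. \<lbrakk>1 \<le> N; - (N powr (\<sigma> - 1)) \<le> x; x < 0\<rbrakk> \<Longrightarrow>
       \<exists>t\<in>{0<..<1}. C \<le> cmod (P a \<gamma> t (wave_packet N (c * N powr (1 - \<sigma> / 2))) x)"
proof -
  \<comment> \<open>The main term of the Gaussian lower bound, with exp (- 2^a) bounding the damping
    factor from below for |u| <= 1.\<close>
  define E where "E = exp (- (2 powr a)) * exp (- 1 / 2)"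
  \<comment> \<open>Large enough that the tail is at most E / 2, by exp (- M^2 / 4) <= 4 /
    M.\<close>
  define M where "M = max 1 (16 * sqrt pi / E)"
  define A where "A = (a - 1) * 2 powr \<bar>a - 2\<bar>"
  \<comment> \<open>The first entry keeps M times the packet width below N / 2, so those frequencies
    stay away from 0; the second gives A (c M)^2 <= 1.\<close>
  define c where "c = min (1 / (2 * M)) (1 / (M * sqrt A))"
  have E: "0 < E" by (simp add: E_def)
  have M: "1 \<le> M" "16 * sqrt pi \<le> M * E" using E by (simp_all add: M_def max_def field_simps)
  have A: "0 < A" using a by (simp add: A_def)
  have c: "0 < c" using M A by (simp add: c_def)
  have cM: "c * M \<le> 1 / 2"
  proof -
    have "c * M \<le> 1 / (2 * M) * M" using M by (intro mult_right_mono) (simp_all add: c_def)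
    then show ?thesis using M by simp
  qed
  have cMA: "A * (c * M)\<^sup>2 \<le> 1"
  proof -
    have "c * M \<le> 1 / (M * sqrt A) * M" using M by (intro mult_right_mono) (simp_all add: c_def)
    then have "c * M \<le> 1 / sqrt A" using M by simp
    then have "(c * M)\<^sup>2 \<le> (1 / sqrt A)\<^sup>2" using c M by (intro power_mono) simp_all
    then show ?thesis using A by (simp add: power_divide field_simps)
  qed
  have "c * 1 \<le> c * M" using c M by (intro mult_left_mono) simp_all
  then have c1: "c \<le> 1" using cM by simp
  have tail: "exp (- M\<^sup>2 / 4) * (2 * sqrt pi) \<le> E / 2"
  proof -
    have "M * 1 \<le> M * M" using M by (intro mult_left_mono) simp_all
    then have "M / 4 \<le> exp (M\<^sup>2 / 4)" using exp_ge_add_one_self[of "M\<^sup>2 / 4"] by (simp only: power2_eq_square)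
    then have "exp (- M\<^sup>2 / 4) \<le> 4 / M" using M by (simp add: exp_minus field_simps)
    then have "exp (- M\<^sup>2 / 4) * (2 * sqrt pi) \<le> 4 / M * (2 * sqrt pi)" by (intro mult_right_mono) simp_all
    also have "\<dots> \<le> E / 2" using M by (simp add: field_simps)
    finally show ?thesis .
  qed
  show ?thesis
  proof (rule that[OF c c1])
    show "0 < sqrt (2 * pi) * (E / 2)" using E by simp
    fix N x :: real
    assume N: "1 \<le> N" and x: "- (N powr (\<sigma> - 1)) \<le> x" "x < 0"
    define t where "t = - x / (a * N powr (a - 1))"
    define \<delta> where "\<delta> = c * N powr (1 - \<sigma> / 2)"
    have \<delta>: "0 < \<delta>" using c N by (simp add: \<delta>_def)
    have x_eq: "x = - (t * a * N powr (a - 1))" using a N by (simp add: t_def)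
    have t: "0 < t" unfolding t_def using a N x by (intro divide_pos_pos mult_pos_pos) simp_all
    have ta: "t \<le> N powr (\<sigma> - a) / a"
    proof -
      have "N powr (\<sigma> - a) * N powr (a - 1) = N powr (\<sigma> - 1)" by (simp flip: powr_add)
      then have "- x \<le> N powr (\<sigma> - a) * N powr (a - 1)" using x by simp
      then show ?thesis using a N by (simp add: t_def divide_simps mult_ac)
    qed
    have "N powr (\<sigma> - a) \<le> N powr 0" using N \<sigma> a by (intro powr_mono) simp_all
    then have "N powr (\<sigma> - a) / a < 1" "N powr (\<sigma> - a) / a \<le> N powr (\<sigma> - a)"
      using a N by (simp_all add: divide_simps)
    with ta have t1: "t < 1" "t \<le> N powr (\<sigma> - a)" by linarith+
    have \<delta>M: "\<delta> * M \<le> N / 2"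
    proof -
      have "N powr (1 - \<sigma> / 2) \<le> N powr 1" using N \<sigma> by (intro powr_mono) simp_all
      then have "c * M * N powr (1 - \<sigma> / 2) \<le> 1 / 2 * N" using N cM by (intro mult_mono) simp_all
      then show ?thesis by (simp add: \<delta>_def mult_ac)
    qed
    have "\<delta> * 1 \<le> \<delta> * M" using M \<delta> by (intro mult_left_mono) simp_all
    then have \<delta>N: "\<delta> \<le> N / 2" using \<delta>M by linarith
    let ?\<theta> = "\<lambda>u. phase a t x (N + \<delta> * u)"
    let ?\<rho> = "\<lambda>u. exp (- (t powr \<gamma>) * \<bar>N + \<delta> * u\<bar> powr a)"
    have "exp (- (2 powr a)) * exp (- 1 / 2) - exp (- M\<^sup>2 / 4) * (2 * sqrt pi)
      \<le> norm (\<integral>u. of_real (exp (- u\<^sup>2 / 2)) * (cis (?\<theta> u) * of_real (?\<rho> u)) \<partial>lborel)"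
    proof (rule Gaussian_oscillatory_lower_bound)
      fix u :: real
      show "\<bar>?\<theta> u - ?\<theta> 0\<bar> \<le> 1" if u: "\<bar>u\<bar> \<le> M"
      proof -
        have "\<bar>?\<theta> u - phase a t x N\<bar> \<le> t * a * (a - 1) * N powr (a - 2) * 2 powr \<bar>a - 2\<bar> * (\<delta> * M)\<^sup>2"
          unfolding x_eq using a N \<delta> \<delta>M t M u
          by (intro phase_quadratic_bound) (simp_all add: abs_mult mult_left_mono)
        also have "\<dots> = t * a * N powr (a - 1) * (A * (c * M)\<^sup>2) * (N powr (- 1) * (N powr (1 - \<sigma> / 2))\<^sup>2)"
        proof -
          have "N powr (a - 2) = N powr (a - 1) * N powr (- 1)" unfolding powr_add[symmetric] by (rule arg_cong) simp
          then show ?thesis by (simp add: A_def \<delta>_def power_mult_distrib mult_ac)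
        qed
        also have "N powr (- 1) * (N powr (1 - \<sigma> / 2))\<^sup>2 = N powr (1 - \<sigma>)"
          unfolding power2_eq_square powr_add[symmetric] by (rule arg_cong) simp
        also have "t * a * N powr (a - 1) * (A * (c * M)\<^sup>2) * N powr (1 - \<sigma>)
           \<le> N powr (\<sigma> - 1) * 1 * N powr (1 - \<sigma>)"
          using x x_eq cMA A a t by (intro mult_right_mono mult_mono) simp_all
        also have "\<dots> = 1" using N by (simp flip: powr_add)
        finally show ?thesis by simp
      qed
      show "exp (- (2 powr a)) \<le> ?\<rho> u" if u: "\<bar>u\<bar> \<le> 1"
      proof -
        have "\<delta> * \<bar>u\<bar> \<le> \<delta> * 1" using u \<delta> by (intro mult_left_mono) simp_all
        moreover have "\<bar>N + \<delta> * u\<bar> \<le> N + \<delta> * \<bar>u\<bar>" using N \<delta> by (simp add: abs_mult order_trans[OF abs_triangle_ineq])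
        ultimately have "\<bar>N + \<delta> * u\<bar> \<le> 2 * N" using \<delta>N N by linarith
        then have "t powr \<gamma> * \<bar>N + \<delta> * u\<bar> powr a \<le> (N powr (\<sigma> - a)) powr \<gamma> * (2 * N) powr a"
          using t t1 \<gamma> a by (intro mult_mono powr_mono2) simp_all
        also have "\<dots> = 2 powr a * N powr ((\<sigma> - a) * \<gamma> + a)"
          by (simp add: powr_powr powr_mult powr_add)
        also have "N powr ((\<sigma> - a) * \<gamma> + a) \<le> N powr 0"
          using N \<sigma>(3) by (intro powr_mono) (simp_all add: algebra_simps)
        then have "2 powr a * N powr ((\<sigma> - a) * \<gamma> + a) \<le> 2 powr a" using N by simp
        finally show ?thesis by simp
      qed
    qed (use M in simp_all)
    also have "norm (\<integral>u. of_real (exp (- u\<^sup>2 / 2)) * (cis (?\<theta> u) * of_real (?\<rho> u)) \<partial>lborel) =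
        cmod (P a \<gamma> t (wave_packet N \<delta>) x) / sqrt (2 * pi)"
      unfolding P_wave_packet[OF \<delta>] by (simp add: norm_mult)
    finally have "E / 2 \<le> cmod (P a \<gamma> t (wave_packet N \<delta>) x) / sqrt (2 * pi)"
      using tail unfolding E_def by linarith
    then have "sqrt (2 * pi) * (E / 2) \<le> cmod (P a \<gamma> t (wave_packet N \<delta>) x)"
      by (simp add: pos_le_divide_eq mult.commute)
    then show "\<exists>t\<in>{0<..<1}. sqrt (2 * pi) * (E / 2) \<le> cmod (P a \<gamma> t (wave_packet N (c * N powr (1 - \<sigma> / 2))) x)"
      using t t1 unfolding \<delta>_def by (intro bexI[of _ t]) simp_all
  qed
qed

lemma ennsqrt_ennreal: "0 \<le> r \<Longrightarrow> ennsqrt (ennreal r) = ennreal (sqrt r)"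
  by (simp add: ennsqrt_def)

text \<open>The maximal function is at least \<open>B\<close> on an interval of length N^(\<sigma> -
  1), while the squared Sobolev norm is at most a multiple of N^(2 s) / N^(1 - \<sigma> / 2). The
  estimate would thus keep N^(\<sigma> / 2 - 2 s) bounded, although the exponent is
  positive.\<close>

lemma no_maximal_estimate:
  fixes a \<gamma> s \<sigma> C :: real
  assumes a: "1 < a" and \<gamma>: "0 < \<gamma>" and \<sigma>: "0 < \<sigma>" "\<sigma> \<le> 1" "\<gamma> * \<sigma> \<le> a * (\<gamma> - 1)"
    and s: "0 < s" "4 * s < \<sigma>"
    and est: "\<And>f. f \<in> schwartz \<Longrightarrow> L2_norm_on {-1..1} (P_max a \<gamma> f) \<le> ennreal C * sobolev_norm s f"
  shows False
proof -
  obtain c B where c: "0 < c" "c \<le> 1" and B: "0 < B"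
    and foc: "\<And>N x. \<lbrakk>1 \<le> N; - (N powr (\<sigma> - 1)) \<le> x; x < 0\<rbrakk> \<Longrightarrow>
       \<exists>t\<in>{0<..<1}. B \<le> cmod (P a \<gamma> t (wave_packet N (c * N powr (1 - \<sigma> / 2))) x)"
    using wave_packet_focusing[OF a \<gamma> \<sigma>] by blast
  \<comment> \<open>\<open>C\<close> may be negative, in which case \<open>ennreal C\<close> is 0; a
    nonnegative real constant is needed to return to real inequalities.\<close>
  define D where "D = max C 0"
  have D: "0 \<le> D" "ennreal C \<le> ennreal D" by (simp_all add: D_def ennreal_leI)
  define K where "K = D\<^sup>2 * (8 * pi * sqrt (2 * pi) / c) / B\<^sup>2"
  have key: "N powr (\<sigma> / 2 - 2 * s) \<le> K" if N: "1 \<le> N" for N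
  proof -
    define \<delta> where "\<delta> = c * N powr (1 - \<sigma> / 2)"
    define f where "f = wave_packet N \<delta>"
    define X where "X = N powr (\<sigma> - 1)"
    define S where "S = 8 * pi * sqrt (2 * pi) * N powr (2 * s) / \<delta>"
    have \<delta>: "0 < \<delta>" using c N by (simp add: \<delta>_def)
    have "N powr (1 - \<sigma> / 2) \<le> N powr 1" using N \<sigma> by (intro powr_mono) simp_all
    then have "c * N powr (1 - \<sigma> / 2) \<le> 1 * N" using N c by (intro mult_mono) simp_all
    then have \<delta>N: "\<delta> \<le> N" by (simp add: \<delta>_def)
    have "N powr (\<sigma> - 1) \<le> N powr 0" using N \<sigma> by (intro powr_mono) simp_all
    then have X: "0 \<le> X" "X \<le> 1" using N by (simp_all add: X_def)
    have S0: "0 \<le> S" using \<delta> by (simp add: S_def)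
    have f: "f \<in> schwartz" unfolding f_def using \<delta> by (rule wave_packet_schwartz)
    have "ennreal (B\<^sup>2 * X) = (\<integral>\<^sup>+x. ennreal (B\<^sup>2) * indicator {-X..<0} x \<partial>lborel)"
      using X by (simp add: nn_integral_cmult_indicator ennreal_mult)
    also have "\<dots> \<le> (\<integral>\<^sup>+x\<in>{-1..1}. (P_max a \<gamma> f x)\<^sup>2 \<partial>lborel)"
    proof (rule nn_integral_mono)
      fix x :: real
      show "ennreal (B\<^sup>2) * indicator {-X..<0} x \<le> (P_max a \<gamma> f x)\<^sup>2 * indicator {-1..1} x"
      proof (cases "x \<in> {-X..<0}")
        case True
        then obtain t where t: "t \<in> {0<..<1}" "B \<le> cmod (P a \<gamma> t f x)"
          using foc[OF N, of x] by (auto simp: f_def \<delta>_def X_def)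
        have "ennreal B \<le> ennreal (cmod (P a \<gamma> t f x))" using t by (intro ennreal_leI)
        also have "\<dots> \<le> P_max a \<gamma> f x" unfolding P_max_def using t(1) by (rule SUP_upper)
        finally have "(ennreal B)\<^sup>2 \<le> (P_max a \<gamma> f x)\<^sup>2" by (rule power_mono) simp
        then show ?thesis using True X B by (simp add: ennreal_power indicator_def)
      qed simp
    qed
    finally have "ennsqrt (ennreal (B\<^sup>2 * X)) \<le> L2_norm_on {-1..1} (P_max a \<gamma> f)"
      unfolding L2_norm_on_def by (rule ennsqrt_mono)
    also have "\<dots> \<le> ennreal C * sobolev_norm s f" by (rule est[OF f])
    also have "\<dots> \<le> ennreal D * ennsqrt (ennreal S)"
      unfolding sobolev_norm_def f_def S_def
      using s \<sigma> N \<delta> \<delta>N D by (intro mult_mono ennsqrt_mono sobolev_integral_wave_packet) simp_all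
    also have "\<dots> = ennreal (D * sqrt S)"
      using D S0 by (simp add: ennsqrt_ennreal ennreal_mult)
    also have "ennsqrt (ennreal (B\<^sup>2 * X)) = ennreal (sqrt (B\<^sup>2 * X))"
      using X by (intro ennsqrt_ennreal) simp
    finally have "ennreal (sqrt (B\<^sup>2 * X)) \<le> ennreal (D * sqrt S)" .
    then have "sqrt (B\<^sup>2 * X) \<le> D * sqrt S" using D S0 by (subst (asm) ennreal_le_iff) simp_all
    then have "(sqrt (B\<^sup>2 * X))\<^sup>2 \<le> (D * sqrt S)\<^sup>2" using X by (intro power_mono) simp_all
    then have "B\<^sup>2 * X \<le> D\<^sup>2 * S" using X S0 by (simp add: power_mult_distrib)
    also have "S = 8 * pi * sqrt (2 * pi) / c * (N powr (2 * s) / N powr (1 - \<sigma> / 2))"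
      by (simp add: S_def \<delta>_def)
    also have "D\<^sup>2 * (8 * pi * sqrt (2 * pi) / c * (N powr (2 * s) / N powr (1 - \<sigma> / 2)))
       = B\<^sup>2 * (K * (N powr (2 * s) / N powr (1 - \<sigma> / 2)))"
      using B by (simp add: K_def)
    finally have "X \<le> K * (N powr (2 * s) / N powr (1 - \<sigma> / 2))"
      using B by (simp add: mult_le_cancel_left_pos del: times_divide_eq_right)
    then have "X * (N powr (1 - \<sigma> / 2) / N powr (2 * s)) \<le> K"
      using N by (simp add: pos_le_divide_eq pos_divide_le_eq)
    also have "X * (N powr (1 - \<sigma> / 2) / N powr (2 * s)) = N powr (\<sigma> / 2 - 2 * s)"
    proof -
      have "X * (N powr (1 - \<sigma> / 2) / N powr (2 * s)) = N powr (\<sigma> - 1 + (1 - \<sigma> / 2 - 2 * s))"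
        by (simp only: X_def powr_add powr_diff)
      then show ?thesis by simp
    qed
    finally show ?thesis .
  qed
  define e where "e = \<sigma> / 2 - 2 * s"
  have e: "0 < e" using s by (simp add: e_def)
  \<comment> \<open>Chosen so that N^e = max K 0 + 1, which is larger than \<open>K\<close>.\<close>
  define N where "N = (max K 0 + 1) powr (1 / e)"
  have "1 \<le> N" unfolding N_def using e by (intro ge_one_powr_ge_zero) simp_all
  from key[OF this] have "max K 0 + 1 \<le> K" using e by (simp add: N_def powr_powr flip: e_def)
  then show False by simp
qed


section \<open>The critical exponent\<close>

theorem theorem4p1:
  fixes a \<gamma> :: real
  assumes "\<gamma> > 0" and "a > 1"
  shows "s_loc a \<gamma> = ereal (min (1 / 4 * a * max 0 (1 - 1 / \<gamma>)) (1 / 4))"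
proof -
  define s0 where "s0 = min (1 / 4 * a * max 0 (1 - 1 / \<gamma>)) (1 / 4)"
  define A where "A = {s::real. s > 0 \<and> (\<exists>C::real. \<forall>f\<in>schwartz.
    L2_norm_on {-1..1} (P_max a \<gamma> f) \<le> ennreal C * sobolev_norm s f)}"
  have "0 \<le> 1 / 4 * a * max 0 (1 - 1 / \<gamma>)" using assms by simp
  then have s0: "0 \<le> s0" "s0 \<le> 1 / 4" unfolding s0_def by linarith+
  \<comment> \<open>s = 1/4 belongs to neither alternative of the maximal estimate. Exponents are
    therefore taken from (s0, 1/4), or from (1/4, 1/2) if s0 = 1/4; both intervals reach down to s0,
    which is enough for the infimum.\<close>
  have upper: "s \<in> A" if s: "s0 < s" "s < 1 / 2" "s0 < 1 / 4 \<longrightarrow> s < 1 / 4" for s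
  proof -
    have "1 / 4 < s \<or> s < 1 / 4 \<and> a * (\<gamma> - 1) < 4 * s * \<gamma>"
    proof (cases "s0 < 1 / 4")
      case True
      then have "1 / 4 * a * max 0 (1 - 1 / \<gamma>) < s" using s unfolding s0_def by linarith
      moreover have "1 / 4 * a * (1 - 1 / \<gamma>) \<le> 1 / 4 * a * max 0 (1 - 1 / \<gamma>)"
        using assms by (intro mult_left_mono) simp_all
      ultimately have "1 / 4 * a * (1 - 1 / \<gamma>) < s" by linarith
      then have "1 / 4 * a * (1 - 1 / \<gamma>) * \<gamma> < s * \<gamma>" using assms by (intro mult_strict_right_mono)
      also have "1 / 4 * a * (1 - 1 / \<gamma>) * \<gamma> = a * (\<gamma> - 1) / 4" using assms by (simp add: field_simps)
      finally show ?thesis using s True by simp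
    next
      case False
      then show ?thesis using s s0 by simp
    qed
    moreover have "0 < s" using s s0 by linarith
    ultimately show ?thesis using maximal_estimate[of a \<gamma> s] assms s by (simp add: A_def)
  qed
  have lower: "s0 \<le> s" if "s \<in> A" for s
  proof (rule ccontr)
    assume "\<not> s0 \<le> s"
    from that obtain C where s: "0 < s"
      and est: "\<And>f. f \<in> schwartz \<Longrightarrow> L2_norm_on {-1..1} (P_max a \<gamma> f) \<le> ennreal C * sobolev_norm s f"
      by (auto simp: A_def)
    have pos: "0 < s0" using \<open>\<not> s0 \<le> s\<close> s by linarith
    have "max 0 (1 - 1 / \<gamma>) = 1 - 1 / \<gamma>"
      using pos by (cases "0 \<le> 1 - 1 / \<gamma>") (simp_all add: s0_def)
    moreover have "s0 \<le> 1 / 4 * a * max 0 (1 - 1 / \<gamma>)" unfolding s0_def by (rule min.cobounded1)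
    ultimately have "4 * s0 \<le> a * (1 - 1 / \<gamma>)" by linarith
    then have "\<gamma> * (4 * s0) \<le> \<gamma> * (a * (1 - 1 / \<gamma>))" using assms by (intro mult_left_mono) simp_all
    also have "\<dots> = a * (\<gamma> - 1)" using assms by (simp add: field_simps)
    finally have "\<gamma> * (4 * s0) \<le> a * (\<gamma> - 1)" .
    then show False
      using no_maximal_estimate[of a \<gamma> "4 * s0" s C] assms pos s0 s est \<open>\<not> s0 \<le> s\<close> by simp
  qed
  have "Inf (ereal ` A) = ereal s0"
  proof (rule antisym)
    show "ereal s0 \<le> Inf (ereal ` A)" using lower by (auto intro!: Inf_greatest)
    show "Inf (ereal ` A) \<le> ereal s0"
    proof (rule dense_ge)
      fix y assume y: "ereal s0 < y"
      \<comment> \<open>The right end of the interval above s0 on which \<open>upper\<close>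
        applies.\<close>
      define b :: real where "b = (if s0 < 1 / 4 then 1 / 4 else 1 / 2)"
      have "ereal s0 < min y (ereal b)" using y s0 by (simp add: b_def)
      then obtain s where s: "ereal s0 < ereal s" "ereal s < min y (ereal b)"
        using ereal_dense2 by blast
      then have "s \<in> A" by (intro upper) (auto simp: b_def split: if_splits)
      then have "Inf (ereal ` A) \<le> ereal s" by (intro Inf_lower) simp
      also have "\<dots> \<le> y" using s(2) by (simp add: less_imp_le)
      finally show "Inf (ereal ` A) \<le> y" .
    qed
  qed
  then show ?thesis by (simp add: s_loc_def A_def s0_def)
qed

end
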